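(* Let $n,N$ be positive integers, $\alpha_0\neq0,\alpha_2,\ldots,\alpha_{N-1}\in\mathbb{C}$, $M_{\mathrm{Ai}}(x,\partial_x)=\partial_x^N+\sum_{i=2}^{N-1}\alpha_i\partial_x^{N-i}+\alpha_0x$, let $\psi_1,\ldots,\psi_N$ be a basis of its kernel, let $\psi$ be a function in the kernel, and set $\Psi_{\mathrm{Ai}}(x,z):=\psi(x+z)I_n$. The bispectral Darboux transformations from the matrix Airy function $\Psi_{\mathrm{Ai}}(x,z)$, for operators $L,Q,P$ with invertible leading terms, are exactly the functions of the form $$\Phi(x,z)=W(x)P(x,\partial_x)\Psi_{\mathrm{Ai}}(x,z),$$ where $W(x)$ is an invertible $M_n(\mathbb{C})$-valued rational function and $P(x,\partial_x)$ is a monic matrix differential operator of order $dN$ (for some $d$) whose vector kernel is a nondegenerate $ndN$-dimensional space with a basis which is a union of $N$-tuples of the form $$\sum_{j=0}^{N-1}\psi_i^{(j)}(x+\lambda)p_j(x),\qquad i=1,\ldots,N,$$ for some vector-valued polynomials $p_j(x)\in\mathbb{C}[x]^n$ and $\lambda\in\mathbb{C}$. (The polynomials $p_j$ and the complex numbers $\lambda$ can be different for different $N$-tuples of basis elements.)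
   Context: $M_{\mathrm{Ai}}(x,\partial_x)$ is the (generalized) Airy operator; its kernel is $N$-dimensional over $\mathbb{C}$ and consists of entire functions. It is also viewed as a scalar matrix-valued operator. A bispectral Darboux transformation from $\Psi_{\mathrm{Ai}}$ for operators $L,Q,P$ with invertible leading terms means a function $\Phi(x,z)=P(x,\partial_x)\Psi_{\mathrm{Ai}}(x,z)$ arising from a factorization $L(x,\partial_x)=q(M_{\mathrm{Ai}}(x,\partial_x))=Q(x,\partial_x)P(x,\partial_x)$, where $q(t)$ is an $M_n(\mathbb{C})$-valued polynomial, $Q$ and $P$ are $M_n(\mathbb{C})$-valued differential operators with rational coefficients, and the leading coefficients of $L,Q,P$ are invertible matrix-valued functions (determinant not identically zero). The vector kernel of a differential operator $P(x,\partial_x)$ with meromorphic $M_n(\mathbb{C})$-valued coefficients on $\mathbb{C}$ is $\operatorname{vker}P=\{\text{meromorphic } f\colon\mathbb{C}\to\mathbb{C}^n\mid P(x,\partial_x)f(x)=0\}$. A subspace of dimension $nk$ of the space of $\mathbb{C}^n$-valued meromorphic functions is nondegenerate if it has a basis $f_1,\ldots,f_{nk}$ whose Wronski matrix, the $nk\times nk$ matrix with block rows $(f_1^{(i)},\ldots,f_{nk}^{(i)})$, $i=0,\ldots,k-1$, has determinant that is a nonzero meromorphic function. "Monic" means leading coefficient $I_n$.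
   Formalization: The number d may be rational with dN and nd integers: with d an integer the claim fails, e.g. n = N = 2 and the first-order P whose vector kernel is spanned by (ψ_i, ψ_i')^T, i = 1, 2, where d = 1/2. If n and N are coprime, d is automatically an integer. *)

theory Defs
  imports
    "HOL-Complex_Analysis.Complex_Analysis"
    "Jordan_Normal_Form.Determinant"
begin

unbundle no vec_syntax

text \<open>
  Conventions. Meromorphic functions are total functions \<open>complex \<Rightarrow> complex\<close> (the library's
  \<open>meromorphic_on\<close>), whose values at the poles are arbitrary. Equality of meromorphic functions is
  therefore equality off a discrete closed subset of the plane, written \<open>\<forall>\<^sub>\<approx>x. f x = g x\<close>.
  Indices run from \<open>0\<close>.
\<close>

definition mero_vec :: "nat \<Rightarrow> (complex \<Rightarrow> complex vec) \<Rightarrow> bool" where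
  "mero_vec n f \<longleftrightarrow>
     (\<forall>x. f x \<in> carrier_vec n) \<and> (\<forall>r<n. (\<lambda>x. f x $ r) meromorphic_on UNIV)"

definition mero_mat :: "nat \<Rightarrow> (complex \<Rightarrow> complex mat) \<Rightarrow> bool" where
  "mero_mat n A \<longleftrightarrow>
     (\<forall>x. A x \<in> carrier_mat n n) \<and>
     (\<forall>r<n. \<forall>c<n. (\<lambda>x. A x $$ (r, c)) meromorphic_on UNIV)"

definition rational_fun :: "(complex \<Rightarrow> complex) \<Rightarrow> bool" where
  "rational_fun f \<longleftrightarrow>
     (\<exists>p q. q \<noteq> 0 \<and> (\<forall>x. poly q x \<noteq> 0 \<longrightarrow> f x = poly p x / poly q x))"

definition rational_mat :: "nat \<Rightarrow> (complex \<Rightarrow> complex mat) \<Rightarrow> bool" where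
  "rational_mat n A \<longleftrightarrow>
     (\<forall>x. A x \<in> carrier_mat n n) \<and> (\<forall>r<n. \<forall>c<n. rational_fun (\<lambda>x. A x $$ (r, c)))"

text \<open>The determinant is not the zero meromorphic function.\<close>

definition invertible_fun :: "(complex \<Rightarrow> complex mat) \<Rightarrow> bool" where
  "invertible_fun A \<longleftrightarrow> \<not> (\<forall>\<^sub>\<approx>x. Determinant.det (A x) = 0)"

text \<open>
  The nonempty list \<open>[A\<^sub>0, \<dots>, A\<^sub>k]\<close> stands for the matrix differential operator
  \<open>\<Sum>i\<le>k. A\<^sub>i(x) \<partial>\<^sub>x\<^sup>i\<close>. Its order is \<open>k\<close> and its leading coefficient \<open>A\<^sub>k\<close>; this is
  its true order wherever the definitions below ask \<open>A\<^sub>k\<close> to be invertible or the identity.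
\<close>

type_synonym mdo = "(complex \<Rightarrow> complex mat) list"

definition mero_mdo :: "nat \<Rightarrow> mdo \<Rightarrow> bool" where
  "mero_mdo n P \<longleftrightarrow> P \<noteq> [] \<and> (\<forall>A\<in>set P. mero_mat n A)"

definition rational_mdo :: "nat \<Rightarrow> mdo \<Rightarrow> bool" where
  "rational_mdo n P \<longleftrightarrow> P \<noteq> [] \<and> (\<forall>A\<in>set P. rational_mat n A)"

definition mdo_order :: "mdo \<Rightarrow> nat" where
  "mdo_order P = length P - 1"

definition monic_mdo :: "nat \<Rightarrow> mdo \<Rightarrow> bool" where
  "monic_mdo n P \<longleftrightarrow> (\<forall>\<^sub>\<approx>x. last P x = 1\<^sub>m n)"

definition vec_deriv :: "nat \<Rightarrow> nat \<Rightarrow> (complex \<Rightarrow> complex vec) \<Rightarrow> complex \<Rightarrow> complex vec" where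
  "vec_deriv n i f x = Matrix.vec n (\<lambda>r. (deriv ^^ i) (\<lambda>y. f y $ r) x)"

definition mdo_app :: "nat \<Rightarrow> mdo \<Rightarrow> (complex \<Rightarrow> complex vec) \<Rightarrow> complex \<Rightarrow> complex vec" where
  "mdo_app n P f x =
     Matrix.vec n (\<lambda>r. \<Sum>i<length P. ((P ! i) x *\<^sub>v vec_deriv n i f x) $ r)"

text \<open>The action on functions with values in \<open>n \<times> n\<close> matrices is column by column.\<close>

definition mdo_app_mat :: "nat \<Rightarrow> mdo \<Rightarrow> (complex \<Rightarrow> complex mat) \<Rightarrow> complex \<Rightarrow> complex mat" where
  "mdo_app_mat n P F x =
     Matrix.mat n n (\<lambda>(r, c). mdo_app n P (\<lambda>y. col (F y) c) x $ r)"

definition vker :: "nat \<Rightarrow> mdo \<Rightarrow> (complex \<Rightarrow> complex vec) set" where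
  "vker n P = {f. mero_vec n f \<and> (\<forall>\<^sub>\<approx>x. mdo_app n P f x = 0\<^sub>v n)}"

definition lin_comb ::
    "nat \<Rightarrow> nat \<Rightarrow> (nat \<Rightarrow> complex) \<Rightarrow> (nat \<Rightarrow> complex \<Rightarrow> complex vec) \<Rightarrow> complex \<Rightarrow> complex vec" where
  "lin_comb n m a f x = Matrix.vec n (\<lambda>r. \<Sum>j<m. a j * f j x $ r)"

text \<open>
  The family \<open>f 0, \<dots>, f (m - 1)\<close> is a basis of the complex vector space \<open>V\<close> of meromorphic
  \<open>n\<close>-vector functions. The last conjunct says that \<open>V\<close> is the linear span of the family; in
  particular \<open>V\<close> is then a subspace of dimension \<open>m\<close>.
\<close>

definition mero_basis ::
    "nat \<Rightarrow> (complex \<Rightarrow> complex vec) set \<Rightarrow> nat \<Rightarrow> (nat \<Rightarrow> complex \<Rightarrow> complex vec) \<Rightarrow> bool" where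
  "mero_basis n V m f \<longleftrightarrow>
     (\<forall>j<m. mero_vec n (f j)) \<and>
     (\<forall>a. (\<forall>\<^sub>\<approx>x. lin_comb n m a f x = 0\<^sub>v n) \<longrightarrow> (\<forall>j<m. a j = 0)) \<and>
     V = {g. mero_vec n g \<and> (\<exists>a. \<forall>\<^sub>\<approx>x. g x = lin_comb n m a f x)}"

text \<open>Row \<open>i * n + r\<close> of the Wronski matrix is row \<open>r\<close> of its \<open>i\<close>-th block row.\<close>

definition wronski_mat ::
    "nat \<Rightarrow> nat \<Rightarrow> (nat \<Rightarrow> complex \<Rightarrow> complex vec) \<Rightarrow> complex \<Rightarrow> complex mat" where
  "wronski_mat n k f x =
     Matrix.mat (n * k) (n * k) (\<lambda>(a, c). vec_deriv n (a div n) (f c) x $ (a mod n))"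

definition nondegenerate :: "nat \<Rightarrow> nat \<Rightarrow> (complex \<Rightarrow> complex vec) set \<Rightarrow> bool" where
  "nondegenerate n k V \<longleftrightarrow>
     (\<exists>f. mero_basis n V (n * k) f \<and> invertible_fun (wronski_mat n k f))"

text \<open>The values \<open>\<alpha> 1\<close> and \<open>\<alpha> i\<close> with \<open>i \<ge> N\<close> are not used (but \<open>\<alpha> 0\<close> is, also if \<open>N = 1\<close>).\<close>

definition airy_op ::
    "nat \<Rightarrow> (nat \<Rightarrow> complex) \<Rightarrow> (complex \<Rightarrow> complex) \<Rightarrow> complex \<Rightarrow> complex" where
  "airy_op N \<alpha> g x =
     (deriv ^^ N) g x + (\<Sum>i\<in>{2..N-1}. \<alpha> i * (deriv ^^ (N - i)) g x) + \<alpha> 0 * x * g x"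

definition airy_kernel :: "nat \<Rightarrow> (nat \<Rightarrow> complex) \<Rightarrow> (complex \<Rightarrow> complex) set" where
  "airy_kernel N \<alpha> = {g. g holomorphic_on UNIV \<and> (\<forall>x. airy_op N \<alpha> g x = 0)}"

definition airy_basis :: "nat \<Rightarrow> (nat \<Rightarrow> complex) \<Rightarrow> (nat \<Rightarrow> complex \<Rightarrow> complex) \<Rightarrow> bool" where
  "airy_basis N \<alpha> \<psi>s \<longleftrightarrow>
     (\<forall>i<N. \<psi>s i \<in> airy_kernel N \<alpha>) \<and>
     (\<forall>a. (\<forall>x. (\<Sum>i<N. a i * \<psi>s i x) = 0) \<longrightarrow> (\<forall>i<N. a i = 0)) \<and>
     (\<forall>g\<in>airy_kernel N \<alpha>. \<exists>a. \<forall>x. g x = (\<Sum>i<N. a i * \<psi>s i x))"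

definition Psi_Airy :: "nat \<Rightarrow> (complex \<Rightarrow> complex) \<Rightarrow> complex \<Rightarrow> complex \<Rightarrow> complex mat" where
  "Psi_Airy n \<psi> x z = \<psi> (x + z) \<cdot>\<^sub>m 1\<^sub>m n"

text \<open>
  The matrix polynomial \<open>q(t)\<close> is a matrix with polynomial entries. The scalar operator
  \<open>M\<^sub>A\<^sub>i\<close> acts componentwise, so the \<open>(r, c)\<close> entry of \<open>q(M\<^sub>A\<^sub>i)\<close> is the scalar operator
  \<open>q\<^sub>r\<^sub>c(M\<^sub>A\<^sub>i)\<close>.
\<close>

definition airy_poly_app ::
    "nat \<Rightarrow> nat \<Rightarrow> (nat \<Rightarrow> complex) \<Rightarrow> complex poly mat \<Rightarrow>
     (complex \<Rightarrow> complex vec) \<Rightarrow> complex \<Rightarrow> complex vec" where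
  "airy_poly_app n N \<alpha> q f x =
     Matrix.vec n (\<lambda>r. \<Sum>c<n. \<Sum>s\<le>degree (q $$ (r, c)).
       coeff (q $$ (r, c)) s * (airy_op N \<alpha> ^^ s) (\<lambda>y. f y $ c) x)"

text \<open>
  \<open>L = q(M\<^sub>A\<^sub>i) = Q P\<close>, the product being composition; operators with meromorphic
  coefficients are equal when they act equally on all meromorphic vector functions.
\<close>

definition airy_factorization ::
    "nat \<Rightarrow> nat \<Rightarrow> (nat \<Rightarrow> complex) \<Rightarrow> complex poly mat \<Rightarrow> mdo \<Rightarrow> mdo \<Rightarrow> mdo \<Rightarrow> bool" where
  "airy_factorization n N \<alpha> q L Q P \<longleftrightarrow>
     (\<forall>f. mero_vec n f \<longrightarrow>
        (\<forall>\<^sub>\<approx>x. mdo_app n L f x = airy_poly_app n N \<alpha> q f x) \<and>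
        (\<forall>\<^sub>\<approx>x. mdo_app n L f x = mdo_app n Q (mdo_app n P f) x))"

definition bispectral_darboux ::
    "nat \<Rightarrow> nat \<Rightarrow> (nat \<Rightarrow> complex) \<Rightarrow> (complex \<Rightarrow> complex) \<Rightarrow>
     (complex \<Rightarrow> complex \<Rightarrow> complex mat) \<Rightarrow> bool" where
  "bispectral_darboux n N \<alpha> \<psi> \<Phi> \<longleftrightarrow>
     (\<exists>q L Q P.
        q \<in> carrier_mat n n \<and>
        rational_mdo n L \<and> rational_mdo n Q \<and> rational_mdo n P \<and>
        invertible_fun (last L) \<and> invertible_fun (last Q) \<and> invertible_fun (last P) \<and>
        airy_factorization n N \<alpha> q L Q P \<and>
        (\<forall>\<^sub>\<approx>x. \<forall>z. \<Phi> x z = mdo_app_mat n P (\<lambda>y. Psi_Airy n \<psi> y z) x))"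

definition airy_tuple ::
    "nat \<Rightarrow> nat \<Rightarrow> (nat \<Rightarrow> complex \<Rightarrow> complex) \<Rightarrow> complex \<Rightarrow> (nat \<Rightarrow> complex poly vec) \<Rightarrow>
     nat \<Rightarrow> complex \<Rightarrow> complex vec" where
  "airy_tuple n N \<psi>s \<mu> p i x =
     Matrix.vec n (\<lambda>r. \<Sum>j<N. (deriv ^^ j) (\<psi>s i) (x + \<mu>) * poly (p j $ r) x)"

text \<open>
  A basis of the vector kernel consisting of \<open>m\<close> tuples of length \<open>N\<close>; the basis element with index
  \<open>t * N + i\<close> is the \<open>i\<close>-th member of the \<open>t\<close>-th tuple.
\<close>

definition airy_tuple_basis ::
    "nat \<Rightarrow> nat \<Rightarrow> (nat \<Rightarrow> complex \<Rightarrow> complex) \<Rightarrow> (complex \<Rightarrow> complex vec) set \<Rightarrow> nat \<Rightarrow> bool" where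
  "airy_tuple_basis n N \<psi>s V m \<longleftrightarrow>
     (\<exists>lam p. (\<forall>t<m. \<forall>j<N. p t j \<in> carrier_vec n) \<and>
        mero_basis n V (m * N)
          (\<lambda>b. airy_tuple n N \<psi>s (lam (b div N)) (p (b div N)) (b mod N)))"

text \<open>
  The order of \<open>P\<close> is \<open>d N\<close>, and its kernel has a basis of \<open>n d\<close> tuples, where \<open>d\<close> may be any
  rational number for which \<open>d N\<close> and \<open>n d\<close> are integers. Integrality of \<open>d\<close> itself cannot be
  required: for \<open>n = N = 2\<close> the first order operator with vector kernel spanned by
  \<open>(\<psi>\<^sub>i, \<psi>\<^sub>i')\<^sup>T\<close>, \<open>i = 1, 2\<close>, divides \<open>M\<^sub>A\<^sub>i\<^sup>2\<close> on the right, and here \<open>d = 1/2\<close>.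
\<close>

definition airy_darboux_form ::
    "nat \<Rightarrow> nat \<Rightarrow> (nat \<Rightarrow> complex \<Rightarrow> complex) \<Rightarrow> (complex \<Rightarrow> complex) \<Rightarrow>
     (complex \<Rightarrow> complex \<Rightarrow> complex mat) \<Rightarrow> bool" where
  "airy_darboux_form n N \<psi>s \<psi> \<Phi> \<longleftrightarrow>
     (\<exists>W P (d :: rat) m.
        rational_mat n W \<and> invertible_fun W \<and>
        mero_mdo n P \<and> monic_mdo n P \<and>
        of_nat (mdo_order P) = d * of_nat N \<and> of_nat m = of_nat n * d \<and>
        nondegenerate n (mdo_order P) (vker n P) \<and>
        airy_tuple_basis n N \<psi>s (vker n P) m \<and>
        (\<forall>\<^sub>\<approx>x. \<forall>z. \<Phi> x z = W x * mdo_app_mat n P (\<lambda>y. Psi_Airy n \<psi> y z) x))"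

end

theory Submission
  imports
    Defs
    "HOL-Computational_Algebra.Fundamental_Theorem_Algebra"
begin

text \<open>
  Since \<open>M\<^sub>A\<^sub>i = h(\<partial>) + \<alpha>\<^sub>0 x\<close> is linear in \<open>x\<close>, every polynomial combination of the derivatives of a
  function \<open>g\<close> with \<open>M\<^sub>A\<^sub>i g = c g\<close> can be written as \<open>a(\<partial>) g\<close> with a unique constant coefficient
  polynomial \<open>a\<close>, and \<open>M\<^sub>A\<^sub>i\<close> acts on \<open>a\<close> as \<open>c - \<alpha>\<^sub>0 d/dt\<close>. Hence the functions \<open>\<psi>\<^sub>i\<^sup>(\<^sup>j\<^sup>)(x + \<lambda>)\<close>,
  for all \<open>i\<close>, all \<open>j < N\<close> and finitely many distinct \<open>\<lambda>\<close>, are linearly independent over the rational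
  functions: applying \<open>M\<^sub>A\<^sub>i - c\<close> lowers the degrees in a relation until a constant one is left.

  If \<open>q(M\<^sub>A\<^sub>i) = Q P\<close>, a dimension count shows that the kernel of \<open>P\<close> consists of sums of functions
  \<open>a(\<partial>) \<psi>\<^sub>i(x + \<lambda>)\<close>. By the independence each summand lies in the kernel, and remains there when \<open>\<psi>\<^sub>i\<close> is
  replaced by another \<open>\<psi>\<^sub>i\<^sub>'\<close>; so the kernel is spanned by tuples. Conversely, if \<open>P\<close> has a basis of tuples
  as kernel, then its coefficients are rational by Cramer's rule, because the Wronski matrix is the
  product of a polynomial matrix with the matrix of the functions \<open>\<psi>\<^sub>i\<^sup>(\<^sup>j\<^sup>)(x + \<lambda>)\<close>. A suitable scalar
  polynomial \<open>q(M\<^sub>A\<^sub>i)\<close> kills all the tuples, and division by \<open>P\<close> leaves no remainder, since a remainder of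
  order less than that of \<open>P\<close> would kill a basis with invertible Wronski matrix.
\<close>

hide_const (open) Module.smult Determinants.det Finite_Cartesian_Product.mat

text \<open>Kernels are studied through jets at one regular point: the derivatives below the order
  determine a kernel element, which bounds the dimension above by \<open>n * k\<close>; the lower
  bound comes from counting linear conditions on an explicit finite-dimensional space. The
  invertible leading coefficients make orders additive, so that the order of Q P is \<open>N\<close>
  times the largest degree in \<open>q\<close>, and the matrix of coefficients of \<open>q\<close>
  at that degree is invertible; hence det q has the full degree on which the count relies. Tuples
  are carried in two forms: one polynomial \<open>a\<close> per component, on which M acts simply,
  and the \<open>N\<close> coefficients p_j, which the theorem displays and Cramer's rule needs.
  Since equality holds only off a discrete set while derivatives at a point require equality on a
  neighbourhood, many arguments pass through punctured neighbourhoods and restore the centre by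
  continuity.\<close>

type_synonym fun_seq = "nat \<Rightarrow> complex \<Rightarrow> complex"

lemma analytic_at_nhds:
  fixes f :: "complex \<Rightarrow> complex"
  assumes "f analytic_on {x}"
  shows "eventually (\<lambda>y. f analytic_on {y}) (nhds x)"
proof -
  obtain S where "open S" "x \<in> S" "f holomorphic_on S" using assms analytic_at by blast
  then have "\<forall>y\<in>S. f analytic_on {y}" using analytic_at by blast
  then show ?thesis using \<open>open S\<close> \<open>x \<in> S\<close> eventually_nhds by blast
qed

section \<open>Differential operators with meromorphic coefficients\<close>

text \<open>Coefficient families are zero from the order bound \<open>K\<close> on, so that \<open>K\<close> can be enlarged at will.
  The family \<open>dop a\<close> belongs to the composition of \<open>\<partial>\<close> with the operator of \<open>a\<close>.\<close>

definition sop :: "nat \<Rightarrow> fun_seq \<Rightarrow> (complex \<Rightarrow> complex) \<Rightarrow> complex \<Rightarrow> complex" where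
  "sop K a g x = (\<Sum>i<K. a i x * (deriv ^^ i) g x)"

definition dop :: "fun_seq \<Rightarrow> nat \<Rightarrow> complex \<Rightarrow> complex" where
  "dop a i = (\<lambda>x. deriv (a i) x + (if i = 0 then 0 else a (i - 1) x))"

lemma sop_analytic:
  assumes "\<And>i. i < K \<Longrightarrow> a i analytic_on {x}" "g analytic_on {x}"
  shows "sop K a g analytic_on {x}"
  unfolding sop_def[abs_def] using assms by (intro analytic_intros analytic_on_sum) (auto intro!: analytic_intros)

lemma dop_analytic:
  assumes "\<And>i. a i analytic_on {x}"
  shows "dop a i analytic_on {x}"
  unfolding dop_def using assms by (cases "i = 0") (auto intro!: analytic_intros)

lemma dop_pow_analytic:
  assumes "\<And>i. a i analytic_on {x}"
  shows "(dop ^^ j) a i analytic_on {x}"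
  using assms by (induction j arbitrary: i) (auto intro!: dop_analytic)

lemma dop_zero:
  assumes "\<And>i. i \<ge> K \<Longrightarrow> a i = (\<lambda>_. 0)" "i \<ge> Suc K"
  shows "dop a i = (\<lambda>_. 0)"
  using assms by (auto simp: dop_def)

lemma dop_pow_zero:
  assumes "\<And>i. i \<ge> K \<Longrightarrow> a i = (\<lambda>_. 0)" "i \<ge> K + j"
  shows "(dop ^^ j) a i = (\<lambda>_. 0)"
  using assms
proof (induction j arbitrary: i)
  case (Suc j)
  then show ?case using dop_zero[of "K + j" "(dop ^^ j) a" i] by auto
qed auto

text \<open>In the Leibniz rule the term of highest order is the one in which the coefficient is not
  differentiated, so the top coefficient only moves up by one index at each step.\<close>

lemma dop_pow_top:
  assumes "\<And>i. i > K \<Longrightarrow> a i = (\<lambda>_. 0)"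
  shows "(dop ^^ j) a (K + j) = a K"
proof (induction j)
  case (Suc j)
  have "(dop ^^ j) a (K + Suc j) = (\<lambda>_. 0)"
    by (rule dop_pow_zero[of "Suc K"]) (use assms in auto)
  then show ?case using Suc by (auto simp: dop_def[of "(dop ^^ j) a"])
qed auto

lemma sop_extend:
  assumes "\<And>i. i \<ge> K \<Longrightarrow> a i = (\<lambda>_. 0)" "K \<le> K'"
  shows "sop K' a g x = sop K a g x"
  unfolding sop_def by (rule sum.mono_neutral_right) (use assms in auto)

lemma deriv_sop:
  assumes a: "\<And>i. i < K \<Longrightarrow> a i analytic_on {x}" and g: "g analytic_on {x}"
    and z: "\<And>i. i \<ge> K \<Longrightarrow> a i = (\<lambda>_. 0)"
  shows "deriv (sop K a g) x = sop (Suc K) (dop a) g x"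
proof -
  have gd: "(deriv ^^ i) g field_differentiable at x" for i
    using analytic_on_imp_differentiable_at[OF analytic_higher_deriv[OF g]] by simp
  have ad: "a i field_differentiable at x" if "i < K" for i
    using a[OF that] analytic_on_imp_differentiable_at by blast
  have "((sop K a g) has_field_derivative (\<Sum>i<K. deriv (a i) x * (deriv ^^ i) g x + a i x * (deriv ^^ Suc i) g x)) (at x)"
    unfolding sop_def[abs_def]
  proof (rule DERIV_sum)
    fix i assume "i \<in> {..<K}"
    then show "((\<lambda>x. a i x * (deriv ^^ i) g x) has_field_derivative
        deriv (a i) x * (deriv ^^ i) g x + a i x * (deriv ^^ Suc i) g x) (at x)"
      using DERIV_mult[OF DERIV_deriv_iff_field_differentiable[THEN iffD2, OF ad[of i]]
          DERIV_deriv_iff_field_differentiable[THEN iffD2, OF gd[of i]]]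
      by (simp add: algebra_simps)
  qed
  then have "deriv (sop K a g) x = (\<Sum>i<K. deriv (a i) x * (deriv ^^ i) g x + a i x * (deriv ^^ Suc i) g x)"
    by (rule DERIV_imp_deriv)
  also have "\<dots> = (\<Sum>i<K. deriv (a i) x * (deriv ^^ i) g x) + (\<Sum>i<K. a i x * (deriv ^^ Suc i) g x)"
    by (simp add: sum.distrib)
  \<comment> \<open>Padding by the vanishing coefficient \<open>a K\<close> lets both sums run below
    \<open>Suc K\<close>.\<close>
  also have "(\<Sum>i<K. deriv (a i) x * (deriv ^^ i) g x) = (\<Sum>i<Suc K. deriv (a i) x * (deriv ^^ i) g x)"
    using z[of K] by simp
  also have "(\<Sum>i<K. a i x * (deriv ^^ Suc i) g x) = (\<Sum>i<Suc K. (if i = 0 then 0 else a (i - 1) x) * (deriv ^^ i) g x)"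
    by (simp only: sum.lessThan_Suc_shift) simp
  finally show ?thesis unfolding sop_def dop_def
    by (simp add: sum.distrib[symmetric] algebra_simps del: sum.lessThan_Suc)
qed

lemma higher_deriv_sop:
  assumes a: "\<And>i. a i analytic_on {x}" and g: "g analytic_on {x}"
    and z: "\<And>i. i \<ge> K \<Longrightarrow> a i = (\<lambda>_. 0)"
  shows "(deriv ^^ j) (sop K a g) x = sop (K + j) ((dop ^^ j) a) g x"
  using a g
proof (induction j arbitrary: x)
  case (Suc j)
  \<comment> \<open>The induction hypothesis is wanted on a whole neighbourhood because it is about
    to be differentiated; there only the finitely many coefficients below \<open>K\<close> have to
    be checked.\<close>
  have az: "eventually (\<lambda>y. \<forall>i\<in>{..<K}. a i analytic_on {y}) (nhds x)"
    using Suc.prems by (intro eventually_ball_finite) (auto intro!: analytic_at_nhds)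
  have "eventually (\<lambda>y. (deriv ^^ j) (sop K a g) y = sop (K + j) ((dop ^^ j) a) g y) (nhds x)"
    using az analytic_at_nhds[OF Suc.prems(2)]
  proof eventually_elim
    case (elim y)
    have "a i analytic_on {y}" for i
      by (cases "i < K") (use elim z in auto)
    then show ?case using Suc.IH elim by blast
  qed
  then have "deriv ((deriv ^^ j) (sop K a g)) x = deriv (sop (K + j) ((dop ^^ j) a) g) x"
    by (rule deriv_cong_ev) auto
  also have "\<dots> = sop (Suc (K + j)) (dop ((dop ^^ j) a)) g x"
    by (rule deriv_sop) (use Suc.prems z in \<open>auto intro!: dop_pow_analytic dop_pow_zero\<close>)
  finally show ?case by simp
qed auto

section \<open>Matrix operators and their composition\<close>

definition mop :: "nat \<Rightarrow> nat \<Rightarrow> (nat \<Rightarrow> nat \<Rightarrow> fun_seq) \<Rightarrow> fun_seq \<Rightarrow> nat \<Rightarrow> complex \<Rightarrow> complex" where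
  "mop n K A F r x = (\<Sum>c<n. sop K (A r c) (F c) x)"

text \<open>Coefficients of the composition of B after A: by the Leibniz rule, \<partial>^j composed
  with an entry of A has the coefficients \<open>(dop ^^ j) (A e c)\<close>.\<close>

definition mcomp :: "nat \<Rightarrow> nat \<Rightarrow> (nat \<Rightarrow> nat \<Rightarrow> fun_seq) \<Rightarrow>
    (nat \<Rightarrow> nat \<Rightarrow> fun_seq) \<Rightarrow> nat \<Rightarrow> nat \<Rightarrow> fun_seq" where
  "mcomp n J B A r c i x = (\<Sum>j<J. \<Sum>e<n. B r e j x * (dop ^^ j) (A e c) i x)"

lemma mop_analytic:
  assumes "\<And>r c i. A r c i analytic_on {x}" "\<And>c. c < n \<Longrightarrow> F c analytic_on {x}"
  shows "mop n K A F r analytic_on {x}"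
  unfolding mop_def[abs_def] using assms by (auto intro!: analytic_on_sum sop_analytic)

lemma higher_deriv_sum_at:
  assumes "\<And>c. c \<in> S \<Longrightarrow> f c analytic_on {x}"
  shows "(deriv ^^ j) (\<lambda>y. \<Sum>c\<in>S. f c y) x = (\<Sum>c\<in>S. (deriv ^^ j) (f c) x)"
  using assms
proof (induction S rule: infinite_finite_induct)
  case (insert a S)
  have "(\<lambda>y. \<Sum>c\<in>S. f c y) analytic_on {x}"
    using insert by (intro analytic_on_sum) auto
  then show ?case using insert by (auto simp: higher_deriv_add_at)
qed auto

lemma higher_deriv_mop:
  assumes "\<And>r c i. A r c i analytic_on {x}" "\<And>c. c < n \<Longrightarrow> F c analytic_on {x}"
    and "\<And>r c i. i \<ge> K \<Longrightarrow> A r c i = (\<lambda>_. 0)"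
  shows "(deriv ^^ j) (mop n K A F r) x = (\<Sum>c<n. sop (K + j) ((dop ^^ j) (A r c)) (F c) x)"
proof -
  have "(deriv ^^ j) (mop n K A F r) x = (\<Sum>c<n. (deriv ^^ j) (sop K (A r c) (F c)) x)"
    unfolding mop_def[abs_def] using assms
    by (intro higher_deriv_sum_at) (auto intro!: sop_analytic)
  also have "\<dots> = (\<Sum>c<n. sop (K + j) ((dop ^^ j) (A r c)) (F c) x)"
    using assms by (intro sum.cong higher_deriv_sop) auto
  finally show ?thesis .
qed

lemma mop_mcomp:
  assumes A: "\<And>r c i. A r c i analytic_on {x}" and F: "\<And>c. c < n \<Longrightarrow> F c analytic_on {x}"
    and z: "\<And>r c i. i \<ge> K \<Longrightarrow> A r c i = (\<lambda>_. 0)"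
  shows "mop n J B (mop n K A F) r x = mop n (K + J) (mcomp n J B A) F r x"
proof -
  have "mop n J B (mop n K A F) r x =
      (\<Sum>e<n. \<Sum>j<J. \<Sum>c<n. B r e j x * sop (K + J) ((dop ^^ j) (A e c)) (F c) x)"
    unfolding mop_def[of n J] sop_def[of J]
  proof (intro sum.cong refl)
    fix e j assume "j \<in> {..<J}"
    have "(deriv ^^ j) (mop n K A F e) x = (\<Sum>c<n. sop (K + j) ((dop ^^ j) (A e c)) (F c) x)"
      by (rule higher_deriv_mop) (use assms in auto)
    also have "\<dots> = (\<Sum>c<n. sop (K + J) ((dop ^^ j) (A e c)) (F c) x)"
      using \<open>j \<in> _\<close> z by (intro sum.cong sop_extend[symmetric] refl dop_pow_zero[of K]) auto
    finally show "B r e j x * (deriv ^^ j) (mop n K A F e) x =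
        (\<Sum>c<n. B r e j x * sop (K + J) ((dop ^^ j) (A e c)) (F c) x)"
      by (simp add: sum_distrib_left)
  qed
  also have "\<dots> = (\<Sum>e<n. \<Sum>c<n. \<Sum>j<J. B r e j x * sop (K + J) ((dop ^^ j) (A e c)) (F c) x)"
    by (rule sum.cong[OF refl], rule sum.swap)
  also have "\<dots> = (\<Sum>c<n. \<Sum>e<n. \<Sum>j<J. B r e j x * sop (K + J) ((dop ^^ j) (A e c)) (F c) x)"
    by (rule sum.swap)
  also have "\<dots> = mop n (K + J) (mcomp n J B A) F r x"
    unfolding mop_def
  proof (rule sum.cong[OF refl])
    fix c
    have "(\<Sum>e<n. \<Sum>j<J. B r e j x * sop (K + J) ((dop ^^ j) (A e c)) (F c) x) =
        (\<Sum>e<n. \<Sum>j<J. \<Sum>i<K + J. B r e j x * (dop ^^ j) (A e c) i x * (deriv ^^ i) (F c) x)"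
      unfolding sop_def by (simp add: sum_distrib_left mult.assoc)
    also have "\<dots> = (\<Sum>e<n. \<Sum>i<K + J. \<Sum>j<J. B r e j x * (dop ^^ j) (A e c) i x * (deriv ^^ i) (F c) x)"
      by (rule sum.cong[OF refl], rule sum.swap)
    also have "\<dots> = (\<Sum>i<K + J. \<Sum>e<n. \<Sum>j<J. B r e j x * (dop ^^ j) (A e c) i x * (deriv ^^ i) (F c) x)"
      by (rule sum.swap)
    also have "\<dots> = (\<Sum>i<K + J. \<Sum>j<J. \<Sum>e<n. B r e j x * (dop ^^ j) (A e c) i x * (deriv ^^ i) (F c) x)"
      by (rule sum.cong[OF refl], rule sum.swap)
    also have "\<dots> = sop (K + J) (mcomp n J B A r c) (F c) x"
      unfolding sop_def mcomp_def by (simp add: sum_distrib_right)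
    finally show "(\<Sum>e<n. \<Sum>j<J. B r e j x * sop (K + J) ((dop ^^ j) (A e c)) (F c) x) =
        sop (K + J) (mcomp n J B A r c) (F c) x" .
  qed
  finally show ?thesis .
qed

lemma mcomp_zero:
  assumes "\<And>r c i. i > k \<Longrightarrow> A r c i = (\<lambda>_. 0)" "i > k + l"
  shows "mcomp n (Suc l) B A r c i = (\<lambda>_. 0)"
proof -
  have "(dop ^^ j) (A e c) i = (\<lambda>_. 0)" if "j < Suc l" for j e
    by (rule dop_pow_zero[of "Suc k"]) (use assms that in auto)
  then show ?thesis unfolding mcomp_def by (auto simp del: sum.lessThan_Suc)
qed

text \<open>Only the summand \<open>j = l\<close> reaches the index \<open>k + l\<close>, and there
  \<open>dop_pow_top\<close> applies. So leading matrices multiply, and orders add when these are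
  invertible.\<close>

lemma mcomp_top:
  assumes "\<And>r c i. i > k \<Longrightarrow> A r c i = (\<lambda>_. 0)"
  shows "mcomp n (Suc l) B A r c (k + l) x = (\<Sum>e<n. B r e l x * A e c k x)"
proof -
  have "(dop ^^ j) (A e c) (k + l) = (\<lambda>_. 0)" if "j < l" for j e
    by (rule dop_pow_zero[of "Suc k"]) (use assms that in auto)
  moreover have "(dop ^^ l) (A e c) (k + l) = A e c k" for e
    by (rule dop_pow_top) (use assms in auto)
  ultimately show ?thesis unfolding mcomp_def by simp
qed

text \<open>Where the leading coefficient is invertible, differentiating the equation expresses each higher
  derivative by lower ones. This uniqueness statement is all that is used of the theory of ODEs.\<close>

lemma jet_unique:
  fixes F :: "nat \<Rightarrow> complex \<Rightarrow> complex"
  assumes an: "\<And>r c i. A r c i analytic_on {x}" and F: "\<And>c. c < n \<Longrightarrow> F c analytic_on {x}"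
    and z: "\<And>r c i. i > k \<Longrightarrow> A r c i = (\<lambda>_. 0)"
    and ev: "eventually (\<lambda>y. \<forall>r<n. mop n (Suc k) A F r y = 0) (nhds x)"
    and inv: "\<And>v. \<forall>r<n. (\<Sum>c<n. A r c k x * v c) = 0 \<Longrightarrow> \<forall>c<n. v c = 0"
    and jet: "\<And>i c. i < k \<Longrightarrow> c < n \<Longrightarrow> (deriv ^^ i) (F c) x = 0"
  shows "c < n \<Longrightarrow> (deriv ^^ l) (F c) x = 0"
proof (induction l arbitrary: c rule: less_induct)
  case (less l)
  show ?case
  proof (cases "l < k")
    case False
    \<comment> \<open>The \<open>j\<close>-th derivative of the equation has order \<open>l\<close>
      and still the leading coefficient \<open>A r c k\<close>.\<close>
    define j where "j = l - k"
    have l: "l = k + j" using False by (simp add: j_def)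
    have "(\<Sum>c<n. A r c k x * (deriv ^^ l) (F c) x) = 0" if r: "r < n" for r
    proof -
      have "eventually (\<lambda>y. mop n (Suc k) A F r y = 0) (nhds x)"
        using ev by eventually_elim (use r in auto)
      then have "(deriv ^^ j) (mop n (Suc k) A F r) x = (deriv ^^ j) (\<lambda>_. 0) x"
        by (rule higher_deriv_cong_ev) auto
      then have "0 = (deriv ^^ j) (mop n (Suc k) A F r) x" by simp
      also have "\<dots> = (\<Sum>c<n. sop (Suc k + j) ((dop ^^ j) (A r c)) (F c) x)"
        by (rule higher_deriv_mop) (use an F z in auto)
      also have "\<dots> = (\<Sum>c<n. A r c k x * (deriv ^^ l) (F c) x)"
      proof (rule sum.cong[OF refl])
        fix c assume c: "c \<in> {..<n}"
        have "sop (Suc k + j) ((dop ^^ j) (A r c)) (F c) x =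
            (\<Sum>i<l. (dop ^^ j) (A r c) i x * (deriv ^^ i) (F c) x) +
            (dop ^^ j) (A r c) l x * (deriv ^^ l) (F c) x"
          unfolding sop_def l by simp
        also have "(\<Sum>i<l. (dop ^^ j) (A r c) i x * (deriv ^^ i) (F c) x) = 0"
          using less.IH c by (intro sum.neutral) auto
        also have "(dop ^^ j) (A r c) l = A r c k"
          unfolding l by (rule dop_pow_top) (use z in auto)
        finally show "sop (Suc k + j) ((dop ^^ j) (A r c)) (F c) x = A r c k x * (deriv ^^ l) (F c) x"
          by simp
      qed
      finally show ?thesis by simp
    qed
    then show ?thesis using inv[of "\<lambda>c. (deriv ^^ l) (F c) x"] less.prems by auto
  qed (use jet less.prems in auto)
qed

section \<open>Zeros of meromorphic functions\<close>

lemma mero_zero_or_nonzero: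
  assumes "f meromorphic_on UNIV"
  shows "(\<forall>\<^sub>\<approx>x. f x = 0) \<or> (\<forall>\<^sub>\<approx>x. f x \<noteq> (0::complex))"
  using meromorphic_imp_constant_or_avoid[OF assms] by auto

lemma cosparse_at: "(\<forall>\<^sub>\<approx>x. P x) \<Longrightarrow> eventually P (at (x::complex))"
  using eventually_cosparse_imp_eventually_at[of P UNIV x UNIV] by simp

lemma cosparse_ex: "(\<forall>\<^sub>\<approx>x. P (x::complex)) \<Longrightarrow> \<exists>x. P x"
  using cosparse_at[of P 0] eventually_happens'[of "at (0::complex)"] by auto

text \<open>A meromorphic function that does not vanish identically has no zeros in some punctured
  neighbourhood of any given point.\<close>

lemma mero_zero_at:
  assumes "f meromorphic_on UNIV" "frequently (\<lambda>y. f y = (0::complex)) (at x)"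
  shows "\<forall>\<^sub>\<approx>x. f x = 0"
  using mero_zero_or_nonzero[OF assms(1)] assms(2) cosparse_at[of "\<lambda>y. f y \<noteq> 0" x]
  by (auto simp: frequently_def)

lemma mero_zero_derivs:
  assumes f: "f meromorphic_on UNIV" "f analytic_on {x}" and d: "\<And>l. (deriv ^^ l) f x = (0::complex)"
  shows "\<forall>\<^sub>\<approx>x. f x = 0"
proof (rule mero_zero_at[OF f(1)])
  obtain e where e: "e > 0" "f holomorphic_on ball x e"
    using f(2) unfolding analytic_on_def by auto
  have "f w = 0" if "w \<in> ball x e" for w
    using holomorphic_fun_eq_0_on_ball[OF e(2) that d] .
  then have "eventually (\<lambda>y. f y = 0) (at x)"
    using e by (auto simp: eventually_at_topological intro!: exI[of _ "ball x e"])
  then show "frequently (\<lambda>y. f y = 0) (at x)"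
    by (simp add: eventually_frequently)
qed

section \<open>Homogeneous linear systems\<close>

lemma nontrivial_solution:
  fixes A :: "nat \<Rightarrow> nat \<Rightarrow> complex"
  assumes "p < m"
  shows "\<exists>v. (\<exists>j<m. v j \<noteq> 0) \<and> (\<forall>i<p. (\<Sum>j<m. A i j * v j) = 0)"
proof -
  \<comment> \<open>Padding with zero rows makes the system square, with determinant zero because
    row \<open>p\<close> vanishes.\<close>
  define M where "M = mat m m (\<lambda>(i, j). if i < p then A i j else 0)"
  have M: "M \<in> carrier_mat m m" by (simp add: M_def)
  have "M = mat\<^sub>r m m (\<lambda>i. if i = p then 0\<^sub>v m else row M i)"
    by (rule eq_matI) (auto simp: M_def)
  moreover have "row M \<in> {0..<m} \<rightarrow> carrier_vec m" using M by auto
  ultimately have "det M = 0" using det_row_0[OF assms, of "row M"] by simp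
  then obtain v where v: "v \<in> carrier_vec m" "v \<noteq> 0\<^sub>v m" "M *\<^sub>v v = 0\<^sub>v m"
    using det_0_iff_vec_prod_zero[OF M] by auto
  have "\<exists>j<m. v $ j \<noteq> 0" using v by (metis eq_vecI carrier_vecD index_zero_vec)
  moreover have "(\<Sum>j<m. A i j * v $ j) = 0" if i: "i < p" for i
  proof -
    have "0 = (M *\<^sub>v v) $ i" using v(3) i assms by simp
    also have "\<dots> = row M i \<bullet> v" using i assms M by simp
    also have "\<dots> = (\<Sum>j<m. A i j * v $ j)"
      using v(1) i assms by (auto simp: M_def scalar_prod_def atLeast0LessThan)
    finally show ?thesis by simp
  qed
  ultimately show ?thesis by (intro exI[of _ "\<lambda>j. v $ j"]) auto
qed

text \<open>Rank-nullity with explicit independent solutions. Each further equation costs one of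
  them: either all \<open>Suc D\<close> old solutions satisfy it, or one with nonzero defect serves
  as a pivot and corrects the others.\<close>

lemma kernel_family:
  fixes A :: "nat \<Rightarrow> nat \<Rightarrow> complex"
  assumes "e + D \<le> R"
  shows "\<exists>u. (\<forall>d<D. \<forall>i<e. (\<Sum>j<R. A i j * u d j) = 0) \<and>
     (\<forall>a. (\<forall>j<R. (\<Sum>d<D. a d * u d j) = 0) \<longrightarrow> (\<forall>d<D. a d = 0))"
  using assms
proof (induction e arbitrary: D)
  case 0
  then show ?case
  proof (intro exI[of _ "\<lambda>d j. if d = j then 1 else 0"] conjI allI impI)
    fix a :: "nat \<Rightarrow> complex" and d assume a: "\<forall>j<R. (\<Sum>d<D. a d * (if d = j then 1 else 0)) = 0" and d: "d < D"
    have "(\<Sum>d'<D. a d' * (if d' = d then 1 else 0)) = a d"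
      using d by (simp add: if_distrib[of "(*) _"] cong: if_cong)
    then show "a d = 0" using a d 0 by auto
  qed auto
next
  case (Suc e)
  obtain u where u: "\<And>d i. d < Suc D \<Longrightarrow> i < e \<Longrightarrow> (\<Sum>j<R. A i j * u d j) = 0"
    and ui: "\<And>a. \<forall>j<R. (\<Sum>d<Suc D. a d * u d j) = 0 \<Longrightarrow> \<forall>d<Suc D. a d = 0"
    using Suc.IH[of "Suc D"] Suc.prems by auto
  define \<phi> where "\<phi> d = (\<Sum>j<R. A e j * u d j)" for d
  show ?case
  proof (cases "\<forall>d<Suc D. \<phi> d = 0")
    case True
    show ?thesis
    proof (intro exI[of _ u] conjI allI impI)
      fix d i assume "d < D" "i < Suc e"
      then show "(\<Sum>j<R. A i j * u d j) = 0"
        using u[of d i] True by (cases "i = e") (auto simp: \<phi>_def)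
    next
      fix a :: "nat \<Rightarrow> complex" and d assume a: "\<forall>j<R. (\<Sum>d<D. a d * u d j) = 0" "d < D"
      then show "a d = 0" using ui[of "\<lambda>d. if d < D then a d else 0"] by (auto dest!: spec[of _ d])
    qed
  next
    case False
    then obtain p where p: "p < Suc D" "\<phi> p \<noteq> 0" by auto
    \<comment> \<open>\<open>s\<close> enumerates the indices other than the pivot
      \<open>p\<close>.\<close>
    define s where "s d = (if d < p then d else Suc d)" for d
    define w where "w d j = u (s d) j - \<phi> (s d) / \<phi> p * u p j" for d j
    have s: "s d < Suc D" if "d < D" for d using that by (auto simp: s_def)
    have bij: "bij_betw s {..<D} ({..<Suc D} - {p})"
    proof (rule bij_betwI[where g = "\<lambda>d. if d < p then d else d - 1"])
    qed (use p in \<open>auto simp: s_def split: if_splits\<close>)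
    show ?thesis
    proof (intro exI[of _ w] conjI allI impI)
      fix d i assume d: "d < D" and i: "i < Suc e"
      have "(\<Sum>j<R. A i j * w d j) = (\<Sum>j<R. A i j * u (s d) j) - \<phi> (s d) / \<phi> p * (\<Sum>j<R. A i j * u p j)"
        by (simp add: w_def algebra_simps sum_subtractf sum_distrib_left)
      also have "\<dots> = 0"
        using u[of "s d" i] u[of p i] s[OF d] p i by (cases "i = e") (auto simp: \<phi>_def)
      finally show "(\<Sum>j<R. A i j * w d j) = 0" .
    next
      fix a :: "nat \<Rightarrow> complex" and d0 assume a: "\<forall>j<R. (\<Sum>d<D. a d * w d j) = 0" and d: "d0 < D"
      define t where "t d = (if d < p then d else d - 1)" for d
      have ts: "t (s d) = d" for d by (auto simp: t_def s_def)
      \<comment> \<open>The coefficient at the pivot collects the multiples of \<open>u p\<close>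
        subtracted in the \<open>w d\<close>, so a relation among the \<open>w d\<close> becomes one
        among the \<open>u d\<close>.\<close>
      define b where "b d = (if d = p then - (\<Sum>d<D. a d * (\<phi> (s d) / \<phi> p)) else a (t d))" for d
      have sp: "s d \<noteq> p" for d by (auto simp: s_def)
      have "(\<Sum>d<Suc D. b d * u d j) = (\<Sum>d<D. a d * w d j)" for j
      proof -
        have "(\<Sum>d<Suc D. b d * u d j) = b p * u p j + (\<Sum>d\<in>{..<Suc D} - {p}. b d * u d j)"
          using p by (intro sum.remove) auto
        also have "(\<Sum>d\<in>{..<Suc D} - {p}. b d * u d j) = (\<Sum>d<D. b (s d) * u (s d) j)"
          by (rule sum.reindex_bij_betw[OF bij, symmetric])
        also have "\<dots> = (\<Sum>d<D. a d * u (s d) j)"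
          by (rule sum.cong) (auto simp: b_def sp ts)
        finally show ?thesis
          by (simp add: b_def w_def algebra_simps sum_subtractf sum_distrib_left)
      qed
      then have "\<forall>d<Suc D. b d = 0" using ui a by metis
      then have "b (s d0) = 0" using s[OF d] by blast
      then show "a d0 = 0" by (simp add: b_def sp ts)
    qed
  qed
qed

section \<open>The module generated by the shifted Airy functions\<close>

text \<open>This is a(\<partial>) g. Keeping the symbol \<open>a\<close> as a polynomial turns
  composition into multiplication (\<open>papp_papp\<close>).\<close>

definition papp :: "complex poly \<Rightarrow> (complex \<Rightarrow> complex) \<Rightarrow> complex \<Rightarrow> complex" where
  "papp a g x = (\<Sum>l\<le>degree a. coeff a l * (deriv ^^ l) g x)"

lemma papp_extend:
  assumes "degree a \<le> L"
  shows "papp a g x = (\<Sum>l\<le>L. coeff a l * (deriv ^^ l) g x)"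
  unfolding papp_def by (rule sum.mono_neutral_left) (use assms in \<open>auto simp: coeff_eq_0\<close>)

lemma papp_0 [simp]: "papp 0 g x = 0"
  by (simp add: papp_def)

lemma papp_add: "papp (a + b) g x = papp a g x + papp b g x"
proof -
  define L where "L = max (degree a) (degree b)"
  have "degree (a + b) \<le> L" unfolding L_def by (rule degree_add_le_max)
  then show ?thesis
    by (simp add: papp_extend[of _ L] L_def sum.distrib algebra_simps)
qed

lemma papp_smult: "papp (smult k a) g x = k * papp a g x"
  by (simp add: papp_extend[of _ "degree a"] sum_distrib_left mult.assoc)

lemma papp_minus: "papp (- a) g x = - papp a g x"
  using papp_smult[of "- 1" a g x] by simp

lemma papp_diff: "papp (a - b) g x = papp a g x - papp b g x"
  using papp_add[of a "- b" g x] by (simp add: papp_minus)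

lemma papp_sum: "papp (\<Sum>s\<in>S. a s) g x = (\<Sum>s\<in>S. papp (a s) g x)"
  by (induction S rule: infinite_finite_induct) (auto simp: papp_add)

lemma papp_monom: "papp (monom k l) g x = k * (deriv ^^ l) g x"
proof (cases "k = 0")
  case False
  then show ?thesis by (simp add: papp_def degree_monom_eq if_distrib[of "\<lambda>y. y * _"] cong: if_cong)
qed auto

lemma papp_const [simp]: "papp [:k:] g x = k * g x"
  by (simp add: papp_def)

lemma papp_1 [simp]: "papp 1 g = g"
  using papp_const[of 1 g] by (auto simp: one_pCons)

lemma papp_entire:
  assumes "g holomorphic_on UNIV"
  shows "papp a g holomorphic_on UNIV"
  unfolding papp_def[abs_def] using assms by (auto intro!: holomorphic_intros)

lemma entire_analytic: "g holomorphic_on UNIV \<Longrightarrow> g analytic_on {x}"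
  using analytic_on_open analytic_on_subset by blast

text \<open>Horner's rule with \<partial> for the variable; the inductions over the symbol
  \<open>a\<close> rest on it.\<close>

lemma papp_pCons:
  assumes g: "g holomorphic_on UNIV"
  shows "papp (pCons k a) g x = k * g x + deriv (papp a g) x"
proof -
  have "deriv (papp a g) x = (deriv ^^ 1) (\<lambda>x. \<Sum>l\<le>degree a. coeff a l * (deriv ^^ l) g x) x"
    by (simp add: papp_def[abs_def])
  also have "\<dots> = (\<Sum>l\<le>degree a. (deriv ^^ 1) (\<lambda>x. coeff a l * (deriv ^^ l) g x) x)"
    by (intro higher_deriv_sum_at) (auto intro!: analytic_intros entire_analytic[OF g])
  also have "\<dots> = (\<Sum>l\<le>degree a. coeff a l * (deriv ^^ Suc l) g x)"
    by (intro sum.cong refl, subst higher_deriv_cmult')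
      (auto intro!: analytic_intros entire_analytic[OF g])
  finally have d: "deriv (papp a g) x = (\<Sum>l\<le>degree a. coeff a l * (deriv ^^ Suc l) g x)" .
  have "papp (pCons k a) g x = (\<Sum>l\<le>Suc (degree a). coeff (pCons k a) l * (deriv ^^ l) g x)"
    by (rule papp_extend) (rule degree_pCons_le)
  also have "\<dots> = k * g x + (\<Sum>l\<le>degree a. coeff a l * (deriv ^^ Suc l) g x)"
    by (subst sum.atMost_Suc_shift) simp
  finally show ?thesis using d by simp
qed

lemma deriv_papp:
  assumes g: "g holomorphic_on UNIV"
  shows "deriv (papp a g) = papp (pCons 0 a) g"
  using papp_pCons[OF g, of 0 a] by auto

lemma higher_deriv_papp:
  assumes g: "g holomorphic_on UNIV"
  shows "(deriv ^^ j) (papp a g) = papp (monom 1 j * a) g"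
proof (induction j)
  case (Suc j)
  have "pCons 0 (monom 1 j * a) = monom 1 (Suc j) * a"
    by (simp add: monom_Suc)
  then show ?case using Suc deriv_papp[OF g] by simp
qed (simp add: monom_0 flip: one_pCons)

lemma papp_papp:
  assumes g: "g holomorphic_on UNIV"
  shows "papp b (papp a g) x = papp (b * a) g x"
proof -
  have "b * a = (\<Sum>l\<le>degree b. smult (coeff b l) (monom 1 l * a))"
    by (subst poly_as_sum_of_monoms[of b, symmetric], subst sum_distrib_right)
      (simp add: smult_monom flip: mult_smult_left)
  then show ?thesis
    by (simp add: papp_def[of b] higher_deriv_papp[OF g] papp_sum papp_smult)
qed

lemma papp_zero_fun: "papp a (\<lambda>x. 0) x = 0"
  by (simp add: papp_def)

lemma papp_sum_fun:
  assumes "\<And>s. s \<in> S \<Longrightarrow> f s analytic_on {x}"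
  shows "papp a (\<lambda>x. \<Sum>s\<in>S. f s x) x = (\<Sum>s\<in>S. papp a (f s) x)"
  unfolding papp_def by (simp add: higher_deriv_sum_at[OF assms] sum_distrib_left) (rule sum.swap)

section \<open>The Airy operator and its eigenfunctions\<close>

definition airy_symbol :: "nat \<Rightarrow> (nat \<Rightarrow> complex) \<Rightarrow> complex poly" where
  "airy_symbol N \<alpha> = monom 1 N + (\<Sum>i\<in>{2..N-1}. monom (\<alpha> i) (N - i))"

lemma airy_op_papp: "airy_op N \<alpha> g x = papp (airy_symbol N \<alpha>) g x + \<alpha> 0 * x * g x"
  by (simp add: airy_op_def airy_symbol_def papp_add papp_sum papp_monom)

lemma airy_symbol_coeff_N: "N > 0 \<Longrightarrow> coeff (airy_symbol N \<alpha>) N = 1"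
  by (auto simp: airy_symbol_def coeff_sum intro!: sum.neutral)

lemma airy_symbol_degree: "N > 0 \<Longrightarrow> degree (airy_symbol N \<alpha>) = N"
proof (rule antisym)
  show "degree (airy_symbol N \<alpha>) \<le> N"
    unfolding airy_symbol_def
    by (intro degree_add_le degree_sum_le) (auto intro: order.trans[OF degree_monom_le])
  assume "N > 0" then show "N \<le> degree (airy_symbol N \<alpha>)"
    by (intro le_degree) (simp add: airy_symbol_coeff_N)
qed

locale airy =
  fixes N :: nat and \<alpha> :: "nat \<Rightarrow> complex" and \<psi>s :: "nat \<Rightarrow> complex \<Rightarrow> complex"
  assumes N: "N > 0" and \<alpha>0: "\<alpha> 0 \<noteq> 0" and basis: "airy_basis N \<alpha> \<psi>s"
begin

abbreviation h where "h \<equiv> airy_symbol N \<alpha>"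

text \<open>The shift is chosen such that \<open>M\<^sub>A\<^sub>i (psi c i) = c psi c i\<close>.\<close>

definition psi :: "complex \<Rightarrow> nat \<Rightarrow> complex \<Rightarrow> complex" where
  "psi c i x = \<psi>s i (x + - c / \<alpha> 0)"

lemma psis_entire: "i < N \<Longrightarrow> \<psi>s i holomorphic_on UNIV"
  using basis by (auto simp: airy_basis_def airy_kernel_def)

lemma psi_entire: "i < N \<Longrightarrow> psi c i holomorphic_on UNIV"
  unfolding psi_def[abs_def]
  using holomorphic_on_compose_gen[of "\<lambda>x. x + - c / \<alpha> 0" UNIV "\<psi>s i" UNIV] psis_entire[of i]
  by (simp add: o_def holomorphic_intros)

lemma higher_deriv_psi: "i < N \<Longrightarrow> (deriv ^^ j) (psi c i) x = (deriv ^^ j) (\<psi>s i) (x + - c / \<alpha> 0)"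
  unfolding psi_def[abs_def]
  using higher_deriv_compose_linear'[OF psis_entire open_UNIV open_UNIV UNIV_I, of i 1 "- c / \<alpha> 0" j x] by simp

lemma airy_psi:
  assumes "i < N"
  shows "papp h (psi c i) x = (c - \<alpha> 0 * x) * psi c i x"
proof -
  have "papp h (psi c i) x = papp h (\<psi>s i) (x + - c / \<alpha> 0)"
    by (simp add: papp_def higher_deriv_psi[OF assms])
  moreover have "airy_op N \<alpha> (\<psi>s i) (x + - c / \<alpha> 0) = 0"
    using basis assms by (auto simp: airy_basis_def airy_kernel_def)
  moreover have "\<alpha> 0 * (x + - c / \<alpha> 0) = - (c - \<alpha> 0 * x)" using \<alpha>0 by (simp add: field_simps)
  ultimately show ?thesis unfolding airy_op_papp psi_def by (metis add_eq_0_iff2 mult_minus_left minus_minus)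
qed

text \<open>On \<open>papp a (psi c i)\<close>, that is \<open>a(\<partial>) (psi c i)\<close>, multiplication by \<open>x\<close> acts as \<open>X c\<close> on \<open>a\<close>, and \<open>M\<^sub>A\<^sub>i\<close> acts as
  the operator \<open>T c\<close> below; neither depends on \<open>i\<close>.\<close>

definition X :: "complex \<Rightarrow> complex poly \<Rightarrow> complex poly" where
  "X c a = smult (1 / \<alpha> 0) (smult c a - h * a) - pderiv a"

text \<open>This is the relation x \<partial> = \<partial> x - 1 carried over to symbols; the term
  \<open>- a\<close> is the commutator.\<close>

lemma X_pCons: "X c (pCons k a) = smult k (X c 1) + pCons 0 (X c a) - a"
  unfolding X_def
  by (simp add: pderiv_pCons algebra_simps smult_add_right smult_diff_right smult_smult)

text \<open>For \<open>a = 1\<close> this is the Airy equation solved for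
  \<open>x * psi c i x\<close>. The induction step is the product rule for the derivative of
  \<open>x * papp a (psi c i) x\<close>.\<close>

lemma x_papp:
  assumes i: "i < N"
  shows "x * papp a (psi c i) x = papp (X c a) (psi c i) x"
proof (induction a arbitrary: x)
  case 0
  then show ?case by (simp add: X_def)
next
  case (pCons k a)
  note e = psi_entire[OF i, of c]
  have "papp (pCons 0 (X c a)) (psi c i) x = deriv (papp (X c a) (psi c i)) x"
    by (simp add: deriv_papp[OF e])
  also have "papp (X c a) (psi c i) = (\<lambda>x. x * papp a (psi c i) x)"
    using pCons.IH by auto
  also have "deriv \<dots> x = papp a (psi c i) x + x * deriv (papp a (psi c i)) x"
  proof -
    have "papp a (psi c i) field_differentiable at x"
      using papp_entire[OF e] by (simp add: holomorphic_on_def)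
    then show ?thesis by (subst deriv_mult) auto
  qed
  finally have 1: "papp (pCons 0 (X c a)) (psi c i) x = papp a (psi c i) x + x * deriv (papp a (psi c i)) x" .
  have 2: "papp (X c 1) (psi c i) x = x * psi c i x"
    using \<alpha>0 by (simp add: X_def papp_diff papp_smult airy_psi[OF i] field_simps)
  show ?case
    by (simp add: X_pCons papp_diff papp_add papp_smult papp_pCons[OF e, of k] 1 2 algebra_simps)
qed

definition T :: "complex \<Rightarrow> complex poly \<Rightarrow> complex poly" where
  "T c a = smult c a - smult (\<alpha> 0) (pderiv a)"

text \<open>The product \<open>h * a\<close> coming from the constant coefficient part cancels
  against the one in \<open>X c a\<close>; what remains does not raise degrees.\<close>

lemma airy_papp:
  assumes i: "i < N"
  shows "airy_op N \<alpha> (papp a (psi c i)) x = papp (T c a) (psi c i) x"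
  using x_papp[OF i, of x a c] \<alpha>0
  by (simp add: airy_op_papp papp_papp[OF psi_entire[OF i]] X_def T_def papp_diff papp_smult field_simps)

text \<open>A general element of the module. Its polynomials may vary with \<open>i\<close>, whereas
  in a tuple one polynomial is shared by all \<open>i\<close>.\<close>

definition psi_sum :: "complex set \<Rightarrow> (complex \<Rightarrow> nat \<Rightarrow> complex poly) \<Rightarrow> complex \<Rightarrow> complex" where
  "psi_sum \<Lambda> a x = (\<Sum>c\<in>\<Lambda>. \<Sum>i<N. papp (a c i) (psi c i) x)"

lemma psi_sum_entire: "psi_sum \<Lambda> a holomorphic_on UNIV"
  unfolding psi_sum_def[abs_def] by (intro holomorphic_on_sum papp_entire psi_entire) auto

lemma airy_psi_sum: "airy_op N \<alpha> (psi_sum \<Lambda> a) x = psi_sum \<Lambda> (\<lambda>c i. T c (a c i)) x"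
proof -
  have *: "papp (a c i) (psi c i) analytic_on {x}" if "i < N" for c i x
    using that by (intro entire_analytic papp_entire psi_entire)
  have "papp h (psi_sum \<Lambda> a) x = (\<Sum>c\<in>\<Lambda>. \<Sum>i<N. papp h (papp (a c i) (psi c i)) x)"
    unfolding psi_sum_def[abs_def] using *
    by (subst papp_sum_fun, force intro!: analytic_on_sum) (intro sum.cong refl papp_sum_fun, auto)
  then have "airy_op N \<alpha> (psi_sum \<Lambda> a) x = (\<Sum>c\<in>\<Lambda>. \<Sum>i<N. airy_op N \<alpha> (papp (a c i) (psi c i)) x)"
    by (simp add: airy_op_papp psi_sum_def sum_distrib_left sum.distrib)
  then show ?thesis by (simp add: airy_papp psi_sum_def)
qed

lemma airy_pow_psi_sum: "(airy_op N \<alpha> ^^ s) (psi_sum \<Lambda> a) = psi_sum \<Lambda> (\<lambda>c i. (T c ^^ s) (a c i))"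
proof (induction s)
  case (Suc s)
  show ?case using Suc airy_psi_sum by (auto intro!: ext)
qed auto

lemma psi_indep:
  assumes "\<And>x. (\<Sum>i<N. k i * psi c i x) = 0" "i < N"
  shows "k i = 0"
proof -
  have "(\<Sum>i<N. k i * \<psi>s i x) = 0" for x
    using assms(1)[of "x + c / \<alpha> 0"] by (simp add: psi_def)
  then show ?thesis using basis assms(2) by (auto simp: airy_basis_def)
qed

text \<open>\<open>T c\<close> minus the scalar \<open>c'\<close> is a nonzero scalar minus a degree
  lowering operator, hence injective.\<close>

lemma T_eq_0:
  assumes "c \<noteq> c'" "T c a = smult c' a"
  shows "a = 0"
proof (rule ccontr)
  assume a: "a \<noteq> 0"
  have "smult (c - c') a = smult (\<alpha> 0) (pderiv a)"
    using assms by (simp add: T_def smult_diff_left algebra_simps)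
  then have "degree a = degree (pderiv a)"
    using assms \<alpha>0 by (metis degree_smult_eq right_minus_eq)
  then have "degree a = 0" by (simp add: degree_pderiv)
  then have "pderiv a = 0" by (simp add: pderiv_eq_0_iff)
  then have "smult (c - c') a = 0" using \<open>smult (c - c') a = _\<close> by simp
  then show False using a assms by simp
qed

text \<open>The degree plus one, so that passing from a nonzero constant to zero counts as a
  descent.\<close>

definition wt :: "complex poly \<Rightarrow> nat" where "wt a = (if a = 0 then 0 else Suc (degree a))"

lemma wt_T: "wt (T c a - smult c' a) \<le> wt a"
proof (cases "a = 0")
  case False
  have "degree (T c a - smult c' a) \<le> degree a"
    unfolding T_def by (intro degree_diff_le degree_smult_le[THEN order.trans]) (auto simp: degree_pderiv)
  then show ?thesis using False by (simp add: wt_def)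
qed (simp add: T_def)

lemma wt_T_less:
  assumes "a \<noteq> 0"
  shows "wt (T c a - smult c a) < wt a"
proof (cases "degree a = 0")
  case True
  then have "pderiv a = 0" by (simp add: pderiv_eq_0_iff)
  then show ?thesis using assms by (simp add: wt_def T_def)
next
  case False
  have "degree (T c a - smult c a) < degree a"
    using False by (simp add: T_def degree_pderiv)
  then show ?thesis using assms by (simp add: wt_def)
qed

text \<open>Applying \<open>M\<^sub>A\<^sub>i - c\<close> to a linear relation lowers the degree of the coefficients
  belonging to \<open>c\<close>, so a minimal relation is a constant one among the \<open>psi c i\<close>.\<close>

lemma psi_sum_indep:
  assumes "finite \<Lambda>" "\<And>x. psi_sum \<Lambda> a x = 0" "c \<in> \<Lambda>" "i < N"
  shows "a c i = 0"
  using assms(2-)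
proof (induction "\<Sum>c\<in>\<Lambda>. \<Sum>i<N. wt (a c i)" arbitrary: a c i rule: less_induct)
  case (less a c i)
  show ?case
  proof (rule ccontr)
    assume nz: "a c i \<noteq> 0"
    define b where "b c' i' = T c' (a c' i') - smult c (a c' i')" for c' i'
    have "psi_sum \<Lambda> b x = airy_op N \<alpha> (psi_sum \<Lambda> a) x - c * psi_sum \<Lambda> a x" for x
      by (simp add: airy_psi_sum psi_sum_def b_def papp_diff papp_smult sum_subtractf sum_distrib_left)
    moreover have "psi_sum \<Lambda> a = (\<lambda>_. 0)" using less.prems by auto
    ultimately have Sb: "psi_sum \<Lambda> b x = 0" for x
      by (simp add: airy_op_papp papp_zero_fun)
    have "(\<Sum>i<N. wt (b c' i)) \<le> (\<Sum>i<N. wt (a c' i))" for c'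
      by (intro sum_mono) (auto simp: b_def wt_T)
    moreover have "(\<Sum>i<N. wt (b c i)) < (\<Sum>i<N. wt (a c i))"
    proof (rule sum_strict_mono_ex1)
      show "\<exists>j\<in>{..<N}. wt (b c j) < wt (a c j)"
        using wt_T_less[OF nz] less.prems unfolding b_def by blast
    qed (auto simp: b_def wt_T)
    ultimately have "(\<Sum>c\<in>\<Lambda>. \<Sum>i<N. wt (b c i)) < (\<Sum>c\<in>\<Lambda>. \<Sum>i<N. wt (a c i))"
      using assms(1) less.prems by (intro sum_strict_mono_ex1) auto
    then have b0: "b c' i' = 0" if "c' \<in> \<Lambda>" "i' < N" for c' i'
      using less.hyps Sb that by blast
    \<comment> \<open>Vanishing of \<open>b\<close> means that \<open>T c'\<close> acts on
      \<open>a c' i'\<close> as the scalar \<open>c\<close>: for \<open>c' \<noteq> c\<close> this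
      leaves only zero, for \<open>c' = c\<close> only constants.\<close>
    have other: "a c' i' = 0" if "c' \<in> \<Lambda>" "i' < N" "c' \<noteq> c" for c' i'
      using b0[OF that(1,2)] T_eq_0[OF that(3)] by (simp add: b_def)
    have const: "degree (a c i') = 0" if "i' < N" for i'
      using b0[OF less.prems(2) that] \<alpha>0 by (simp add: b_def T_def pderiv_eq_0_iff)
    have "(\<Sum>i<N. coeff (a c i) 0 * psi c i x) = 0" for x
    proof -
      have "0 = psi_sum \<Lambda> a x" using less.prems by simp
      also have "\<dots> = (\<Sum>i<N. papp (a c i) (psi c i) x)"
        unfolding psi_sum_def using assms(1) less.prems other
        by (subst sum.remove[of _ c]) (auto intro!: sum.neutral)
      also have "\<dots> = (\<Sum>i<N. coeff (a c i) 0 * psi c i x)"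
        by (rule sum.cong) (auto simp: papp_def const)
      finally show ?thesis by simp
    qed
    then have "coeff (a c i) 0 = 0" using psi_indep[of "\<lambda>i. coeff (a c i) 0" c i] less.prems by blast
    then show False using nz const[OF less.prems(3)] by (metis degree_0_id pCons_0_0)
  qed
qed

text \<open>Horner's rule for \<open>u\<close> with \<open>X c\<close> in place of \<open>x\<close>.
  The new symbol depends on \<open>c\<close> and \<open>a\<close> but not on \<open>i\<close>, so
  tuples go to tuples.\<close>

lemma poly_mult_papp:
  "\<exists>B. \<forall>c a i x. i < N \<longrightarrow> poly u x * papp a (psi c i) x = papp (B c a) (psi c i) x"
proof (induction u)
  case 0
  show ?case by (intro exI[of _ "\<lambda>_ _. 0"]) auto
next
  case (pCons k u)
  then obtain B where "\<And>c a i x. i < N \<Longrightarrow> poly u x * papp a (psi c i) x = papp (B c a) (psi c i) x"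
    by blast
  then show ?case
    by (intro exI[of _ "\<lambda>c a. smult k a + X c (B c a)"])
      (auto simp: papp_add papp_smult algebra_simps simp flip: x_papp)
qed

section \<open>Tuples as in the theorem, where the shift is \<open>- c / \<alpha> 0\<close>\<close>

definition tup :: "complex \<Rightarrow> (nat \<Rightarrow> complex poly) \<Rightarrow> nat \<Rightarrow> complex \<Rightarrow> complex" where
  "tup c p i x = (\<Sum>j<N. (deriv ^^ j) (psi c i) x * poly (p j) x)"

text \<open>The last summand comes from eliminating the \<open>N\<close>-th derivative of \<open>psi c i\<close>.\<close>

definition Dt :: "complex \<Rightarrow> (nat \<Rightarrow> complex poly) \<Rightarrow> nat \<Rightarrow> complex poly" where
  "Dt c p j = pderiv (p j) + (if j = 0 then 0 else p (j - 1)) +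
     ((if j = 0 then [:c, - \<alpha> 0:] else 0) - [:coeff h j:]) * p (N - 1)"

lemma deriv_N_psi:
  assumes i: "i < N"
  shows "(deriv ^^ N) (psi c i) x = (\<Sum>j<N. (deriv ^^ j) (psi c i) x * poly ((if j = 0 then [:c, - \<alpha> 0:] else 0) - [:coeff h j:]) x)"
proof -
  have "papp h (psi c i) x = (deriv ^^ N) (psi c i) x + (\<Sum>j<N. coeff h j * (deriv ^^ j) (psi c i) x)"
    unfolding papp_def airy_symbol_degree[OF N]
    by (simp add: lessThan_Suc_atMost[symmetric] airy_symbol_coeff_N[OF N])
  then have "(deriv ^^ N) (psi c i) x = (c - \<alpha> 0 * x) * psi c i x - (\<Sum>j<N. coeff h j * (deriv ^^ j) (psi c i) x)"
    using airy_psi[OF i] by (simp add: algebra_simps)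
  also have "(c - \<alpha> 0 * x) * psi c i x = (\<Sum>j<N. if j = 0 then (deriv ^^ j) (psi c i) x * (c - \<alpha> 0 * x) else 0)"
    using N by (simp add: mult.commute)
  also have "\<dots> - (\<Sum>j<N. coeff h j * (deriv ^^ j) (psi c i) x) =
      (\<Sum>j<N. (deriv ^^ j) (psi c i) x * poly ((if j = 0 then [:c, - \<alpha> 0:] else 0) - [:coeff h j:]) x)"
    unfolding sum_subtractf[symmetric] by (intro sum.cong refl) (auto simp: algebra_simps)
  finally show ?thesis .
qed

lemma deriv_tup:
  assumes i: "i < N"
  shows "deriv (tup c p i) = tup c (Dt c p) i"
proof
  fix x
  have fd: "(deriv ^^ j) (psi c i) field_differentiable at x" for j
    using holomorphic_higher_deriv[OF psi_entire[OF i] open_UNIV] by (simp add: holomorphic_on_def)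
  have "(tup c p i has_field_derivative (\<Sum>j<N. (deriv ^^ Suc j) (psi c i) x * poly (p j) x +
      (deriv ^^ j) (psi c i) x * poly (pderiv (p j)) x)) (at x)"
    unfolding tup_def[abs_def]
  proof (rule DERIV_sum)
    fix j
    show "((\<lambda>x. (deriv ^^ j) (psi c i) x * poly (p j) x) has_field_derivative
        (deriv ^^ Suc j) (psi c i) x * poly (p j) x +
        (deriv ^^ j) (psi c i) x * poly (pderiv (p j)) x) (at x)"
      using DERIV_mult[OF DERIV_deriv_iff_field_differentiable[THEN iffD2, OF fd[of j]] poly_DERIV[of "p j" x]]
      by (simp add: algebra_simps)
  qed
  then have "deriv (tup c p i) x = (\<Sum>j<N. (deriv ^^ Suc j) (psi c i) x * poly (p j) x) +
      (\<Sum>j<N. (deriv ^^ j) (psi c i) x * poly (pderiv (p j)) x)"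
    by (simp add: DERIV_imp_deriv sum.distrib)
  also have "(\<Sum>j<N. (deriv ^^ Suc j) (psi c i) x * poly (p j) x) =
      (\<Sum>j<N. (deriv ^^ j) (psi c i) x * poly (if j = 0 then 0 else p (j - 1)) x) +
      (deriv ^^ N) (psi c i) x * poly (p (N - 1)) x"
  proof -
    obtain M where M: "N = Suc M" using N gr0_implies_Suc by blast
    show ?thesis unfolding M by (subst (2) sum.lessThan_Suc_shift) simp
  qed
  also have "(deriv ^^ N) (psi c i) x * poly (p (N - 1)) x =
     (\<Sum>j<N. (deriv ^^ j) (psi c i) x * poly (((if j = 0 then [:c, - \<alpha> 0:] else 0) - [:coeff h j:]) * p (N - 1)) x)"
    by (simp only: deriv_N_psi[OF i] sum_distrib_right poly_mult mult.assoc)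
  finally show "deriv (tup c p i) x = tup c (Dt c p) i x"
    unfolding tup_def Dt_def by (simp only: poly_add distrib_left sum.distrib add_ac)
qed

lemma higher_deriv_tup: "i < N \<Longrightarrow> (deriv ^^ l) (tup c p i) = tup c ((Dt c ^^ l) p) i"
  by (induction l) (auto simp: deriv_tup)

text \<open>Each further derivative is reduced to order below \<open>N\<close> through
  \<open>Dt\<close>. As \<open>p\<close> is chosen before \<open>i\<close>, the functions for the
  different \<open>i\<close> form one tuple.\<close>

lemma papp_eq_tup: "\<exists>p. \<forall>i<N. papp a (psi c i) = tup c p i"
proof (induction a)
  case 0
  show ?case by (intro exI[of _ "\<lambda>_. 0"]) (auto simp: tup_def)
next
  case (pCons k a)
  then obtain p where p: "\<And>i. i < N \<Longrightarrow> papp a (psi c i) = tup c p i" by blast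
  show ?case
  proof (intro exI[of _ "\<lambda>j. (if j = 0 then [:k:] else 0) + Dt c p j"] allI impI ext)
    fix i x assume i: "i < N"
    have "k * psi c i x = (\<Sum>j<N. (deriv ^^ j) (psi c i) x * poly (if j = 0 then [:k:] else 0) x)"
    proof -
      have "(\<Sum>j<N. (deriv ^^ j) (psi c i) x * poly (if j = 0 then [:k:] else 0) x) =
          (\<Sum>j<N. if j = 0 then k * (deriv ^^ j) (psi c i) x else 0)"
        by (rule sum.cong) auto
      then show ?thesis using N by simp
    qed
    then show "papp (pCons k a) (psi c i) x = tup c (\<lambda>j. (if j = 0 then [:k:] else 0) + Dt c p j) i x"
      using papp_pCons[OF psi_entire[OF i], of k a c x]
      by (simp add: p[OF i] deriv_tup[OF i]) (simp add: tup_def distrib_left sum.distrib)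
  qed
qed

text \<open>Multiplication by \<open>p j\<close> is absorbed into the symbol by
  \<open>poly_mult_papp\<close>, again uniformly in \<open>i\<close>.\<close>

lemma tup_eq_papp: "\<exists>a. \<forall>i<N. tup c p i = papp a (psi c i)"
proof -
  have "\<exists>a. \<forall>i x. i < N \<longrightarrow> (deriv ^^ j) (psi c i) x * poly (p j) x = papp a (psi c i) x" for j
  proof -
    obtain B where "\<And>c a i x. i < N \<Longrightarrow> poly (p j) x * papp a (psi c i) x = papp (B c a) (psi c i) x"
      using poly_mult_papp by blast
    from this[of _ _ "monom 1 j" c] show ?thesis
      by (intro exI[of _ "B c (monom 1 j)"]) (auto simp: papp_monom mult.commute[of _ "poly _ _"] simp flip: )
  qed
  then obtain a where "\<And>j i x. i < N \<Longrightarrow> (deriv ^^ j) (psi c i) x * poly (p j) x = papp (a j) (psi c i) x"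
    by metis
  then show ?thesis
    by (intro exI[of _ "\<Sum>j<N. a j"]) (auto simp: tup_def papp_sum)
qed

text \<open>The action of \<open>p(M\<^sub>A\<^sub>i)\<close> on \<open>a(\<partial>) (psi c i)\<close>, transported to \<open>a\<close>.\<close>

definition tact :: "complex \<Rightarrow> complex poly \<Rightarrow> complex poly \<Rightarrow> complex poly" where
  "tact c p a = (\<Sum>s\<le>degree p. smult (coeff p s) ((T c ^^ s) a))"

lemma T_add: "T c (a + b) = T c a + T c b"
  by (simp add: T_def pderiv_add smult_add_right)

lemma T_smult: "T c (smult k a) = smult k (T c a)"
  by (simp add: T_def pderiv_smult smult_diff_right mult.commute)

lemma T_0 [simp]: "T c 0 = 0"
  by (simp add: T_def)

lemma T_sum: "T c (\<Sum>s\<in>S. f s) = (\<Sum>s\<in>S. T c (f s))"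
  by (induction S rule: infinite_finite_induct) (auto simp: T_add)

lemma tact_extend:
  assumes "degree p \<le> L"
  shows "tact c p a = (\<Sum>s\<le>L. smult (coeff p s) ((T c ^^ s) a))"
  unfolding tact_def by (rule sum.mono_neutral_left) (use assms in \<open>auto simp: coeff_eq_0\<close>)

lemma tact_pCons: "tact c (pCons k p) a = smult k a + T c (tact c p a)"
proof -
  have "tact c (pCons k p) a = (\<Sum>s\<le>Suc (degree p). smult (coeff (pCons k p) s) ((T c ^^ s) a))"
    by (rule tact_extend) (rule degree_pCons_le)
  then show ?thesis
    by (simp only: sum.atMost_Suc_shift) (simp add: tact_def T_sum T_smult)
qed

lemma tact_0 [simp]: "tact c 0 a = 0" and tact_0_right [simp]: "tact c p 0 = 0"
proof -
  show "tact c 0 a = 0" by (simp add: tact_def)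
  show "tact c p 0 = 0" by (induction p) (simp_all add: tact_pCons, simp add: tact_def)
qed

lemma tact_add: "tact c (p + q) a = tact c p a + tact c q a"
proof -
  define L where "L = max (degree p) (degree q)"
  have "degree (p + q) \<le> L" unfolding L_def by (rule degree_add_le_max)
  then show ?thesis
    by (simp add: tact_extend[of _ L] L_def sum.distrib smult_add_left)
qed

lemma tact_sum: "tact c (\<Sum>s\<in>S. p s) a = (\<Sum>s\<in>S. tact c (p s) a)"
  by (induction S rule: infinite_finite_induct) (auto simp: tact_add)

lemma tact_smult: "tact c (smult k p) a = smult k (tact c p a)"
proof (induction p)
  case (pCons l p)
  then show ?case by (simp add: tact_pCons T_smult smult_add_right)
qed auto

lemma tact_add_right: "tact c p (a + b) = tact c p a + tact c p b"
  by (induction p) (auto simp: tact_pCons T_add smult_add_right)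

lemma tact_sum_right: "tact c p (\<Sum>s\<in>S. a s) = (\<Sum>s\<in>S. tact c p (a s))"
  by (induction S rule: infinite_finite_induct) (auto simp: tact_add_right)

lemma tact_mult: "tact c (p * q) a = tact c p (tact c q a)"
proof (induction p)
  case (pCons k p)
  have "tact c (pCons 0 (p * q)) a = T c (tact c p (tact c q a))"
    using pCons by (simp add: tact_pCons)
  then show ?case by (simp add: tact_add tact_smult tact_pCons)
qed auto

lemma tact_linear_factor: "tact c [:- c, 1:] a = - smult (\<alpha> 0) (pderiv a)"
  by (simp add: tact_pCons T_def)

text \<open>The factor t - c acts as \<open>- \<alpha> 0\<close> times differentiation and lowers
  degrees. The zero polynomial is listed apart because its degree is 0 by convention.\<close>

lemma tact_power_eq_0:
  assumes "a = 0 \<or> degree a < s"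
  shows "tact c ([:- c, 1:] ^ s) a = 0"
  using assms
proof (induction s arbitrary: a)
  case (Suc s)
  have "pderiv a = 0 \<or> degree (pderiv a) < s"
    using Suc.prems by (auto simp: degree_pderiv pderiv_eq_0_iff)
  then have "tact c [:- c, 1:] a = 0 \<or> degree (tact c [:- c, 1:] a) < s"
    using \<alpha>0 by (auto simp: tact_linear_factor)
  then have "tact c ([:- c, 1:] ^ s * [:- c, 1:]) a = 0"
    unfolding tact_mult using Suc.IH by blast
  then show ?case by (simp only: power_Suc2)
qed auto

lemma tact_dvd_eq_0:
  assumes "[:- c, 1:] ^ s dvd p" "a = 0 \<or> degree a < s"
  shows "tact c p a = 0"
proof -
  obtain q where "p = q * [:- c, 1:] ^ s" using assms(1) by (metis dvdE mult.commute)
  then show ?thesis using tact_power_eq_0[OF assms(2)] by (simp add: tact_mult)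
qed

lemma airy_poly_psi_sum:
  "(\<Sum>s\<le>degree p. coeff p s * (airy_op N \<alpha> ^^ s) (psi_sum \<Lambda> a) x) = psi_sum \<Lambda> (\<lambda>c i. tact c p (a c i)) x"
proof -
  have "(\<Sum>s\<le>degree p. coeff p s * (airy_op N \<alpha> ^^ s) (psi_sum \<Lambda> a) x) =
      (\<Sum>s\<le>degree p. \<Sum>c\<in>\<Lambda>. \<Sum>i<N. coeff p s * papp ((T c ^^ s) (a c i)) (psi c i) x)"
    by (simp add: airy_pow_psi_sum psi_sum_def sum_distrib_left)
  also have "\<dots> = (\<Sum>c\<in>\<Lambda>. \<Sum>s\<le>degree p. \<Sum>i<N. coeff p s * papp ((T c ^^ s) (a c i)) (psi c i) x)"
    by (rule sum.swap)
  also have "\<dots> = (\<Sum>c\<in>\<Lambda>. \<Sum>i<N. \<Sum>s\<le>degree p. coeff p s * papp ((T c ^^ s) (a c i)) (psi c i) x)"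
    by (rule sum.cong[OF refl], rule sum.swap)
  finally show ?thesis by (simp add: psi_sum_def tact_def papp_sum papp_smult)
qed

end

section \<open>Rational functions and coefficient uniqueness\<close>

lemma poly_nonzero_cosparse: "p \<noteq> 0 \<Longrightarrow> \<forall>\<^sub>\<approx>x. poly p (x::complex) \<noteq> 0"
  unfolding eventually_cosparse
  by (intro finite_imp_sparse) (simp add: poly_roots_finite)

lemma poly_analytic: "poly p analytic_on (A :: complex set)"
proof -
  have "poly p = (\<lambda>x. \<Sum>i\<le>degree p. coeff p i * x ^ i)" by (simp add: poly_altdef fun_eq_iff)
  then show ?thesis by (auto intro!: analytic_intros)
qed

lemma rational_cosparse:
  assumes "rational_fun f"
  obtains p q where "q \<noteq> 0" "\<forall>\<^sub>\<approx>x. poly q x \<noteq> 0 \<and> f x = poly p x / poly q x"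
proof -
  obtain p q where q: "q \<noteq> 0" "\<And>x. poly q x \<noteq> 0 \<Longrightarrow> f x = poly p x / poly q x"
    using assms by (auto simp: rational_fun_def)
  have "\<forall>\<^sub>\<approx>x. poly q x \<noteq> 0 \<and> f x = poly p x / poly q x"
    using poly_nonzero_cosparse[OF q(1)] by eventually_elim (use q in auto)
  then show ?thesis using that q by blast
qed

lemma rational_mero:
  assumes "rational_fun f" shows "f meromorphic_on UNIV"
proof -
  obtain p q where q: "\<forall>\<^sub>\<approx>x. poly q x \<noteq> 0 \<and> f x = poly p x / poly q x"
    using rational_cosparse[OF assms] by blast
  have "(\<lambda>x. poly p x / poly q x) meromorphic_on UNIV"
    by (intro meromorphic_intros analytic_on_imp_meromorphic_on poly_analytic)
  moreover have "\<forall>\<^sub>\<approx>x. f x = poly p x / poly q x"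
    using q by eventually_elim auto
  ultimately show ?thesis
    using meromorphic_on_cong'[of f "\<lambda>x. poly p x / poly q x" UNIV UNIV] by simp
qed

lemma rational_poly [intro]: "rational_fun (poly p)"
  unfolding rational_fun_def by (intro exI[of _ p] exI[of _ 1]) auto

lemma rational_const [intro]: "rational_fun (\<lambda>_. k)"
  unfolding rational_fun_def by (intro exI[of _ "[:k:]"] exI[of _ 1]) auto

lemma rational_add [intro]:
  assumes "rational_fun f" "rational_fun g"
  shows "rational_fun (\<lambda>x. f x + g x)"
proof -
  obtain p q p' q' where "q \<noteq> 0" "\<And>x. poly q x \<noteq> 0 \<Longrightarrow> f x = poly p x / poly q x"
    "q' \<noteq> 0" "\<And>x. poly q' x \<noteq> 0 \<Longrightarrow> g x = poly p' x / poly q' x"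
    using assms unfolding rational_fun_def by metis
  then show ?thesis unfolding rational_fun_def
    by (intro exI[of _ "p * q' + p' * q"] exI[of _ "q * q'"]) (auto simp: field_simps)
qed

lemma rational_mult [intro]:
  assumes "rational_fun f" "rational_fun g"
  shows "rational_fun (\<lambda>x. f x * g x)"
proof -
  obtain p q p' q' where "q \<noteq> 0" "\<And>x. poly q x \<noteq> 0 \<Longrightarrow> f x = poly p x / poly q x"
    "q' \<noteq> 0" "\<And>x. poly q' x \<noteq> 0 \<Longrightarrow> g x = poly p' x / poly q' x"
    using assms unfolding rational_fun_def by metis
  then show ?thesis unfolding rational_fun_def
    by (intro exI[of _ "p * p'"] exI[of _ "q * q'"]) auto
qed

lemma rational_divide [intro]:
  assumes "rational_fun f" "rational_fun g"
  shows "rational_fun (\<lambda>x. f x / g x)"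
proof -
  obtain p q p' q' where 1: "q \<noteq> 0" "\<And>x. poly q x \<noteq> 0 \<Longrightarrow> f x = poly p x / poly q x"
    "q' \<noteq> 0" "\<And>x. poly q' x \<noteq> 0 \<Longrightarrow> g x = poly p' x / poly q' x"
    using assms unfolding rational_fun_def by metis
  show ?thesis
  proof (cases "p' = 0")
    case True
    then show ?thesis using 1 unfolding rational_fun_def
      by (intro exI[of _ 0] exI[of _ q']) auto
  next
    case False
    then show ?thesis using 1 unfolding rational_fun_def
      by (intro exI[of _ "p * q' * q'"] exI[of _ "q * q' * p'"]) auto
  qed
qed

lemma rational_sum [intro]:
  assumes "\<And>s. s \<in> S \<Longrightarrow> rational_fun (f s)"
  shows "rational_fun (\<lambda>x. \<Sum>s\<in>S. f s x)"
  using assms by (induction S rule: infinite_finite_induct) auto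

lemma rational_deriv [intro]:
  assumes "rational_fun f"
  shows "rational_fun (deriv f)"
proof -
  obtain p q where q: "q \<noteq> 0" "\<And>x. poly q x \<noteq> 0 \<Longrightarrow> f x = poly p x / poly q x"
    using assms unfolding rational_fun_def by metis
  have "deriv f x = poly (pderiv p * q - p * pderiv q) x / poly (q * q) x" if x: "poly q x \<noteq> 0" for x
  proof -
    have "eventually (\<lambda>y. poly q y \<noteq> 0) (nhds x)"
      using x by (intro tendsto_imp_eventually_ne[of "poly q" "poly q x"] isCont_tendsto_compose[of x "poly q" "\<lambda>y. y"])
        (auto simp: filterlim_ident)
    then have "eventually (\<lambda>y. f y = poly p y / poly q y) (nhds x)"
      by eventually_elim (use q in auto)
    then have "deriv f x = deriv (\<lambda>y. poly p y / poly q y) x"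
      by (rule deriv_cong_ev) auto
    also have "\<dots> = (poly (pderiv p) x * poly q x - poly p x * poly (pderiv q) x) / (poly q x * poly q x)"
      by (rule DERIV_imp_deriv, rule DERIV_divide) (use x in \<open>auto intro!: poly_DERIV\<close>)
    finally show ?thesis by simp
  qed
  then show ?thesis unfolding rational_fun_def using q
    by (intro exI[of _ "pderiv p * q - p * pderiv q"] exI[of _ "q * q"]) auto
qed

lemma rational_dop:
  assumes "\<And>i. rational_fun (a i)"
  shows "rational_fun ((dop ^^ j) a i)"
  using assms
proof (induction j arbitrary: i)
  case (Suc j)
  then show ?case by (cases "i = 0") (auto simp: dop_def[of "(dop ^^ j) a"])
qed auto

text \<open>The Leibniz formula is a polynomial in the entries. The class \<open>C\<close> is kept
  abstract so that one proof serves meromorphic and rational functions.\<close>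

lemma det_closed:
  fixes M :: "complex \<Rightarrow> complex mat"
  assumes C: "\<And>k. C (\<lambda>_. k)" "\<And>f g. C f \<Longrightarrow> C g \<Longrightarrow> C (\<lambda>x. f x + g x)"
    "\<And>f g. C f \<Longrightarrow> C g \<Longrightarrow> C (\<lambda>x. f x * g x)"
    and M: "\<And>x. M x \<in> carrier_mat n n" "\<And>r c. r < n \<Longrightarrow> c < n \<Longrightarrow> C (\<lambda>x. M x $$ (r, c))"
  shows "C (\<lambda>x. det (M x))"
proof -
  have sum: "C (\<lambda>x. \<Sum>s\<in>S. f s x)" if "\<And>s. s \<in> S \<Longrightarrow> C (f s)" for S :: "(nat \<Rightarrow> nat) set" and f
    using that by (induction S rule: infinite_finite_induct) (auto intro: C)
  have prod: "C (\<lambda>x. \<Prod>s\<in>S. f s x)" if "\<And>s. s \<in> S \<Longrightarrow> C (f s)" for S :: "nat set" and f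
    using that by (induction S rule: infinite_finite_induct) (auto intro: C)
  have "(\<lambda>x. det (M x)) = (\<lambda>x. \<Sum>p | p permutes {0..<n}. signof p * (\<Prod>i = 0..<n. M x $$ (i, p i)))"
    using det_def'[OF M(1)] by auto
  moreover have "C \<dots>"
    by (intro sum C prod) (auto intro!: M)
  ultimately show ?thesis by simp
qed

lemma adj_closed:
  fixes M :: "complex \<Rightarrow> complex mat"
  assumes C: "\<And>k. C (\<lambda>_. k)" "\<And>f g. C f \<Longrightarrow> C g \<Longrightarrow> C (\<lambda>x. f x + g x)"
    "\<And>f g. C f \<Longrightarrow> C g \<Longrightarrow> C (\<lambda>x. f x * g x)"
    and M: "\<And>x. M x \<in> carrier_mat n n" "\<And>r c. r < n \<Longrightarrow> c < n \<Longrightarrow> C (\<lambda>x. M x $$ (r, c))"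
    and rc: "r < n" "c < n"
  shows "C (\<lambda>x. adj_mat (M x) $$ (r, c))"
proof -
  have "C (\<lambda>x. det (mat_delete (M x) c r))"
  proof (rule det_closed[OF C, where n = "n - 1"])
    show "mat_delete (M x) c r \<in> carrier_mat (n - 1) (n - 1)" for x
      using M(1)[of x] by (auto simp: mat_delete_def)
    fix i j assume "i < n - 1" "j < n - 1"
    then show "C (\<lambda>x. mat_delete (M x) c r $$ (i, j))"
      using M(1) M(2)[of "if i < c then i else Suc i" "if j < r then j else Suc j"] by (auto simp: mat_delete_def carrier_matD[OF M(1)])
  qed assumption+
  then have "C (\<lambda>x. (-1) ^ (c + r) * det (mat_delete (M x) c r))"
    by (intro C)
  moreover have "adj_mat (M x) $$ (r, c) = (-1) ^ (c + r) * det (mat_delete (M x) c r)" for x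
    using M(1)[of x] rc by (auto simp: adj_mat_def cofactor_def)
  ultimately show ?thesis by simp
qed

lemma det_inj:
  assumes "det (mat n n (\<lambda>(r, c). a r c)) \<noteq> (0::complex)"
    "\<forall>r<n. (\<Sum>c<n. a r c * v c) = 0"
  shows "\<forall>c<n. v c = 0"
proof -
  let ?M = "mat n n (\<lambda>(r, c). a r c)"
  have M: "?M \<in> carrier_mat n n" by simp
  have "?M *\<^sub>v Matrix.vec n v = 0\<^sub>v n"
    using assms(2) by (intro eq_vecI) (auto simp: scalar_prod_def atLeast0LessThan)
  then have "Matrix.vec n v = 0\<^sub>v n"
    using det_0_iff_vec_prod_zero[OF M] assms(1) by (metis vec_carrier)
  then show ?thesis by (metis index_vec index_zero_vec(1))
qed

section \<open>Uniqueness of coefficients and of solutions\<close>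

lemma deriv_pow_same: "(deriv ^^ i) (\<lambda>w. w ^ i) x = (fact i :: complex)"
  using higher_deriv_power[of i 0 i x] by (simp add: pochhammer_fact)

lemma deriv_pow_zero: "l > i \<Longrightarrow> (deriv ^^ l) (\<lambda>w. w ^ i) x = (0 :: complex)"
  using higher_deriv_power[of l 0 i x] by (simp add: pochhammer_0_left)

text \<open>Testing on the power x^i in a single component isolates the coefficient
  \<open>i\<close>: derivatives beyond the \<open>i\<close>-th vanish, and the lower coefficients
  are already known to agree.\<close>

lemma mop_coeff_unique:
  assumes eq: "\<And>F r. (\<And>c. F c meromorphic_on UNIV) \<Longrightarrow> r < n \<Longrightarrow> \<forall>\<^sub>\<approx>x. mop n K A F r x = mop n K B F r x"
    and rc: "r < n" "c < n"
  shows "i < K \<Longrightarrow> \<forall>\<^sub>\<approx>x. A r c i x = B r c i x"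
proof (induction i rule: less_induct)
  case (less i)
  define F where "F c' = (if c' = c then (\<lambda>x::complex. x ^ i) else (\<lambda>_. 0))" for c'
  have "\<forall>\<^sub>\<approx>x. mop n K A F r x = mop n K B F r x"
    by (rule eq) (auto simp: F_def rc intro!: meromorphic_intros)
  moreover have "\<forall>\<^sub>\<approx>x. \<forall>l\<in>{..<i}. A r c l x = B r c l x"
    using less by (intro eventually_ball_finite) auto
  ultimately show ?case
  proof eventually_elim
    case (elim x)
    have *: "mop n K A F r x = (\<Sum>l<i. A r c l x * (deriv ^^ l) (\<lambda>w. w ^ i) x) + A r c i x * fact i" for A
    proof -
      have "mop n K A F r x = sop K (A r c) (F c) x"
        unfolding mop_def using rc by (subst sum.remove[of _ c]) (auto simp: F_def sop_def intro!: sum.neutral)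
      also have "\<dots> = (\<Sum>l<Suc i. A r c l x * (deriv ^^ l) (\<lambda>w. w ^ i) x)"
        unfolding sop_def using less.prems
        by (intro sum.mono_neutral_cong_right) (auto simp: F_def deriv_pow_zero)
      finally show ?thesis by (simp add: deriv_pow_same)
    qed
    have "(\<Sum>l<i. A r c l x * (deriv ^^ l) (\<lambda>w. w ^ i) x) = (\<Sum>l<i. B r c l x * (deriv ^^ l) (\<lambda>w. w ^ i) x)"
      using elim by (intro sum.cong) auto
    then show ?case using elim *[of A] *[of B] by simp
  qed
qed

lemma analytic_zero_nhds:
  assumes "f analytic_on {x}" "eventually (\<lambda>y. f y = (0::complex)) (at x)"
  shows "eventually (\<lambda>y. f y = 0) (nhds x)"
proof -
  have "isCont f x" using assms(1) analytic_at_imp_isCont by blast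
  then have "f \<midarrow>x\<rightarrow> f x" by (simp add: isCont_def)
  moreover have "f \<midarrow>x\<rightarrow> 0" using assms(2) by (simp add: tendsto_eventually)
  ultimately have "f x = 0" using LIM_unique by blast
  then show ?thesis using assms(2) by (simp add: eventually_nhds_conv_at)
qed

text \<open>By \<open>jet_unique\<close> all derivatives at \<open>x\<close> vanish, and the
  identity theorem spreads this over the plane. The equation, given only off a discrete set, is
  first extended to a full neighbourhood of \<open>x\<close> by continuity.\<close>

lemma mop_unique:
  fixes F :: "nat \<Rightarrow> complex \<Rightarrow> complex"
  assumes an: "\<And>r c i. A r c i analytic_on {x}"
    and F: "\<And>c. c < n \<Longrightarrow> F c meromorphic_on UNIV" "\<And>c. c < n \<Longrightarrow> F c analytic_on {x}"
    and z: "\<And>r c i. i > k \<Longrightarrow> A r c i = (\<lambda>_. 0)"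
    and ker: "\<And>r. r < n \<Longrightarrow> \<forall>\<^sub>\<approx>y. mop n (Suc k) A F r y = 0"
    and det: "det (mat n n (\<lambda>(r, c). A r c k x)) \<noteq> 0"
    and jet: "\<And>i c. i < k \<Longrightarrow> c < n \<Longrightarrow> (deriv ^^ i) (F c) x = 0"
    and c: "c < n"
  shows "\<forall>\<^sub>\<approx>y. F c y = 0"
proof (rule mero_zero_derivs[OF F(1)[OF c] F(2)[OF c]])
  fix l
  show "(deriv ^^ l) (F c) x = 0"
  proof (rule jet_unique[OF an F(2) z _ _ jet c])
    have "\<forall>r\<in>{..<n}. eventually (\<lambda>y. mop n (Suc k) A F r y = 0) (nhds x)"
      using ker an F by (intro ballI analytic_zero_nhds mop_analytic cosparse_at) auto
    then have "eventually (\<lambda>y. \<forall>r\<in>{..<n}. mop n (Suc k) A F r y = 0) (nhds x)"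
      by (intro eventually_ball_finite) auto
    then show "eventually (\<lambda>y. \<forall>r<n. mop n (Suc k) A F r y = 0) (nhds x)"
      by (simp add: Ball_def)
  qed (use det_inj[OF det] in auto)
qed

text \<open>\<open>acoef N \<alpha> s\<close> are the coefficients of the \<open>s\<close>-th power of \<open>M\<^sub>A\<^sub>i\<close>.\<close>

primrec acoef :: "nat \<Rightarrow> (nat \<Rightarrow> complex) \<Rightarrow> nat \<Rightarrow> nat \<Rightarrow> complex \<Rightarrow> complex" where
  "acoef N \<alpha> 0 = (\<lambda>i x. if i = 0 then 1 else 0)"
| "acoef N \<alpha> (Suc s) = (\<lambda>i x. (\<Sum>l\<le>degree (airy_symbol N \<alpha>). coeff (airy_symbol N \<alpha>) l * (dop ^^ l) (acoef N \<alpha> s) i x)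
      + \<alpha> 0 * x * acoef N \<alpha> s i x)"

lemma dop_poly:
  assumes "\<And>i. \<exists>p. a i = poly p"
  shows "\<exists>p. (dop ^^ j) a i = poly p"
  using assms
proof (induction j arbitrary: i)
  case (Suc j)
  then obtain p p' where p: "(dop ^^ j) a i = poly p" "(dop ^^ j) a (i - 1) = poly p'" by metis
  have "(dop ^^ Suc j) a i = poly (pderiv p + (if i = 0 then 0 else p'))"
    using p by (cases "i = 0") (auto simp: dop_def[of "(dop ^^ j) a"] DERIV_imp_deriv[OF poly_DERIV] poly_eq_poly_eq_iff)
  then show ?case ..
qed auto

lemma acoef_poly: "\<exists>p. acoef N \<alpha> s i = poly p"
proof (induction s arbitrary: i)
  case 0
  show ?case by (intro exI[of _ "if i = 0 then 1 else 0"]) auto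
next
  case (Suc s)
  have "\<forall>l. \<exists>p. (dop ^^ l) (acoef N \<alpha> s) i = poly p"
    using dop_poly[of "acoef N \<alpha> s"] Suc by blast
  then obtain p where p: "\<And>l. (dop ^^ l) (acoef N \<alpha> s) i = poly (p l)"
    by (auto dest: choice)
  obtain p' where p': "acoef N \<alpha> s i = poly p'" using Suc by blast
  show ?case
    by (intro exI[of _ "(\<Sum>l\<le>degree (airy_symbol N \<alpha>). smult (coeff (airy_symbol N \<alpha>) l) (p l)) + [:0, \<alpha> 0:] * p'"])
      (simp only: acoef.simps p p', simp add: poly_sum fun_eq_iff)
qed

lemma acoef_analytic: "acoef N \<alpha> s i analytic_on {x}"
  using acoef_poly[of N \<alpha> s i] poly_analytic by metis

lemma acoef_rational: "rational_fun (acoef N \<alpha> s i)"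
  using acoef_poly[of N \<alpha> s i] rational_poly by metis

context
  fixes N :: nat and \<alpha> :: "nat \<Rightarrow> complex"
  assumes N: "N > 0"
begin

lemma acoef_zero: "i > N * s \<Longrightarrow> acoef N \<alpha> s i = (\<lambda>_. 0)"
proof (induction s arbitrary: i)
  case (Suc s)
  have "(dop ^^ l) (acoef N \<alpha> s) i = (\<lambda>_. 0)" if "l \<le> N" for l
    by (rule dop_pow_zero[of "Suc (N * s)"]) (use Suc that in auto)
  then show ?case using Suc by (auto simp: airy_symbol_degree[OF N])
qed auto

text \<open>M is monic of order \<open>N\<close>: the summand \<open>\<alpha> 0 * x\<close> does not
  raise the order and so misses the index \<open>N * s + N\<close>.\<close>

lemma acoef_top: "acoef N \<alpha> s (N * s) = (\<lambda>_. 1)"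
proof (induction s)
  case (Suc s)
  have "(dop ^^ l) (acoef N \<alpha> s) (N * s + N) = (\<lambda>_. 0)" if "l < N" for l
    by (rule dop_pow_zero[of "Suc (N * s)"]) (use acoef_zero that in auto)
  moreover have "(dop ^^ N) (acoef N \<alpha> s) (N * s + N) = (\<lambda>_. 1)"
    using dop_pow_top[of "N * s" "acoef N \<alpha> s" N] acoef_zero Suc by auto
  moreover have "acoef N \<alpha> s (N * s + N) = (\<lambda>_. 0)"
    using N by (intro acoef_zero) auto
  ultimately show ?case
    by (auto simp: airy_symbol_degree[OF N] airy_symbol_coeff_N[OF N] lessThan_Suc_atMost[symmetric] add.commute)
qed auto

lemma airy_pow_sop:
  assumes "g analytic_on {x}"
  shows "(airy_op N \<alpha> ^^ s) g x = sop (Suc (N * s)) (acoef N \<alpha> s) g x"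
  using assms
proof (induction s arbitrary: x)
  case 0
  then show ?case by (simp add: sop_def)
next
  case (Suc s)
  let ?h = "airy_symbol N \<alpha>"
  have ev: "eventually (\<lambda>y. (airy_op N \<alpha> ^^ s) g y = sop (Suc (N * s)) (acoef N \<alpha> s) g y) (nhds x)"
    using analytic_at_nhds[OF Suc.prems] by eventually_elim (rule Suc.IH)
  have "(airy_op N \<alpha> ^^ Suc s) g x = (\<Sum>l\<le>degree ?h. coeff ?h l * (deriv ^^ l) ((airy_op N \<alpha> ^^ s) g) x)
      + \<alpha> 0 * x * (airy_op N \<alpha> ^^ s) g x"
    by (simp add: airy_op_papp papp_def)
  also have "\<dots> = (\<Sum>l\<le>degree ?h. coeff ?h l * sop (Suc (N * Suc s)) ((dop ^^ l) (acoef N \<alpha> s)) g x)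
      + \<alpha> 0 * x * sop (Suc (N * Suc s)) (acoef N \<alpha> s) g x"
  proof (intro arg_cong2[of _ _ _ _ "(+)"] sum.cong refl arg_cong2[of _ _ _ _ "(*)"])
    fix l assume "l \<in> {..degree ?h}"
    then have l: "l \<le> N" by (simp add: airy_symbol_degree[OF N])
    have "(deriv ^^ l) ((airy_op N \<alpha> ^^ s) g) x = (deriv ^^ l) (sop (Suc (N * s)) (acoef N \<alpha> s) g) x"
      by (rule higher_deriv_cong_ev[OF ev]) auto
    also have "\<dots> = sop (Suc (N * s) + l) ((dop ^^ l) (acoef N \<alpha> s)) g x"
      by (rule higher_deriv_sop) (auto simp: acoef_analytic Suc.prems acoef_zero)
    also have "\<dots> = sop (Suc (N * Suc s)) ((dop ^^ l) (acoef N \<alpha> s)) g x"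
      by (rule sop_extend[symmetric]) (use l in \<open>auto intro!: dop_pow_zero[of "Suc (N * s)"] acoef_zero\<close>)
    finally show "(deriv ^^ l) ((airy_op N \<alpha> ^^ s) g) x = sop (Suc (N * Suc s)) ((dop ^^ l) (acoef N \<alpha> s)) g x" .
  next
    show "(airy_op N \<alpha> ^^ s) g x = sop (Suc (N * Suc s)) (acoef N \<alpha> s) g x"
      using Suc.IH[OF Suc.prems] sop_extend[of "Suc (N * s)" "acoef N \<alpha> s" "Suc (N * Suc s)" g x] acoef_zero by auto
  qed
  also have "\<dots> = sop (Suc (N * Suc s)) (acoef N \<alpha> (Suc s)) g x"
  proof -
    have "(\<Sum>l\<le>degree ?h. coeff ?h l * sop K ((dop ^^ l) (acoef N \<alpha> s)) g x)
      + \<alpha> 0 * x * sop K (acoef N \<alpha> s) g x = sop K (acoef N \<alpha> (Suc s)) g x" for K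
      unfolding sop_def acoef.simps
      by (simp add: distrib_right sum.distrib sum_distrib_left sum_distrib_right mult.assoc) (rule sum.swap)
    then show ?thesis .
  qed
  finally show ?case .
qed

end

section \<open>Kernels of matrix differential operators\<close>

definition comps :: "(complex \<Rightarrow> complex vec) \<Rightarrow> nat \<Rightarrow> complex \<Rightarrow> complex" where
  "comps f c x = f x $ c"

definition vecf :: "nat \<Rightarrow> fun_seq \<Rightarrow> complex \<Rightarrow> complex vec" where
  "vecf n F x = Matrix.vec n (\<lambda>c. F c x)"

text \<open>Outside the index range the list and the matrices have unspecified values; zero is put
  there to obey the convention for coefficient families.\<close>

definition cf :: "nat \<Rightarrow> mdo \<Rightarrow> nat \<Rightarrow> nat \<Rightarrow> fun_seq" where
  "cf n P r c i = (\<lambda>x. if r < n \<and> c < n \<and> i < length P then (P ! i) x $$ (r, c) else 0)"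

definition mdo_of :: "nat \<Rightarrow> nat \<Rightarrow> (nat \<Rightarrow> nat \<Rightarrow> fun_seq) \<Rightarrow> mdo" where
  "mdo_of n K A = map (\<lambda>i x. mat n n (\<lambda>(r, c). A r c i x)) [0..<K]"

definition carr_mdo :: "nat \<Rightarrow> mdo \<Rightarrow> bool" where
  "carr_mdo n P \<longleftrightarrow> P \<noteq> [] \<and> (\<forall>A\<in>set P. \<forall>x. A x \<in> carrier_mat n n)"

lemma carr_mdo_mero: "mero_mdo n P \<Longrightarrow> carr_mdo n P"
  by (auto simp: mero_mdo_def mero_mat_def carr_mdo_def)

lemma carr_mdo_rational: "rational_mdo n P \<Longrightarrow> carr_mdo n P"
  by (auto simp: rational_mdo_def rational_mat_def carr_mdo_def)

lemma rational_mdo_mero: "rational_mdo n P \<Longrightarrow> mero_mdo n P"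
  by (auto simp: rational_mdo_def rational_mat_def mero_mdo_def mero_mat_def intro: rational_mero)

lemma comps_vecf: "c < n \<Longrightarrow> comps (vecf n F) c = F c"
  by (auto simp: comps_def vecf_def)

lemma mero_vec_vecf: "(\<And>c. c < n \<Longrightarrow> F c meromorphic_on UNIV) \<Longrightarrow> mero_vec n (vecf n F)"
  by (auto simp: mero_vec_def vecf_def)

lemma mero_vec_comps: "mero_vec n f \<Longrightarrow> c < n \<Longrightarrow> comps f c meromorphic_on UNIV"
  by (auto simp: mero_vec_def comps_def[abs_def])

lemma cf_mero: "mero_mdo n P \<Longrightarrow> cf n P r c i meromorphic_on UNIV"
  by (cases "r < n \<and> c < n \<and> i < length P") (auto simp: cf_def mero_mdo_def mero_mat_def)

lemma cf_rational: "rational_mdo n P \<Longrightarrow> rational_fun (cf n P r c i)"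
  by (cases "r < n \<and> c < n \<and> i < length P") (auto simp: cf_def rational_mdo_def rational_mat_def)

lemma cf_zero: "i \<ge> length P \<Longrightarrow> cf n P r c i = (\<lambda>_. 0)"
  by (auto simp: cf_def)

lemma mdo_app_eq_mop:
  assumes "carr_mdo n P" "r < n"
  shows "mdo_app n P f x $ r = mop n (length P) (cf n P) (comps f) r x"
proof -
  have "((P ! i) x *\<^sub>v vec_deriv n i f x) $ r = (\<Sum>c<n. cf n P r c i x * (deriv ^^ i) (comps f c) x)"
    if i: "i < length P" for i
  proof -
    have "(P ! i) x \<in> carrier_mat n n" using assms i by (auto simp: carr_mdo_def)
    then show ?thesis using assms i
      by (auto simp: vec_deriv_def scalar_prod_def atLeast0LessThan cf_def comps_def[abs_def] intro!: sum.cong)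
  qed
  then have "mdo_app n P f x $ r = (\<Sum>i<length P. \<Sum>c<n. cf n P r c i x * (deriv ^^ i) (comps f c) x)"
    using assms by (simp add: mdo_app_def)
  also have "\<dots> = (\<Sum>c<n. \<Sum>i<length P. cf n P r c i x * (deriv ^^ i) (comps f c) x)"
    by (rule sum.swap)
  finally show ?thesis by (simp add: mop_def sop_def)
qed

lemma dim_mdo_app [simp]: "dim_vec (mdo_app n P f x) = n" "mdo_app n P f x \<in> carrier_vec n"
  by (auto simp: mdo_app_def)

lemma length_mdo_of [simp]: "length (mdo_of n K A) = K"
  by (simp add: mdo_of_def)

lemma cf_mdo_of: "cf n (mdo_of n K A) r c i = (\<lambda>x. if r < n \<and> c < n \<and> i < K then A r c i x else 0)"
  by (auto simp: cf_def mdo_of_def)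

lemma last_mdo_of: "last (mdo_of n (Suc k) A) x = mat n n (\<lambda>(r, c). A r c k x)"
  by (simp add: mdo_of_def)

lemma carr_mdo_of: "carr_mdo n (mdo_of n (Suc k) A)"
  by (auto simp: carr_mdo_def mdo_of_def)

lemma rational_mdo_of: "(\<And>r c i. r < n \<Longrightarrow> c < n \<Longrightarrow> i \<le> k \<Longrightarrow> rational_fun (A r c i)) \<Longrightarrow> rational_mdo n (mdo_of n (Suc k) A)"
  by (auto simp: rational_mdo_def rational_mat_def mdo_of_def simp del: upt_Suc)

lemma mop_cong:
  assumes "\<And>c i. c < n \<Longrightarrow> i < K \<Longrightarrow> A r c i x = B r c i x" "\<And>c. c < n \<Longrightarrow> F c = G c"
  shows "mop n K A F r x = mop n K B G r x"
  unfolding mop_def sop_def using assms by (intro sum.cong) auto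

lemma mdo_app_of:
  assumes "r < n"
  shows "mdo_app n (mdo_of n (Suc k) A) f x $ r = mop n (Suc k) A (comps f) r x"
  unfolding mdo_app_eq_mop[OF carr_mdo_of assms] length_mdo_of
  by (rule mop_cong) (use assms in \<open>auto simp: cf_mdo_of\<close>)

lemma vec_eq_0_iff: "v \<in> carrier_vec n \<Longrightarrow> v = 0\<^sub>v n \<longleftrightarrow> (\<forall>r<n. v $ r = 0)"
  by (metis carrier_vecD eq_vecI index_zero_vec)

lemma cosparse_all_less: "(\<forall>\<^sub>\<approx>x. \<forall>r<n. P r x) \<longleftrightarrow> (\<forall>r<(n::nat). \<forall>\<^sub>\<approx>x. P r (x::complex))"
  using eventually_ball_finite_distrib[of "{..<n}" "\<lambda>x r. P r x" "cosparse UNIV"] by (simp add: Ball_def)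

lemma vker_iff:
  assumes "carr_mdo n P"
  shows "f \<in> vker n P \<longleftrightarrow> mero_vec n f \<and> (\<forall>r<n. \<forall>\<^sub>\<approx>x. mop n (length P) (cf n P) (comps f) r x = 0)"
  unfolding vker_def
  by (simp add: vec_eq_0_iff cosparse_all_less mdo_app_eq_mop[OF assms] cong: conj_cong)

text \<open>The points where \<open>mop_unique\<close> can be applied to \<open>P\<close>; by
  \<open>regular_at_cosparse\<close> these are almost all points.\<close>

definition regular_at :: "nat \<Rightarrow> mdo \<Rightarrow> complex \<Rightarrow> bool" where
  "regular_at n P x \<longleftrightarrow> (\<forall>r c i. cf n P r c i analytic_on {x}) \<and>
     det (mat n n (\<lambda>(r, c). cf n P r c (length P - 1) x)) \<noteq> 0"

lemma cf_top:
  assumes "carr_mdo n P"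
  shows "mat n n (\<lambda>(r, c). cf n P r c (length P - 1) x) = last P x"
proof -
  have P: "P \<noteq> []" "last P x \<in> carrier_mat n n" using assms by (auto simp: carr_mdo_def)
  then show ?thesis
    by (intro eq_matI) (auto simp: cf_def last_conv_nth)
qed

lemma det_mero:
  assumes "mero_mat n A"
  shows "(\<lambda>x. det (A x)) meromorphic_on UNIV"
  by (rule det_closed[where C = "\<lambda>f. f meromorphic_on UNIV"])
    (use assms in \<open>auto simp: mero_mat_def intro!: meromorphic_intros\<close>)

lemma invertible_cosparse:
  assumes "mero_mat n A" "invertible_fun A"
  shows "\<forall>\<^sub>\<approx>x. det (A x) \<noteq> 0"
  using mero_zero_or_nonzero[OF det_mero[OF assms(1)]] assms(2) by (auto simp: invertible_fun_def)

lemma invertible_funI: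
  assumes "\<forall>\<^sub>\<approx>x. det (A x) \<noteq> 0"
  shows "invertible_fun A"
  unfolding invertible_fun_def
proof
  assume "\<forall>\<^sub>\<approx>x. det (A x) = 0"
  then have "\<forall>\<^sub>\<approx>x. det (A x) = 0 \<and> det (A x) \<noteq> 0"
    using assms by eventually_elim blast
  then show False using cosparse_ex[of "\<lambda>x. det (A x) = 0 \<and> det (A x) \<noteq> 0"] by blast
qed

lemma analytic_family_cosparse:
  fixes A :: "nat \<Rightarrow> nat \<Rightarrow> fun_seq"
  assumes "\<And>r c i. A r c i meromorphic_on UNIV"
    and z: "\<And>r c i. \<not> (r < n \<and> c < n \<and> i < K) \<Longrightarrow> A r c i = (\<lambda>_. 0)"
  shows "\<forall>\<^sub>\<approx>x. \<forall>r c i. A r c i analytic_on {x}"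
proof -
  have "\<forall>\<^sub>\<approx>x. \<forall>r<n. \<forall>c<n. \<forall>i<K. A r c i analytic_on {x}"
    unfolding cosparse_all_less using assms by (auto intro!: meromorphic_on_imp_analytic_cosparse)
  then show ?thesis
  proof eventually_elim
    case (elim x)
    show ?case
    proof (intro allI)
      fix r c i show "A r c i analytic_on {x}"
        using elim z[of r c i] by (cases "r < n \<and> c < n \<and> i < K") auto
    qed
  qed
qed

lemma regular_at_cosparse:
  assumes P: "mero_mdo n P" "invertible_fun (last P)"
  shows "\<forall>\<^sub>\<approx>x. regular_at n P x"
proof -
  have "mero_mat n (last P)" using P by (auto simp: mero_mdo_def)
  then have "\<forall>\<^sub>\<approx>x. det (last P x) \<noteq> 0"
    by (rule invertible_cosparse) fact
  moreover have "\<forall>\<^sub>\<approx>x. \<forall>r c i. cf n P r c i analytic_on {x}"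
    by (rule analytic_family_cosparse[of _ n "length P"]) (use P in \<open>auto simp: cf_mero\<close>, auto simp: cf_def)
  ultimately show ?thesis
    by eventually_elim (simp only: regular_at_def cf_top[OF carr_mdo_mero[OF P(1)]], blast)
qed

section \<open>Linear combinations of kernel elements and the dimension of kernels\<close>

lemma lin_comb_index: "r < n \<Longrightarrow> lin_comb n m a f x $ r = (\<Sum>j<m. a j * comps (f j) r x)"
  by (simp add: lin_comb_def comps_def)

lemma lin_comb_dim [simp]: "lin_comb n m a f x \<in> carrier_vec n"
  by (simp add: lin_comb_def)

lemma lin_comb_0_iff: "(\<forall>\<^sub>\<approx>x. lin_comb n m a f x = 0\<^sub>v n) \<longleftrightarrow> (\<forall>r<n. \<forall>\<^sub>\<approx>x. (\<Sum>j<m. a j * comps (f j) r x) = 0)"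
  by (simp add: vec_eq_0_iff cosparse_all_less lin_comb_index)

lemma higher_deriv_lin:
  assumes "\<And>j. j \<in> S \<Longrightarrow> f j analytic_on {x}"
  shows "(deriv ^^ i) (\<lambda>y. \<Sum>j\<in>S. a j * f j y) x = (\<Sum>j\<in>S. a j * (deriv ^^ i) (f j) x)"
proof -
  have "(deriv ^^ i) (\<lambda>y. \<Sum>j\<in>S. a j * f j y) x = (\<Sum>j\<in>S. (deriv ^^ i) (\<lambda>y. a j * f j y) x)"
    using assms by (intro higher_deriv_sum_at) (auto intro!: analytic_intros)
  then show ?thesis using assms by (simp add: higher_deriv_cmult')
qed

lemma mop_lin:
  assumes "\<And>j c. j \<in> S \<Longrightarrow> c < n \<Longrightarrow> F j c analytic_on {x}"
  shows "mop n K A (\<lambda>c y. \<Sum>j\<in>S. a j * F j c y) r x = (\<Sum>j\<in>S. a j * mop n K A (F j) r x)"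
proof -
  have "mop n K A (\<lambda>c y. \<Sum>j\<in>S. a j * F j c y) r x =
      (\<Sum>c<n. \<Sum>i<K. \<Sum>j\<in>S. a j * (A r c i x * (deriv ^^ i) (F j c) x))"
    unfolding mop_def sop_def using assms
    by (intro sum.cong refl) (simp add: higher_deriv_lin sum_distrib_left mult_ac)
  also have "\<dots> = (\<Sum>c<n. \<Sum>j\<in>S. \<Sum>i<K. a j * (A r c i x * (deriv ^^ i) (F j c) x))"
    by (rule sum.cong[OF refl], rule sum.swap)
  also have "\<dots> = (\<Sum>j\<in>S. \<Sum>c<n. \<Sum>i<K. a j * (A r c i x * (deriv ^^ i) (F j c) x))"
    by (rule sum.swap)
  finally show ?thesis by (simp add: mop_def sop_def sum_distrib_left)
qed

lemma comps_analytic_cosparse: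
  fixes m :: nat
  assumes "\<And>j. j < m \<Longrightarrow> mero_vec n (f j)"
  shows "\<forall>\<^sub>\<approx>x. \<forall>j<m. \<forall>c<n. comps (f j) c analytic_on {x}"
proof -
  have "\<forall>\<^sub>\<approx>x. comps (f j) c analytic_on {x}" if "j < m" "c < n" for j c
    using meromorphic_on_imp_analytic_cosparse[OF mero_vec_comps[OF assms[OF that(1)] that(2)]] .
  then show ?thesis by (simp add: cosparse_all_less)
qed

text \<open>Taking jets of order below \<open>k\<close> at a regular point is injective on the
  kernel: a combination of kernel elements solves the equation again, so \<open>mop_unique\<close>
  applies to it.\<close>

lemma vker_jet_unique:
  fixes m :: nat
  assumes P: "mero_mdo n P" "length P = Suc k" "regular_at n P x"
    and f: "\<And>j. j < m \<Longrightarrow> f j \<in> vker n P"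
    and an: "\<And>j c. j < m \<Longrightarrow> c < n \<Longrightarrow> comps (f j) c analytic_on {x}"
    and jet: "\<And>i c. i < k \<Longrightarrow> c < n \<Longrightarrow> (\<Sum>j<m. a j * (deriv ^^ i) (comps (f j) c) x) = 0"
  shows "\<forall>\<^sub>\<approx>y. lin_comb n m a f y = 0\<^sub>v n"
  unfolding lin_comb_0_iff
proof (intro allI impI)
  fix r assume r: "r < n"
  note carr = carr_mdo_mero[OF P(1)]
  define F where "F c = (\<lambda>y. \<Sum>j<m. a j * comps (f j) c y)" for c
  have fm: "comps (f j) c meromorphic_on UNIV" if "j < m" "c < n" for j c
    using f[OF that(1)] that by (auto simp: vker_def intro: mero_vec_comps)
  have "\<forall>\<^sub>\<approx>y. F r y = 0"
  proof (rule mop_unique[of "cf n P" x n F k, OF _ _ _ _ _ _ _ r])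
    show "cf n P r c i analytic_on {x}" for r c i using P by (auto simp: regular_at_def)
    show "F c meromorphic_on UNIV" if "c < n" for c
      unfolding F_def using that fm by (auto intro!: meromorphic_intros)
    show "F c analytic_on {x}" if "c < n" for c
      unfolding F_def using that an by (auto intro!: analytic_intros)
    show "cf n P r c i = (\<lambda>_. 0)" if "i > k" for r c i
      using that P by (intro cf_zero) auto
    show "det (mat n n (\<lambda>(r, c). cf n P r c k x)) \<noteq> 0"
      using P by (simp add: regular_at_def)
    show "(deriv ^^ i) (F c) x = 0" if "i < k" "c < n" for i c
      unfolding F_def using jet[OF that] an that higher_deriv_lin[of "{..<m}" "\<lambda>j. comps (f j) c" x i a] by auto
    fix r assume r: "r < n"
    have "\<forall>\<^sub>\<approx>y. \<forall>j<m. mop n (Suc k) (cf n P) (comps (f j)) r y = 0"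
      unfolding cosparse_all_less using f r P by (auto simp: vker_iff[OF carr])
    moreover have "\<forall>\<^sub>\<approx>y. \<forall>j<m. \<forall>c<n. comps (f j) c analytic_on {y}"
      by (rule comps_analytic_cosparse) (use f in \<open>auto simp: vker_def\<close>)
    ultimately show "\<forall>\<^sub>\<approx>y. mop n (Suc k) (cf n P) F r y = 0"
      unfolding F_def[abs_def] by eventually_elim (subst mop_lin, auto)
  qed
  then show "\<forall>\<^sub>\<approx>x. (\<Sum>j<m. a j * comps (f j) r x) = 0" by (simp add: F_def)
qed

lemma regular_point_exists:
  fixes m :: nat
  assumes P: "mero_mdo n P" "invertible_fun (last P)"
    and f: "\<And>j. j < m \<Longrightarrow> f j \<in> vker n P"
  obtains x where "regular_at n P x" "\<And>j c. j < m \<Longrightarrow> c < n \<Longrightarrow> comps (f j) c analytic_on {x}"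
proof -
  have "\<forall>\<^sub>\<approx>y. \<forall>j<m. \<forall>c<n. comps (f j) c analytic_on {y}"
    by (rule comps_analytic_cosparse) (use f in \<open>auto simp: vker_def\<close>)
  then have "\<forall>\<^sub>\<approx>y. regular_at n P y \<and> (\<forall>j<m. \<forall>c<n. comps (f j) c analytic_on {y})"
    using regular_at_cosparse[OF P] by eventually_elim auto
  then show ?thesis using cosparse_ex that by blast
qed

definition indep :: "nat \<Rightarrow> nat \<Rightarrow> (nat \<Rightarrow> complex \<Rightarrow> complex vec) \<Rightarrow> bool" where
  "indep n m f \<longleftrightarrow> (\<forall>a. (\<forall>\<^sub>\<approx>x. lin_comb n m a f x = 0\<^sub>v n) \<longrightarrow> (\<forall>j<m. a j = 0))"

text \<open>The rows of the Wronski matrix enumerate the pairs of a derivative \<open>i\<close> and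
  a component \<open>c\<close> as \<open>i * n + c\<close>.\<close>

lemma div_mod_idx: "c < n \<Longrightarrow> i < (k::nat) \<Longrightarrow> i * n + c < n * k \<and> (i * n + c) div n = i \<and> (i * n + c) mod n = c"
proof -
  assume *: "c < n" "i < k"
  have "i * n + c < Suc i * n" using * by simp
  also have "\<dots> \<le> k * n" using * by (intro mult_le_mono1) auto
  finally show ?thesis using * by (simp add: mult.commute)
qed

text \<open>A jet consists of \<open>n * k\<close> numbers, so among more functions than that some
  nontrivial combination has zero jet and hence vanishes.\<close>

lemma indep_vker_le:
  assumes P: "mero_mdo n P" "length P = Suc k" "invertible_fun (last P)"
    and f: "\<And>j. j < m \<Longrightarrow> f j \<in> vker n P" and m: "indep n m f"
  shows "m \<le> n * k"
proof (rule ccontr)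
  assume "\<not> m \<le> n * k"
  then have "n * k < m" by simp
  obtain x where x: "regular_at n P x" "\<And>j c. j < m \<Longrightarrow> c < n \<Longrightarrow> comps (f j) c analytic_on {x}"
    by (rule regular_point_exists[OF P(1,3), of m f]) (use f in auto)
  obtain v where v: "\<exists>j<m. v j \<noteq> 0"
      "\<And>e. e < n * k \<Longrightarrow> (\<Sum>j<m. (deriv ^^ (e div n)) (comps (f j) (e mod n)) x * v j) = 0"
    using nontrivial_solution[OF \<open>n * k < m\<close>, of "\<lambda>e j. (deriv ^^ (e div n)) (comps (f j) (e mod n)) x"] by auto
  have "\<forall>\<^sub>\<approx>y. lin_comb n m v f y = 0\<^sub>v n"
  proof (rule vker_jet_unique[OF P(1,2) x(1) f x(2)])
    fix i c assume "i < k" "c < n"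
    then show "(\<Sum>j<m. v j * (deriv ^^ i) (comps (f j) c) x) = 0"
      using v(2)[of "i * n + c"] div_mod_idx[of c n i k] by (auto simp: mult.commute)
  qed
  then show False using m v(1) unfolding indep_def by blast
qed

text \<open>Adding \<open>g\<close> to the family exceeds the bound of \<open>indep_vker_le\<close>;
  in the resulting relation the coefficient of \<open>g\<close> is nonzero because the family is
  independent.\<close>

lemma vker_span:
  assumes P: "mero_mdo n P" "length P = Suc k" "invertible_fun (last P)"
    and f: "\<And>j. j < n * k \<Longrightarrow> f j \<in> vker n P" and ind: "indep n (n * k) f"
    and g: "g \<in> vker n P"
  shows "\<exists>a. \<forall>\<^sub>\<approx>x. g x = lin_comb n (n * k) a f x"
proof -
  let ?m = "n * k"
  define f' where "f' j = (if j < ?m then f j else g)" for j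
  have "f' j \<in> vker n P" for j using f g by (simp add: f'_def)
  then have "\<not> indep n (Suc ?m) f'"
    using indep_vker_le[OF P, of "Suc ?m" f'] by auto
  then obtain a where a: "\<forall>\<^sub>\<approx>x. lin_comb n (Suc ?m) a f' x = 0\<^sub>v n" "\<exists>j<Suc ?m. a j \<noteq> 0"
    unfolding indep_def by blast
  have a': "\<forall>\<^sub>\<approx>x. (\<Sum>j<?m. a j * comps (f j) r x) + a ?m * comps g r x = 0" if "r < n" for r
    using a(1) that unfolding lin_comb_0_iff by (simp add: f'_def)
  have nz: "a ?m \<noteq> 0"
  proof
    assume "a ?m = 0"
    then have "\<forall>\<^sub>\<approx>x. lin_comb n ?m a f x = 0\<^sub>v n"
      using a' unfolding lin_comb_0_iff by simp
    then have "\<forall>j<?m. a j = 0" using ind unfolding indep_def by blast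
    then show False using a(2) \<open>a ?m = 0\<close> by (auto simp: less_Suc_eq)
  qed
  have "\<forall>\<^sub>\<approx>x. \<forall>r<n. (\<Sum>j<?m. a j * comps (f j) r x) + a ?m * comps g r x = 0"
    unfolding cosparse_all_less using a' by blast
  then have "\<forall>\<^sub>\<approx>x. g x = lin_comb n ?m (\<lambda>j. - a j / a ?m) f x"
  proof eventually_elim
    case (elim x)
    have "g x \<in> carrier_vec n" using g by (auto simp: vker_def mero_vec_def)
    show ?case
    proof (rule eq_vecI)
      fix r assume "r < dim_vec (lin_comb n ?m (\<lambda>j. - a j / a ?m) f x)"
      then have r: "r < n" by (simp add: lin_comb_def)
      have "a ?m * comps g r x = - (\<Sum>j<?m. a j * comps (f j) r x)"
        using elim r by (simp add: add_eq_0_iff)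
      then have "comps g r x = - (\<Sum>j<?m. a j * comps (f j) r x) / a ?m"
        using nz by (simp add: field_simps)
      also have "\<dots> = (\<Sum>j<?m. (- a j / a ?m) * comps (f j) r x)"
        by (simp add: sum_negf[symmetric] sum_divide_distrib)
      finally show "g x $ r = lin_comb n ?m (\<lambda>j. - a j / a ?m) f x $ r"
        using r by (simp add: lin_comb_index comps_def)
    qed (use \<open>g x \<in> _\<close> in \<open>simp add: lin_comb_def\<close>)
  qed
  then show ?thesis by blast
qed

text \<open>A null vector of the Wronski matrix at a regular point is a combination with zero jet
  there.\<close>

lemma vker_wronski:
  assumes P: "mero_mdo n P" "length P = Suc k" "invertible_fun (last P)"
    and f: "\<And>j. j < n * k \<Longrightarrow> f j \<in> vker n P" and ind: "indep n (n * k) f"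
  shows "\<forall>\<^sub>\<approx>x. det (wronski_mat n k f x) \<noteq> 0"
proof -
  let ?m = "n * k"
  have "\<forall>\<^sub>\<approx>y. \<forall>j<?m. \<forall>c<n. comps (f j) c analytic_on {y}"
    by (rule comps_analytic_cosparse) (use f in \<open>auto simp: vker_def\<close>)
  then show ?thesis using regular_at_cosparse[OF P(1,3)]
  proof eventually_elim
    case (elim x)
    show ?case
    proof
      assume "det (wronski_mat n k f x) = 0"
      moreover have W: "wronski_mat n k f x \<in> carrier_mat ?m ?m" by (simp add: wronski_mat_def)
      ultimately obtain v where v: "v \<in> carrier_vec ?m" "v \<noteq> 0\<^sub>v ?m" "wronski_mat n k f x *\<^sub>v v = 0\<^sub>v ?m"
        using det_0_iff_vec_prod_zero[OF W] by auto
      have "\<forall>\<^sub>\<approx>y. lin_comb n ?m (\<lambda>j. v $ j) f y = 0\<^sub>v n"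
      proof (rule vker_jet_unique[OF P(1,2) elim(2) f])
        fix i c assume ic: "i < k" "c < n"
        note d = div_mod_idx[OF ic(2,1)]
        have "0 = (wronski_mat n k f x *\<^sub>v v) $ (i * n + c)" using v(3) d by simp
        also have "\<dots> = row (wronski_mat n k f x) (i * n + c) \<bullet> v" using d W by simp
        also have "\<dots> = (\<Sum>j<?m. (deriv ^^ i) (comps (f j) c) x * v $ j)"
          using d v(1) ic by (auto simp: wronski_mat_def scalar_prod_def atLeast0LessThan vec_deriv_def comps_def[abs_def] intro!: sum.cong)
        finally show "(\<Sum>j<?m. v $ j * (deriv ^^ i) (comps (f j) c) x) = 0" by (simp add: mult.commute)
      qed (use elim in auto)
      then have "\<forall>j<?m. v $ j = 0" using ind unfolding indep_def by blast
      then show False using v by (metis carrier_vecD eq_vecI index_zero_vec)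
    qed
  qed
qed

text \<open>The span in \<open>mero_basis\<close> admits changes on discrete sets, so a function
  that merely agrees with a combination almost everywhere must be shown to lie in the kernel. Near
  almost every point the two agree, and then so do their derivatives.\<close>

lemma mero_basisI:
  assumes P: "carr_mdo n P" and f: "\<And>j. j < m \<Longrightarrow> f j \<in> vker n P" and ind: "indep n m f"
    and span: "\<And>g. g \<in> vker n P \<Longrightarrow> \<exists>a. \<forall>\<^sub>\<approx>x. g x = lin_comb n m a f x"
  shows "mero_basis n (vker n P) m f"
proof -
  have "g \<in> vker n P" if g: "mero_vec n g" "\<forall>\<^sub>\<approx>x. g x = lin_comb n m a f x" for g a
  proof -
    have 1: "\<forall>\<^sub>\<approx>y. \<forall>j<m. \<forall>c<n. comps (f j) c analytic_on {y}"
      by (rule comps_analytic_cosparse) (use f in \<open>auto simp: vker_def\<close>)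
    have "\<forall>\<^sub>\<approx>x. eventually (\<lambda>y. g y = lin_comb n m a f y) (at x)"
      using cosparse_at[OF g(2)] by simp
    moreover have "\<forall>\<^sub>\<approx>y. \<forall>c<n. comps g c analytic_on {y}"
      unfolding cosparse_all_less using g(1) by (auto intro!: meromorphic_on_imp_analytic_cosparse mero_vec_comps)
    moreover have "\<forall>\<^sub>\<approx>y. \<forall>r<n. \<forall>j<m. mop n (length P) (cf n P) (comps (f j)) r y = 0"
      unfolding cosparse_all_less using f by (auto simp: vker_iff[OF P])
    ultimately have "\<forall>\<^sub>\<approx>x. \<forall>r<n. mop n (length P) (cf n P) (comps g) r x = 0"
      using 1 g(2)
    proof eventually_elim
      case (elim x)
      have ev: "eventually (\<lambda>y. g y = lin_comb n m a f y) (nhds x)"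
        using elim(1,5) by (simp add: eventually_nhds_conv_at)
      show ?case
      proof (intro allI impI)
        fix r assume r: "r < n"
        have "mop n (length P) (cf n P) (comps g) r x =
            mop n (length P) (cf n P) (\<lambda>c y. \<Sum>j<m. a j * comps (f j) c y) r x"
          unfolding mop_def sop_def
        proof (intro sum.cong refl arg_cong2[of _ _ _ _ "(*)"] higher_deriv_cong_ev)
          fix c assume "c \<in> {..<n}"
          show "eventually (\<lambda>y. comps g c y = (\<Sum>j<m. a j * comps (f j) c y)) (nhds x)"
            using ev by eventually_elim (use \<open>c \<in> _\<close> in \<open>auto simp: comps_def[of g] lin_comb_index\<close>)
        qed
        also have "\<dots> = 0" using elim r by (subst mop_lin) auto
        finally show "mop n (length P) (cf n P) (comps g) r x = 0" .
      qed
    qed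
    then show ?thesis using g by (simp add: vker_iff[OF P] cosparse_all_less)
  qed
  moreover have "mero_vec n g" if "g \<in> vker n P" for g using that by (auto simp: vker_def)
  ultimately show ?thesis
    unfolding mero_basis_def using f ind span unfolding indep_def by blast
qed

lemma mero_basisD:
  assumes "mero_basis n V m f"
  shows "indep n m f" "\<And>j. j < m \<Longrightarrow> f j \<in> V"
proof -
  show "indep n m f" using assms by (auto simp: mero_basis_def indep_def)
  fix j assume j: "j < m"
  have "f j x = lin_comb n m (\<lambda>j'. if j' = j then 1 else 0) f x" for x
  proof (rule eq_vecI)
    fix r assume "r < dim_vec (lin_comb n m (\<lambda>j'. if j' = j then 1 else 0) f x)"
    then have r: "r < n" by (simp add: lin_comb_def)
    have "(\<Sum>j'<m. (if j' = j then 1 else 0) * comps (f j') r x) = (\<Sum>j'<m. if j' = j then comps (f j') r x else 0)"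
      by (rule sum.cong) auto
    then show "f j x $ r = lin_comb n m (\<lambda>j'. if j' = j then 1 else 0) f x $ r"
      using j by (simp add: lin_comb_index[OF r]) (simp add: comps_def)
  next
    show "dim_vec (f j x) = dim_vec (lin_comb n m (\<lambda>j'. if j' = j then 1 else 0) f x)"
      using assms j by (auto simp: lin_comb_def mero_basis_def mero_vec_def)
  qed
  then have "\<forall>\<^sub>\<approx>x. f j x = lin_comb n m (\<lambda>j'. if j' = j then 1 else 0) f x" by simp
  then show "f j \<in> V" using assms j unfolding mero_basis_def by blast
qed

lemma kernel_family_set:
  fixes A :: "nat \<Rightarrow> 'i \<Rightarrow> complex"
  assumes "finite I" "e + D \<le> card I"
  shows "\<exists>u. (\<forall>d<D. \<forall>i<e. (\<Sum>j\<in>I. A i j * u d j) = 0) \<and>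
     (\<forall>a. (\<forall>j\<in>I. (\<Sum>d<D. a d * u d j) = 0) \<longrightarrow> (\<forall>d<(D::nat). a d = 0))"
proof -
  obtain \<phi> where \<phi>: "bij_betw \<phi> {..<card I} I"
    using ex_bij_betw_nat_finite[OF assms(1)] by (auto simp: atLeast0LessThan)
  obtain u where u: "\<And>d i. d < D \<Longrightarrow> i < e \<Longrightarrow> (\<Sum>j<card I. A i (\<phi> j) * u d j) = 0"
    "\<And>a. \<forall>j<card I. (\<Sum>d<D. a d * u d j) = 0 \<Longrightarrow> \<forall>d<D. a d = 0"
    using kernel_family[OF assms(2), of "\<lambda>i j. A i (\<phi> j)"] by blast
  define w where "w d j = u d (inv_into {..<card I} \<phi> j)" for d j
  have w: "w d (\<phi> j) = u d j" if "j < card I" for d j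
    using \<phi> that by (simp add: w_def bij_betw_inv_into_left)
  have "(\<Sum>j\<in>I. A i j * w d j) = (\<Sum>j<card I. A i (\<phi> j) * u d j)" for i d
  proof -
    have "(\<Sum>j\<in>I. A i j * w d j) = (\<Sum>j<card I. A i (\<phi> j) * w d (\<phi> j))"
      by (rule sum.reindex_bij_betw[OF \<phi>, symmetric])
    then show ?thesis by (simp add: w)
  qed
  moreover have "\<forall>d<D. a d = 0" if a: "\<forall>j\<in>I. (\<Sum>d<D. a d * w d j) = 0" for a
  proof (rule u(2), intro allI impI)
    fix j assume j: "j < card I"
    then have "\<phi> j \<in> I" using \<phi> by (auto simp: bij_betw_def)
    then have "(\<Sum>d<D. a d * w d (\<phi> j)) = 0" using a by blast
    then show "(\<Sum>d<D. a d * u d j) = 0" using w[OF j] by simp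
  qed
  ultimately show ?thesis using u(1) by (intro exI[of _ w]) auto
qed

text \<open>With more functions than generators the coefficient matrix has a null vector by
  \<open>nontrivial_solution\<close>, which is a relation among the functions.\<close>

lemma indep_le_span:
  assumes ind: "indep n D f"
    and sp: "\<And>d. d < D \<Longrightarrow> \<exists>a. \<forall>\<^sub>\<approx>x. f d x = lin_comb n m a g x"
  shows "D \<le> m"
proof (rule ccontr)
  assume "\<not> D \<le> m"
  then have "m < D" by simp
  have "\<forall>d\<in>{..<D}. \<exists>a. \<forall>\<^sub>\<approx>x. f d x = lin_comb n m a g x" using sp by blast
  from bchoice[OF this] obtain M where M: "\<And>d. d < D \<Longrightarrow> \<forall>\<^sub>\<approx>x. f d x = lin_comb n m (M d) g x"
    by blast
  obtain v where v: "\<exists>d<D. v d \<noteq> 0" "\<And>j. j < m \<Longrightarrow> (\<Sum>d<D. M d j * v d) = 0"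
    using nontrivial_solution[OF \<open>m < D\<close>, of "\<lambda>j d. M d j"] by blast
  have "\<forall>\<^sub>\<approx>x. \<forall>d<D. f d x = lin_comb n m (M d) g x"
    unfolding cosparse_all_less using M by simp
  then have "\<forall>\<^sub>\<approx>x. lin_comb n D v f x = 0\<^sub>v n"
  proof eventually_elim
    case (elim x)
    have "(\<Sum>d<D. v d * comps (f d) r x) = 0" if r: "r < n" for r
    proof -
      have "(\<Sum>d<D. v d * comps (f d) r x) = (\<Sum>d<D. \<Sum>j<m. v d * (M d j * comps (g j) r x))"
        using elim r by (intro sum.cong) (auto simp: comps_def[of "f _"] lin_comb_index sum_distrib_left)
      also have "\<dots> = (\<Sum>j<m. \<Sum>d<D. v d * (M d j * comps (g j) r x))"
        by (rule sum.swap)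
      also have "\<dots> = (\<Sum>j<m. (\<Sum>d<D. M d j * v d) * comps (g j) r x)"
        unfolding sum_distrib_right by (intro sum.cong refl) (simp add: mult_ac)
      finally show ?thesis using v(2) by simp
    qed
    then show ?case by (simp add: vec_eq_0_iff lin_comb_index)
  qed
  then show False using ind v(1) unfolding indep_def by blast
qed

section \<open>Top coefficients of determinants and adjugates of polynomial matrices\<close>

lemma coeff_mult_bound:
  fixes p q :: "'a::comm_semiring_1 poly"
  assumes "degree p \<le> a" "degree q \<le> b"
  shows "coeff (p * q) (a + b) = coeff p a * coeff q b"
proof -
  have "coeff (p * q) (a + b) = (\<Sum>i\<le>a + b. coeff p i * coeff q (a + b - i))"
    by (rule coeff_mult)
  also have "\<dots> = (\<Sum>i\<in>{a}. coeff p i * coeff q (a + b - i))"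
  proof (rule sum.mono_neutral_right)
    show "\<forall>i\<in>{..a + b} - {a}. coeff p i * coeff q (a + b - i) = 0"
    proof
      fix i assume i: "i \<in> {..a + b} - {a}"
      show "coeff p i * coeff q (a + b - i) = 0"
      proof (cases "i > a")
        case False
        then have "a + b - i > b" using i by auto
        then show ?thesis using assms by (simp add: coeff_eq_0)
      qed (use assms in \<open>simp add: coeff_eq_0\<close>)
    qed
  qed auto
  finally show ?thesis by simp
qed

lemma coeff_prod_bound:
  fixes f :: "'i \<Rightarrow> complex poly"
  assumes "finite S" "\<And>i. i \<in> S \<Longrightarrow> degree (f i) \<le> e"
  shows "degree (\<Prod>i\<in>S. f i) \<le> card S * e \<and> coeff (\<Prod>i\<in>S. f i) (card S * e) = (\<Prod>i\<in>S. coeff (f i) e)"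
  using assms
proof (induction S rule: finite_induct)
  case (insert a S)
  have "degree (f a * (\<Prod>i\<in>S. f i)) \<le> e + card S * e"
    using insert by (intro order.trans[OF degree_mult_le] add_mono) auto
  moreover have "coeff (f a * (\<Prod>i\<in>S. f i)) (e + card S * e) = coeff (f a) e * (\<Prod>i\<in>S. coeff (f i) e)"
    using insert by (subst coeff_mult_bound) auto
  ultimately show ?case using insert by simp
qed auto

text \<open>The coefficient at \<open>m * e\<close> of each Leibniz term is the corresponding term
  for the coefficient matrix. Hence the degree is exactly \<open>m * e\<close> when that matrix is
  invertible.\<close>

lemma det_poly_top:
  fixes M :: "complex poly mat"
  assumes M: "M \<in> carrier_mat m m" and d: "\<And>r c. r < m \<Longrightarrow> c < m \<Longrightarrow> degree (M $$ (r, c)) \<le> e"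
  shows "degree (det M) \<le> m * e"
    "coeff (det M) (m * e) = det (mat m m (\<lambda>(r, c). coeff (M $$ (r, c)) e))"
proof -
  have perm: "degree (\<Prod>i = 0..<m. M $$ (i, p i)) \<le> m * e \<and>
      coeff (\<Prod>i = 0..<m. M $$ (i, p i)) (m * e) = (\<Prod>i = 0..<m. coeff (M $$ (i, p i)) e)"
    if "p permutes {0..<m}" for p
    using coeff_prod_bound[of "{0..<m}" "\<lambda>i. M $$ (i, p i)" e] d permutes_in_image[OF that] by auto
  have sg: "(signof p :: complex poly) * f = (if signof p = (1::complex) then f else - f) \<and>
      (signof p :: complex) \<in> {1, - 1}" for p and f :: "complex poly"
    by (auto simp: sign_def)
  show "degree (det M) \<le> m * e"
    unfolding det_def'[OF M]
  proof (rule degree_sum_le)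
    show "finite {p. p permutes {0..<m}}" by (simp add: finite_permutations)
    fix p assume "p \<in> {p. p permutes {0..<m}}"
    then show "degree ((signof p :: complex poly) * (\<Prod>i = 0..<m. M $$ (i, p i))) \<le> m * e"
      using perm[of p] sg[of p] by auto
  qed
  have "coeff (det M) (m * e) =
     (\<Sum>p | p permutes {0..<m}. coeff ((signof p :: complex poly) * (\<Prod>i = 0..<m. M $$ (i, p i))) (m * e))"
    unfolding det_def'[OF M] by (simp add: coeff_sum)
  also have "\<dots> = (\<Sum>p | p permutes {0..<m}. signof p * (\<Prod>i = 0..<m. coeff (M $$ (i, p i)) e))"
  proof (rule sum.cong[OF refl])
    fix p assume "p \<in> {p. p permutes {0..<m}}"
    then show "coeff ((signof p :: complex poly) * (\<Prod>i = 0..<m. M $$ (i, p i))) (m * e) =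
        signof p * (\<Prod>i = 0..<m. coeff (M $$ (i, p i)) e)"
      using perm[of p] by (auto simp: sign_def)
  qed
  also have "\<dots> = det (mat m m (\<lambda>(r, c). coeff (M $$ (r, c)) e))"
    by (subst det_def'[of _ m]) (auto intro!: sum.cong prod.cong dest: permutes_in_image)
  finally show "coeff (det M) (m * e) = det (mat m m (\<lambda>(r, c). coeff (M $$ (r, c)) e))" .
qed

text \<open>Cofactors are, up to sign, determinants of size \<open>n - 1\<close>. This yields the
  order of adj(q)(M) and its leading matrix, the adjugate of that of q(M).\<close>

lemma adj_poly_top:
  fixes M :: "complex poly mat"
  assumes M: "M \<in> carrier_mat n n" and d: "\<And>r c. r < n \<Longrightarrow> c < n \<Longrightarrow> degree (M $$ (r, c)) \<le> e"
    and rc: "r < n" "c < n"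
  shows "degree (adj_mat M $$ (r, c)) \<le> (n - 1) * e"
    "coeff (adj_mat M $$ (r, c)) ((n - 1) * e) = adj_mat (mat n n (\<lambda>(r, c). coeff (M $$ (r, c)) e)) $$ (r, c)"
proof -
  let ?C = "mat n n (\<lambda>(r, c). coeff (M $$ (r, c)) e)"
  let ?D = "mat_delete M c r"
  have D: "?D \<in> carrier_mat (n - 1) (n - 1)" using M by (auto simp: mat_delete_def)
  have dD: "degree (?D $$ (i, j)) \<le> e" if "i < n - 1" "j < n - 1" for i j
    using that M d[of "if i < c then i else Suc i" "if j < r then j else Suc j"]
    by (auto simp: mat_delete_def)
  have CD: "mat (n - 1) (n - 1) (\<lambda>(i, j). coeff (?D $$ (i, j)) e) = mat_delete ?C c r"
    using M by (intro eq_matI) (auto simp: mat_delete_def)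
  have 1: "adj_mat M $$ (r, c) = (-1) ^ (c + r) * det ?D"
    using M rc by (auto simp: adj_mat_def cofactor_def)
  have 2: "adj_mat ?C $$ (r, c) = (-1) ^ (c + r) * det (mat_delete ?C c r)"
    using rc by (auto simp: adj_mat_def cofactor_def)
  have 3: "(-1) ^ j * f = (if even j then f else - f)" for j :: nat and f :: "'a::comm_ring_1"
    by (simp add: minus_one_power_iff)
  show "degree (adj_mat M $$ (r, c)) \<le> (n - 1) * e"
    using det_poly_top(1)[OF D dD] unfolding 1 3 by auto
  show "coeff (adj_mat M $$ (r, c)) ((n - 1) * e) = adj_mat ?C $$ (r, c)"
    using det_poly_top(2)[OF D dD] unfolding 1 2 3 CD by auto
qed

lemma det_adj_nz:
  fixes A :: "complex mat"
  assumes A: "A \<in> carrier_mat n n" "det A \<noteq> 0"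
  shows "det (adj_mat A) \<noteq> 0"
proof -
  have "det (adj_mat A) * det A = det (det A \<cdot>\<^sub>m 1\<^sub>m n)"
    using det_mult[OF adj_mat(1)[OF A(1)] A(1)] adj_mat(3)[OF A(1)] by simp
  also have "\<dots> = det A ^ n" by (simp add: det_smult)
  finally show ?thesis using A(2) by auto
qed

section \<open>The operator q(M) in coefficients\<close>

definition qcoef :: "nat \<Rightarrow> nat \<Rightarrow> (nat \<Rightarrow> complex) \<Rightarrow> complex poly mat \<Rightarrow> nat \<Rightarrow> nat \<Rightarrow> fun_seq" where
  "qcoef n N \<alpha> q r c i = (\<lambda>x. if r < n \<and> c < n then \<Sum>s\<le>degree (q $$ (r, c)). coeff (q $$ (r, c)) s * acoef N \<alpha> s i x else 0)"

lemma qcoef_rational: "rational_fun (qcoef n N \<alpha> q r c i)"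
proof (cases "r < n \<and> c < n")
  case True
  have "rational_fun (\<lambda>x. \<Sum>s\<le>degree (q $$ (r, c)). coeff (q $$ (r, c)) s * acoef N \<alpha> s i x)"
    by (intro rational_sum rational_mult rational_const acoef_rational)
  then show ?thesis using True by (simp add: qcoef_def)
qed (auto simp: qcoef_def)

lemma qcoef_analytic: "qcoef n N \<alpha> q r c i analytic_on {x}"
  unfolding qcoef_def by (cases "r < n \<and> c < n") (auto intro!: analytic_intros acoef_analytic)

context
  fixes n N e :: nat and \<alpha> :: "nat \<Rightarrow> complex" and q :: "complex poly mat"
  assumes N: "N > 0" and d: "\<And>r c. r < n \<Longrightarrow> c < n \<Longrightarrow> degree (q $$ (r, c)) \<le> e"
begin

lemma qcoef_zero: "i > N * e \<Longrightarrow> qcoef n N \<alpha> q r c i = (\<lambda>_. 0)"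
proof -
  assume i: "i > N * e"
  have "acoef N \<alpha> s i = (\<lambda>_. 0)" if "s \<le> e" for s
    using that i by (intro acoef_zero[OF N]) (meson le_less_trans mult_le_mono2)
  then show ?thesis using d by (fastforce simp: qcoef_def intro!: sum.neutral)
qed

lemma qcoef_top:
  assumes "r < n" "c < n"
  shows "qcoef n N \<alpha> q r c (N * e) x = coeff (q $$ (r, c)) e"
proof -
  have "qcoef n N \<alpha> q r c (N * e) x = (\<Sum>s\<le>e. coeff (q $$ (r, c)) s * acoef N \<alpha> s (N * e) x)"
    using assms d[OF assms] by (auto simp: qcoef_def intro!: sum.mono_neutral_left le_degree)
  also have "\<dots> = (\<Sum>s\<in>{e}. coeff (q $$ (r, c)) s * acoef N \<alpha> s (N * e) x)"
    using N by (intro sum.mono_neutral_right) (auto simp: acoef_zero[OF N])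
  finally show ?thesis by (simp add: acoef_top[OF N])
qed

lemma airy_poly_app_mop:
  assumes an: "\<And>c. c < n \<Longrightarrow> comps f c analytic_on {x}" and r: "r < n"
  shows "airy_poly_app n N \<alpha> q f x $ r = mop n (Suc (N * e)) (qcoef n N \<alpha> q) (comps f) r x"
proof -
  have "airy_poly_app n N \<alpha> q f x $ r =
      (\<Sum>c<n. \<Sum>s\<le>degree (q $$ (r, c)). coeff (q $$ (r, c)) s * (airy_op N \<alpha> ^^ s) (comps f c) x)"
    using r by (simp add: airy_poly_app_def comps_def[abs_def])
  also have "\<dots> = (\<Sum>c<n. \<Sum>s\<le>degree (q $$ (r, c)). \<Sum>i<Suc (N * e). coeff (q $$ (r, c)) s * acoef N \<alpha> s i x * (deriv ^^ i) (comps f c) x)"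
  proof (intro sum.cong refl)
    fix c s assume c: "c \<in> {..<n}" and s: "s \<in> {..degree (q $$ (r, c))}"
    have "s \<le> e" using c s d[OF r, of c] by auto
    then have "Suc (N * s) \<le> Suc (N * e)" by simp
    then have "(airy_op N \<alpha> ^^ s) (comps f c) x = sop (Suc (N * e)) (acoef N \<alpha> s) (comps f c) x"
      using airy_pow_sop[OF N an] c sop_extend[of "Suc (N * s)" "acoef N \<alpha> s" "Suc (N * e)"] acoef_zero[OF N] by simp
    then show "coeff (q $$ (r, c)) s * (airy_op N \<alpha> ^^ s) (comps f c) x =
        (\<Sum>i<Suc (N * e). coeff (q $$ (r, c)) s * acoef N \<alpha> s i x * (deriv ^^ i) (comps f c) x)"
      by (simp only: sop_def sum_distrib_left mult.assoc)
  qed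
  also have "\<dots> = (\<Sum>c<n. \<Sum>i<Suc (N * e). \<Sum>s\<le>degree (q $$ (r, c)). coeff (q $$ (r, c)) s * acoef N \<alpha> s i x * (deriv ^^ i) (comps f c) x)"
    by (rule sum.cong[OF refl], rule sum.swap)
  also have "\<dots> = mop n (Suc (N * e)) (qcoef n N \<alpha> q) (comps f) r x"
    unfolding mop_def sop_def using r
    by (intro sum.cong refl) (simp add: qcoef_def sum_distrib_right)
  finally show ?thesis .
qed

end

lemma mop_left:
  "mop n K (\<lambda>r c i x. \<Sum>e<n. V r e x * A e c i x) F r x = (\<Sum>e<n. V r e x * mop n K A F e x)"
proof -
  have "mop n K (\<lambda>r c i x. \<Sum>e<n. V r e x * A e c i x) F r x =
     (\<Sum>c<n. \<Sum>i<K. \<Sum>e<n. V r e x * (A e c i x * (deriv ^^ i) (F c) x))"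
    unfolding mop_def sop_def by (simp add: sum_distrib_right mult.assoc)
  also have "\<dots> = (\<Sum>c<n. \<Sum>e<n. \<Sum>i<K. V r e x * (A e c i x * (deriv ^^ i) (F c) x))"
    by (rule sum.cong[OF refl], rule sum.swap)
  also have "\<dots> = (\<Sum>e<n. \<Sum>c<n. \<Sum>i<K. V r e x * (A e c i x * (deriv ^^ i) (F c) x))"
    by (rule sum.swap)
  finally show ?thesis by (simp add: mop_def sop_def sum_distrib_left)
qed

lemma mop_extend:
  assumes "\<And>r c i. i \<ge> K \<Longrightarrow> A r c i = (\<lambda>_. 0)" "K \<le> K'"
  shows "mop n K' A F r x = mop n K A F r x"
  unfolding mop_def using assms by (intro sum.cong refl sop_extend) auto

lemma sum_lessThan_add: "(\<Sum>j<a + b. f j) = (\<Sum>j<a. f j) + (\<Sum>i<(b::nat). f (a + i :: nat) :: 'a::comm_monoid_add)"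
  by (induction b) (auto simp: add_ac)

lemma sum_div_mod: "(\<Sum>j<m * N. g (j div N) (j mod N)) = (\<Sum>t<m. \<Sum>i<(N::nat). g t i :: 'a::comm_monoid_add)"
proof (induction m)
  case (Suc m)
  have "(\<Sum>i<N. g ((m * N + i) div N) ((m * N + i) mod N)) = (\<Sum>i<N. g m i)"
    by (intro sum.cong) auto
  then show ?case using Suc sum_lessThan_add[of "\<lambda>j. g (j div N) (j mod N)" "m * N" N]
    by (simp add: add.commute)
qed auto

lemma entire_eq_0:
  assumes "f holomorphic_on UNIV" "\<forall>\<^sub>\<approx>x. f x = 0"
  shows "f x = (0::complex)"
  using analytic_zero_nhds[OF entire_analytic[OF assms(1)] cosparse_at[OF assms(2)], of x] eventually_nhds_x_imp_x by fastforce

lemma entire_mero: "f holomorphic_on UNIV \<Longrightarrow> f meromorphic_on UNIV"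
  by (simp add: analytic_on_imp_meromorphic_on analytic_on_open)

section \<open>Rational operators acting on the module\<close>

lemma common_denominator:
  assumes "finite S" "\<And>s. s \<in> S \<Longrightarrow> rational_fun (f s)"
  shows "\<exists>D u. D \<noteq> 0 \<and> (\<forall>s\<in>S. \<forall>x. poly D x \<noteq> 0 \<longrightarrow> poly D x * f s x = poly (u s) x)"
proof -
  have "\<forall>s\<in>S. \<exists>p q. q \<noteq> 0 \<and> (\<forall>x. poly q x \<noteq> 0 \<longrightarrow> f s x = poly p x / poly q x)"
    using assms by (auto simp: rational_fun_def)
  then obtain p q where pq: "\<And>s. s \<in> S \<Longrightarrow> q s \<noteq> 0" "\<And>s x. s \<in> S \<Longrightarrow> poly (q s) x \<noteq> 0 \<Longrightarrow> f s x = poly (p s) x / poly (q s) x"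
    by metis
  have "poly (\<Prod>s\<in>S. q s) x * f s x = poly (p s * (\<Prod>s'\<in>S - {s}. q s')) x"
    if "s \<in> S" "poly (\<Prod>s\<in>S. q s) x \<noteq> 0" for s x
  proof -
    have e: "(\<Prod>s\<in>S. q s) = q s * (\<Prod>s'\<in>S - {s}. q s')"
      using assms that by (simp add: prod.remove)
    then have "poly (q s) x \<noteq> 0" using that by auto
    then show ?thesis using pq(2)[OF that(1)] by (simp add: e)
  qed
  moreover have "(\<Prod>s\<in>S. q s) \<noteq> 0" using assms pq by simp
  ultimately show ?thesis
    by (intro exI[of _ "\<Prod>s\<in>S. q s"] exI[of _ "\<lambda>s. p s * (\<Prod>s'\<in>S - {s}. q s')"]) auto
qed

context airy
begin

text \<open>After clearing denominators by \<open>D\<close> the coefficients are polynomials and act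
  on symbols by \<open>poly_mult_papp\<close>, while derivatives multiply symbols by monomials.
  Neither step depends on \<open>i\<close>.\<close>

lemma rational_action:
  assumes P: "rational_mdo n P"
  shows "\<exists>D B. D \<noteq> 0 \<and> (\<forall>r<n. \<forall>c a x. \<forall>i<N. poly D x \<noteq> 0 \<longrightarrow>
    poly D x * mop n (length P) (cf n P) (\<lambda>e. papp (a e) (psi c i)) r x = papp (B r c a) (psi c i) x)"
proof -
  let ?K = "length P"
  obtain D u where D: "D \<noteq> 0" "\<And>r e l x. r < n \<Longrightarrow> e < n \<Longrightarrow> l < ?K \<Longrightarrow> poly D x \<noteq> 0 \<Longrightarrow>
      poly D x * cf n P r e l x = poly (u (r, e, l)) x"
    using common_denominator[of "{..<n} \<times> {..<n} \<times> {..<?K}" "\<lambda>(r, e, l). cf n P r e l"] cf_rational[OF P] by auto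
  obtain Bu where Bu: "\<And>u c a i x. i < N \<Longrightarrow> poly u x * papp a (psi c i) x = papp (Bu u c a) (psi c i) x"
    using poly_mult_papp by metis
  define B where "B r c a = (\<Sum>e<n. \<Sum>l<?K. Bu (u (r, e, l)) c (monom 1 l * a e))" for r c and a :: "nat \<Rightarrow> complex poly"
  have "poly D x * mop n ?K (cf n P) (\<lambda>e. papp (a e) (psi c i)) r x = papp (B r c a) (psi c i) x"
    if "r < n" "i < N" "poly D x \<noteq> 0" for r c a x i
  proof -
    have "poly D x * mop n ?K (cf n P) (\<lambda>e. papp (a e) (psi c i)) r x =
        (\<Sum>e<n. \<Sum>l<?K. (poly D x * cf n P r e l x) * papp (monom 1 l * a e) (psi c i) x)"
      by (simp add: mop_def sop_def sum_distrib_left mult.assoc higher_deriv_papp[OF psi_entire[OF that(2)]])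
    also have "\<dots> = (\<Sum>e<n. \<Sum>l<?K. poly (u (r, e, l)) x * papp (monom 1 l * a e) (psi c i) x)"
      using D that by (intro sum.cong) auto
    also have "\<dots> = papp (B r c a) (psi c i) x"
      by (simp add: B_def papp_sum Bu[OF that(2)])
    finally show ?thesis .
  qed
  then show ?thesis using D by blast
qed

lemma mop_psi_sum:
  "mop n K A (\<lambda>r. psi_sum \<Lambda> (a r)) r x = (\<Sum>c\<in>\<Lambda>. \<Sum>i<N. mop n K A (\<lambda>e. papp (a e c i) (psi c i)) r x)"
proof (cases "finite \<Lambda>")
  case True
  have e: "papp (a e c i) (psi c i) analytic_on {x}" if "i < N" for e c i
    using that by (intro entire_analytic papp_entire psi_entire)
  have "(\<lambda>e. psi_sum \<Lambda> (a e)) = (\<lambda>e y. \<Sum>s\<in>\<Lambda> \<times> {..<N}. 1 * papp (a e (fst s) (snd s)) (psi (fst s) (snd s)) y)"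
    by (auto simp: fun_eq_iff psi_sum_def sum.cartesian_product case_prod_beta)
  then have "mop n K A (\<lambda>r. psi_sum \<Lambda> (a r)) r x =
     (\<Sum>s\<in>\<Lambda> \<times> {..<N}. 1 * mop n K A (\<lambda>e. papp (a e (fst s) (snd s)) (psi (fst s) (snd s))) r x)"
    using e by (simp only:, subst mop_lin) auto
  then show ?thesis by (simp add: sum.cartesian_product case_prod_beta)
next
  case False
  then show ?thesis by (simp add: mop_def sop_def psi_sum_def[abs_def])
qed

text \<open>A rational operator acts on \<open>a(\<partial>) (psi c i)\<close> through an operator on \<open>a\<close> that does not depend
  on \<open>i\<close>, and there are no linear relations between the results for different \<open>c\<close> and \<open>i\<close>.\<close>

lemma component_in_vker:
  assumes P: "rational_mdo n P" and \<Lambda>: "finite \<Lambda>"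
    and f: "vecf n (\<lambda>r. psi_sum \<Lambda> (a r)) \<in> vker n P" and c: "c \<in> \<Lambda>" "i < N" "i' < N"
  shows "vecf n (\<lambda>r. papp (a r c i) (psi c i')) \<in> vker n P"
proof -
  note carr = carr_mdo_rational[OF P]
  let ?K = "length P"
  obtain D B where D: "D \<noteq> 0" "\<And>r c a x i. r < n \<Longrightarrow> i < N \<Longrightarrow> poly D x \<noteq> 0 \<Longrightarrow>
      poly D x * mop n ?K (cf n P) (\<lambda>e. papp (a e) (psi c i)) r x = papp (B r c a) (psi c i) x"
    using rational_action[OF P] by blast
  have cong: "mop n ?K (cf n P) (comps (vecf n F)) r x = mop n ?K (cf n P) F r x" for F r x
    by (rule mop_cong) (auto simp: comps_vecf)
  \<comment> \<open>D P f is again a \<open>psi_sum\<close>, and it vanishes; independence makes the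
    symbol at each \<open>c\<close> and \<open>i\<close> vanish separately.\<close>
  have B0: "B r c (\<lambda>e. a e c i) = 0" if r: "r < n" for r
  proof (rule psi_sum_indep[OF \<Lambda> _ c(1,2), of "\<lambda>c i. B r c (\<lambda>e. a e c i)"])
    fix x
    have "\<forall>\<^sub>\<approx>x. mop n ?K (cf n P) (\<lambda>r. psi_sum \<Lambda> (a r)) r x = 0"
      using f r unfolding vker_iff[OF carr] cong by blast
    then have "\<forall>\<^sub>\<approx>x. psi_sum \<Lambda> (\<lambda>c i. B r c (\<lambda>e. a e c i)) x = 0"
      using poly_nonzero_cosparse[OF D(1)]
    proof eventually_elim
      case (elim x)
      have "psi_sum \<Lambda> (\<lambda>c i. B r c (\<lambda>e. a e c i)) x =
        (\<Sum>c\<in>\<Lambda>. \<Sum>i<N. poly D x * mop n ?K (cf n P) (\<lambda>e. papp (a e c i) (psi c i)) r x)"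
        unfolding psi_sum_def using D(2) r elim by (intro sum.cong) auto
      also have "\<dots> = 0" using elim(1) by (simp add: mop_psi_sum flip: sum_distrib_left)
      finally show ?case .
    qed
    then show "psi_sum \<Lambda> (\<lambda>c i. B r c (\<lambda>e. a e c i)) x = 0" by (rule entire_eq_0[OF psi_sum_entire])
  qed
  show ?thesis
    unfolding vker_iff[OF carr] cong
  proof (intro conjI allI impI)
    show "mero_vec n (vecf n (\<lambda>r. papp (a r c i) (psi c i')))"
      using c by (intro mero_vec_vecf entire_mero papp_entire psi_entire)
    fix r assume r: "r < n"
    show "\<forall>\<^sub>\<approx>x. mop n ?K (cf n P) (\<lambda>r. papp (a r c i) (psi c i')) r x = 0"
      using poly_nonzero_cosparse[OF D(1)]
    proof eventually_elim
      case (elim x)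
      \<comment> \<open>\<open>B\<close> does not involve the index of \<open>psi\<close>, so
        \<open>B0\<close>, found for \<open>i\<close>, also serves for \<open>i'\<close>.\<close>
      show ?case using D(2)[OF r c(3) elim, of "\<lambda>e. a e c i" c] B0[OF r] elim by simp
    qed
  qed
qed

lemma airy_poly_app_psi_sum:
  assumes "r < n"
  shows "airy_poly_app n N \<alpha> q (vecf n (\<lambda>r. psi_sum \<Lambda> (a r))) x $ r = psi_sum \<Lambda> (\<lambda>c i. \<Sum>c'<n. tact c (q $$ (r, c')) (a c' c i)) x"
proof -
  have "airy_poly_app n N \<alpha> q (vecf n (\<lambda>r. psi_sum \<Lambda> (a r))) x $ r =
      (\<Sum>c'<n. \<Sum>s\<le>degree (q $$ (r, c')). coeff (q $$ (r, c')) s * (airy_op N \<alpha> ^^ s) (psi_sum \<Lambda> (a c')) x)"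
    using assms by (simp add: airy_poly_app_def) (intro sum.cong refl, simp add: vecf_def cong: sum.cong)
  also have "\<dots> = (\<Sum>c'<n. psi_sum \<Lambda> (\<lambda>c i. tact c (q $$ (r, c')) (a c' c i)) x)"
    by (simp add: airy_poly_psi_sum)
  also have "\<dots> = (\<Sum>c\<in>\<Lambda>. \<Sum>c'<n. \<Sum>i<N. papp (tact c (q $$ (r, c')) (a c' c i)) (psi c i) x)"
    unfolding psi_sum_def by (rule sum.swap)
  also have "\<dots> = (\<Sum>c\<in>\<Lambda>. \<Sum>i<N. \<Sum>c'<n. papp (tact c (q $$ (r, c')) (a c' c i)) (psi c i) x)"
    by (rule sum.cong[OF refl], rule sum.swap)
  finally show ?thesis by (simp add: psi_sum_def papp_sum)
qed

end

lemma mop_mero: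
  assumes "\<And>r c i. A r c i meromorphic_on UNIV" "\<And>c. F c meromorphic_on UNIV"
  shows "mop n K A F r meromorphic_on UNIV"
  unfolding mop_def[abs_def] sop_def using assms by (auto intro!: meromorphic_intros simp del: sum.lessThan_Suc)

section \<open>Darboux transformations have tuple kernels\<close>

context airy
begin

text \<open>Coefficients on both sides of q(M) = Q P are compared. The right side has order exactly
  \<open>kP + kQ\<close> with invertible leading matrix; on the left the matrix at
  \<open>N * e\<close> consists of the coefficients of \<open>q\<close> at the maximal degree
  \<open>e\<close>.\<close>

lemma factorization_order:
  assumes n: "n > 0" and Q: "rational_mdo n Q" and P: "rational_mdo n P"
    and inv: "invertible_fun (last Q)" "invertible_fun (last P)"
    and len: "length Q = Suc kQ" "length P = Suc kP"
    and fact: "\<And>f. mero_vec n f \<Longrightarrow> \<forall>\<^sub>\<approx>x. airy_poly_app n N \<alpha> q f x = mdo_app n Q (mdo_app n P f) x"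
  obtains e where "\<And>r c. r < n \<Longrightarrow> c < n \<Longrightarrow> degree (q $$ (r, c)) \<le> e" "N * e = kP + kQ"
    "det (mat n n (\<lambda>(r, c). coeff (q $$ (r, c)) e)) \<noteq> 0"
proof -
  define e where "e = Max ((\<lambda>(r, c). degree (q $$ (r, c))) ` ({..<n} \<times> {..<n}))"
  have d: "degree (q $$ (r, c)) \<le> e" if "r < n" "c < n" for r c
    unfolding e_def using that by (intro Max_ge) auto
  define T where "T = qcoef n N \<alpha> q"
  define C where "C = mcomp n (Suc kQ) (cf n Q) (cf n P)"
  \<comment> \<open>A bound above both orders, which are not yet known to agree.\<close>
  define K where "K = Suc (N * e + kP + kQ)"
  have Tz: "T r c i = (\<lambda>_. 0)" if "i > N * e" for r c i
    unfolding T_def using that d by (intro qcoef_zero[OF N]) auto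
  have cfz: "cf n P r c i = (\<lambda>_. 0)" if "i > kP" for r c i using that len by (intro cf_zero) auto
  have Cz: "C r c i = (\<lambda>_. 0)" if "i > kP + kQ" for r c i
    unfolding C_def by (rule mcomp_zero[OF cfz that])
  note cP = carr_mdo_rational[OF P] and cQ = carr_mdo_rational[OF Q]
  have an: "\<forall>\<^sub>\<approx>x. \<forall>r c i. cf n P r c i analytic_on {x}"
    by (rule analytic_family_cosparse[of _ n "length P"]) (use P in \<open>auto intro: cf_mero rational_mdo_mero\<close>, auto simp: cf_def)
  have eq: "\<forall>\<^sub>\<approx>x. mop n K T F r x = mop n K C F r x"
    if F: "\<And>c. F c meromorphic_on UNIV" and r: "r < n" for F r
  proof -
    have "mero_vec n (vecf n F)" using F by (intro mero_vec_vecf)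
    from fact[OF this] have 1: "\<forall>\<^sub>\<approx>x. airy_poly_app n N \<alpha> q (vecf n F) x = mdo_app n Q (mdo_app n P (vecf n F)) x" .
    have 2: "\<forall>\<^sub>\<approx>x. \<forall>c<n. F c analytic_on {x}"
      unfolding cosparse_all_less using F by (auto intro!: meromorphic_on_imp_analytic_cosparse)
    show ?thesis using 1 2 an
    proof eventually_elim
      case (elim x)
      have "airy_poly_app n N \<alpha> q (vecf n F) x $ r = mop n (Suc (N * e)) T (comps (vecf n F)) r x"
        unfolding T_def using elim d r by (intro airy_poly_app_mop[OF N]) (auto simp: comps_vecf)
      also have "\<dots> = mop n (Suc (N * e)) T F r x"
        by (rule mop_cong) (auto simp: comps_vecf)
      also have "\<dots> = mop n K T F r x"
        by (rule mop_extend[symmetric]) (use Tz in \<open>auto simp: K_def\<close>)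
      finally have a: "airy_poly_app n N \<alpha> q (vecf n F) x $ r = mop n K T F r x" .
      have "mdo_app n Q (mdo_app n P (vecf n F)) x $ r = mop n (Suc kQ) (cf n Q) (comps (mdo_app n P (vecf n F))) r x"
        using mdo_app_eq_mop[OF cQ r] len by simp
      also have "\<dots> = mop n (Suc kQ) (cf n Q) (mop n (Suc kP) (cf n P) F) r x"
      proof (rule mop_cong)
        fix c assume c: "c < n"
        show "comps (mdo_app n P (vecf n F)) c = mop n (Suc kP) (cf n P) F c"
        proof
          fix y
          have "comps (mdo_app n P (vecf n F)) c y = mop n (Suc kP) (cf n P) (comps (vecf n F)) c y"
            using mdo_app_eq_mop[OF cP c] len by (simp add: comps_def)
          also have "\<dots> = mop n (Suc kP) (cf n P) F c y"
            by (rule mop_cong) (auto simp: comps_vecf)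
          finally show "comps (mdo_app n P (vecf n F)) c y = mop n (Suc kP) (cf n P) F c y" .
        qed
      qed auto
      also have "\<dots> = mop n (Suc kP + Suc kQ) C F r x"
        unfolding C_def by (rule mop_mcomp) (use elim cfz in auto)
      also have "\<dots> = mop n (Suc (kP + kQ)) C F r x"
        by (rule mop_extend) (use Cz in auto)
      also have "\<dots> = mop n K C F r x"
        by (rule mop_extend[symmetric]) (use Cz in \<open>auto simp: K_def\<close>)
      finally show ?case using a elim(1) by simp
    qed
  qed
  have coef: "\<forall>\<^sub>\<approx>x. T r c i x = C r c i x" if "r < n" "c < n" "i < K" for r c i
    using mop_coeff_unique[of n K T C, OF eq that(1,2,3)] .
  have coef': "\<forall>\<^sub>\<approx>x. \<forall>r<n. \<forall>c<n. T r c i x = C r c i x" if "i < K" for i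
    unfolding cosparse_all_less using coef that by blast
  have detC: "\<forall>\<^sub>\<approx>x. det (mat n n (\<lambda>(r, c). C r c (kP + kQ) x)) \<noteq> 0"
  proof -
    have "mero_mat n (last P)" "mero_mat n (last Q)"
      using rational_mdo_mero[OF P] rational_mdo_mero[OF Q] by (auto simp: mero_mdo_def)
    then have "\<forall>\<^sub>\<approx>x. det (last P x) \<noteq> 0" "\<forall>\<^sub>\<approx>x. det (last Q x) \<noteq> 0"
      using inv by (auto intro: invertible_cosparse)
    then show ?thesis
    proof eventually_elim
      case (elim x)
      have c: "last P x \<in> carrier_mat n n" "last Q x \<in> carrier_mat n n"
        using cP cQ by (auto simp: carr_mdo_def)
      have l: "last P x $$ (r, c) = cf n P r c kP x" "last Q x $$ (r, c) = cf n Q r c kQ x" if "r < n" "c < n" for r c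
        unfolding cf_top[OF cP, symmetric] cf_top[OF cQ, symmetric] using that len by auto
      have "mat n n (\<lambda>(r, c). C r c (kP + kQ) x) = last Q x * last P x"
        using c by (intro eq_matI)
          (auto simp: C_def mcomp_top[OF cfz] scalar_prod_def atLeast0LessThan l intro!: sum.cong)
      then show ?case using det_mult[OF c(2,1)] elim by simp
    qed
  qed
  have zero_det: "det (mat n n (\<lambda>(r, c). 0 :: complex)) = 0"
    using det_inj[of n "\<lambda>_ _. 0" "\<lambda>_. 1"] n by auto
  have kK: "kP + kQ < K" by (simp add: K_def)
  have "\<not> kP + kQ > N * e"
  proof
    \<comment> \<open>The leading matrix of the product would be both invertible and zero; since
      \<open>n > 0\<close>, the zero matrix has determinant 0.\<close>
    assume gt: "kP + kQ > N * e"
    obtain x where x: "\<forall>r<n. \<forall>c<n. T r c (kP + kQ) x = C r c (kP + kQ) x"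
      "det (mat n n (\<lambda>(r, c). C r c (kP + kQ) x)) \<noteq> 0"
      using cosparse_ex[OF eventually_conj[OF coef'[OF kK] detC]] by blast
    have "mat n n (\<lambda>(r, c). C r c (kP + kQ) x) = mat n n (\<lambda>(r, c). 0)"
      using x(1) Tz[OF gt] by (intro eq_matI) auto
    then show False using x zero_det by simp
  qed
  moreover have "\<not> kP + kQ < N * e"
  proof
    \<comment> \<open>An entry of maximal degree would have vanishing leading coefficient, so
      \<open>e = 0\<close>, against \<open>lt\<close>.\<close>
    assume lt: "kP + kQ < N * e"
    have "e \<in> (\<lambda>(r, c). degree (q $$ (r, c))) ` ({..<n} \<times> {..<n})"
      unfolding e_def using n by (intro Max_in) auto
    then obtain r c where rc: "r < n" "c < n" "degree (q $$ (r, c)) = e" by auto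
    obtain x where "T r c (N * e) x = C r c (N * e) x"
      using cosparse_ex[OF coef[OF rc(1,2), of "N * e"]] by (auto simp: K_def)
    then have "coeff (q $$ (r, c)) e = 0"
      using Cz[OF lt] qcoef_top[OF N d rc(1,2), where \<alpha> = \<alpha> and x = x] by (simp add: T_def)
    then have "e = 0" using rc by (metis leading_coeff_0_iff degree_0)
    then show False using lt by simp
  qed
  ultimately have Ne: "N * e = kP + kQ" by simp
  obtain x where x: "\<forall>r<n. \<forall>c<n. T r c (kP + kQ) x = C r c (kP + kQ) x"
    "det (mat n n (\<lambda>(r, c). C r c (kP + kQ) x)) \<noteq> 0"
    using cosparse_ex[OF eventually_conj[OF coef'[OF kK] detC]] by blast
  have "mat n n (\<lambda>(r, c). C r c (kP + kQ) x) = mat n n (\<lambda>(r, c). coeff (q $$ (r, c)) e)"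
    using x(1) qcoef_top[OF N d, where \<alpha> = \<alpha> and x = x]
    by (intro eq_matI) (auto simp: T_def Ne[symmetric])
  then show ?thesis using that[OF d Ne] x(2) by auto
qed

text \<open>No existence theorem for ODEs is needed to see that the kernel of \<open>P\<close> is large enough. Let \<open>p\<close> be
  the determinant and \<open>B\<close> the adjugate of \<open>q\<close>. The kernel of \<open>p(M\<^sub>A\<^sub>i)\<close> contains an explicit space of
  dimension \<open>n N deg p\<close>. If \<open>f\<close> belongs to it, then \<open>B(M\<^sub>A\<^sub>i)\<close> kills \<open>q(M\<^sub>A\<^sub>i) f = Q P f\<close>; by uniqueness,
  the vanishing of sufficiently many derivatives of \<open>q(M\<^sub>A\<^sub>i) f\<close> and of \<open>P f\<close> at a single regular point
  forces \<open>P f = 0\<close>. As many conditions as the orders of \<open>B(M\<^sub>A\<^sub>i)\<close> and \<open>Q\<close> allow are imposed, and these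
  orders add up with that of \<open>P\<close> to \<open>N deg p\<close>.\<close>

lemma kernel_family_exists:
  assumes n: "n > 0" and q: "q \<in> carrier_mat n n" and Q: "rational_mdo n Q" and P: "rational_mdo n P"
    and inv: "invertible_fun (last Q)" "invertible_fun (last P)"
    and len: "length Q = Suc kQ" "length P = Suc kP"
    and fact: "\<And>f. mero_vec n f \<Longrightarrow> \<forall>\<^sub>\<approx>x. airy_poly_app n N \<alpha> q f x = mdo_app n Q (mdo_app n P f) x"
  obtains \<Lambda> f A where "finite \<Lambda>" "indep n (n * kP) f" "\<And>d. d < n * kP \<Longrightarrow> f d \<in> vker n P"
    "\<And>d. d < n * kP \<Longrightarrow> f d = vecf n (\<lambda>r. psi_sum \<Lambda> (A d r))"
proof -
  obtain e where d: "\<And>r c. r < n \<Longrightarrow> c < n \<Longrightarrow> degree (q $$ (r, c)) \<le> e" and Ne: "N * e = kP + kQ"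
    and qe: "det (mat n n (\<lambda>(r, c). coeff (q $$ (r, c)) e)) \<noteq> 0"
    using factorization_order[OF n Q P inv len fact] by blast
  define p where "p = det q"
  define B where "B = adj_mat q"
  note Bq = adj_mat[OF q, folded B_def p_def]
  have p: "degree p = n * e" "p \<noteq> 0"
  proof -
    have "coeff p (n * e) \<noteq> 0" using det_poly_top(2)[OF q d] qe by (simp add: p_def)
    then show "degree p = n * e" "p \<noteq> 0"
      using det_poly_top(1)[OF q d] le_degree[of p "n * e"] by (auto simp: p_def)
  qed
  define \<Lambda> where "\<Lambda> = {c. poly p c = 0}"
  have fin: "finite \<Lambda>" unfolding \<Lambda>_def using p by (simp add: poly_roots_finite)
  have ord: "(\<Sum>c\<in>\<Lambda>. order c p) = n * e"
  proof -
    have "n * e = size (proots p)" by (simp add: size_proots_complex p)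
    also have "\<dots> = (\<Sum>c\<in>\<Lambda>. order c p)"
      using p by (simp add: size_multiset_overloaded_eq \<Lambda>_def)
    finally show ?thesis by simp
  qed
  \<comment> \<open>Indices of a basis of the explicit space: the symbol t^h, with \<open>h\<close>
    below the multiplicity of the root \<open>c\<close>, is killed by \<open>p\<close>; it is
    combined with each of the \<open>N\<close> functions and each of the \<open>n\<close>
    components.\<close>
  define I where "I = (SIGMA c:\<Lambda>. {..<order c p} \<times> {..<N} \<times> {..<n})"
  have finI: "finite I" unfolding I_def using fin by auto
  have cardI: "card I = n * (N * (n * e))"
  proof -
    have "card I = (\<Sum>c\<in>\<Lambda>. order c p * (N * n))" unfolding I_def using fin by simp
    also have "\<dots> = n * e * (N * n)" by (simp only: sum_distrib_right[symmetric] ord)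
    finally show ?thesis by (simp add: mult_ac)
  qed
  define \<kappa> where "\<kappa> = (\<lambda>(c, h, i, r0 :: nat) r y. if r = r0 then papp (monom 1 h) (psi c i) y else 0)"
  define a where "a v r c i = (\<Sum>h<order c p. monom (v (c, h, i, r)) h)" for v :: "complex \<times> nat \<times> nat \<times> nat \<Rightarrow> complex" and r c i
  define F where "F v r = psi_sum \<Lambda> (a v r)" for v r
  have \<kappa>e: "\<kappa> j r holomorphic_on UNIV" if j: "j \<in> I" for j r
  proof -
    obtain c h i r0 where "j = (c, h, i, r0)" "i < N" using j by (auto simp: I_def)
    then show ?thesis by (cases "r = r0") (auto simp: \<kappa>_def intro!: papp_entire psi_entire)
  qed
  have F\<kappa>: "F v r y = (\<Sum>j\<in>I. v j * \<kappa> j r y)" if "r < n" for v r y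
  proof -
    have "(\<Sum>j\<in>I. v j * \<kappa> j r y) = (\<Sum>c\<in>\<Lambda>. \<Sum>t\<in>{..<order c p} \<times> {..<N} \<times> {..<n}. v (c, t) * \<kappa> (c, t) r y)"
      unfolding I_def using fin by (subst sum.Sigma) (auto simp: case_prod_beta)
    also have "\<dots> = (\<Sum>c\<in>\<Lambda>. \<Sum>h<order c p. \<Sum>i<N. \<Sum>r0<n. v (c, h, i, r0) * \<kappa> (c, h, i, r0) r y)"
      by (simp add: sum.cartesian_product')
    also have "\<dots> = (\<Sum>c\<in>\<Lambda>. \<Sum>h<order c p. \<Sum>i<N. papp (monom (v (c, h, i, r)) h) (psi c i) y)"
    proof (intro sum.cong refl)
      fix c h i
      have "(\<Sum>r0<n. v (c, h, i, r0) * \<kappa> (c, h, i, r0) r y) = (\<Sum>r0<n. if r0 = r then papp (monom (v (c, h, i, r)) h) (psi c i) y else 0)"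
        by (rule sum.cong) (auto simp: \<kappa>_def papp_monom)
      then show "(\<Sum>r0<n. v (c, h, i, r0) * \<kappa> (c, h, i, r0) r y) = papp (monom (v (c, h, i, r)) h) (psi c i) y"
        using that by simp
    qed
    also have "\<dots> = (\<Sum>c\<in>\<Lambda>. \<Sum>i<N. \<Sum>h<order c p. papp (monom (v (c, h, i, r)) h) (psi c i) y)"
      by (rule sum.cong[OF refl], rule sum.swap)
    finally show ?thesis by (simp add: F_def psi_sum_def a_def papp_sum)
  qed
  have Fe: "F v r holomorphic_on UNIV" for v r unfolding F_def by (rule psi_sum_entire)
  have "mero_mdo n P" "mero_mdo n Q" using P Q rational_mdo_mero by auto
  then have "\<forall>\<^sub>\<approx>x. regular_at n P x" "\<forall>\<^sub>\<approx>x. regular_at n Q x" using regular_at_cosparse inv by auto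
  then have "\<forall>\<^sub>\<approx>x. regular_at n P x \<and> regular_at n Q x" by eventually_elim auto
  then obtain x0 where x0: "regular_at n P x0" "regular_at n Q x0" using cosparse_ex by blast
  note cP = carr_mdo_rational[OF P] and cQ = carr_mdo_rational[OF Q]
  define PF where "PF v = mop n (Suc kP) (cf n P) (F v)" for v
  define T where "T = qcoef n N \<alpha> q"
  define G where "G v = mop n (Suc (N * e)) T (F v)" for v
  \<comment> \<open>The order of B(M), since the entries of the adjugate have degree at most
    \<open>(n - 1) * e\<close>.\<close>
  define k2 where "k2 = N * ((n - 1) * e)"
  have lin: "mop n K A (F v) r y = (\<Sum>j\<in>I. v j * mop n K A (\<kappa> j) r y)" for K A v r y
  proof -
    have "mop n K A (F v) r y = mop n K A (\<lambda>c y. \<Sum>j\<in>I. v j * \<kappa> j c y) r y"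
      by (rule mop_cong) (auto simp: F\<kappa>)
    then show ?thesis using \<kappa>e by (simp add: mop_lin entire_analytic)
  qed
  have jetlin: "(deriv ^^ l) (mop n K A (F v) r) x0 = (\<Sum>j\<in>I. (deriv ^^ l) (mop n K A (\<kappa> j) r) x0 * v j)"
    if "\<And>r c i. A r c i analytic_on {x0}" for A l K v r
  proof -
    have "(deriv ^^ l) (mop n K A (F v) r) x0 = (deriv ^^ l) (\<lambda>y. \<Sum>j\<in>I. v j * mop n K A (\<kappa> j) r y) x0"
      using lin by presburger
    also have "\<dots> = (\<Sum>j\<in>I. v j * (deriv ^^ l) (mop n K A (\<kappa> j) r) x0)"
      using \<kappa>e that by (intro higher_deriv_lin mop_analytic) (auto intro: entire_analytic)
    finally show ?thesis by (simp add: mult.commute)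
  qed
  have Pan: "cf n P r c i analytic_on {x0}" for r c i using x0 by (auto simp: regular_at_def)
  have Tan: "T r c i analytic_on {x}" for r c i x unfolding T_def by (rule qcoef_analytic)
  \<comment> \<open>The conditions, numbered like the rows of a Wronski matrix: \<open>E1\<close> is
    the jet of P f, taken below the order of Q, and \<open>E2\<close> the jet of q(M) f, taken below
    the order of B(M).\<close>
  define E1 where "E1 i j = (deriv ^^ (i div n)) (mop n (Suc kP) (cf n P) (\<kappa> j) (i mod n)) x0" for i j
  define E2 where "E2 i j = (deriv ^^ (i div n)) (mop n (Suc (N * e)) T (\<kappa> j) (i mod n)) x0" for i j
  define EE where "EE i j = (if i < n * kQ then E1 i j else E2 (i - n * kQ) j)" for i j
  \<comment> \<open>By \<open>Ne\<close>, the conditions together with the desired dimension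
    \<open>n * kP\<close> exhaust \<open>card I\<close> exactly.\<close>
  have count: "(n * kQ + n * k2) + n * kP \<le> card I"
  proof -
    have "n * kQ + n * kP = n * (N * e)" using Ne by (simp add: algebra_simps)
    moreover have "n * (N * (n * e)) = n * (N * e) + n * k2"
      using n by (cases n) (auto simp: k2_def algebra_simps)
    ultimately show ?thesis unfolding cardI by simp
  qed
  obtain u where u: "\<And>d i. d < n * kP \<Longrightarrow> i < n * kQ + n * k2 \<Longrightarrow> (\<Sum>j\<in>I. EE i j * u d j) = 0"
    "\<And>b. \<forall>j\<in>I. (\<Sum>d<n * kP. b d * u d j) = 0 \<Longrightarrow> \<forall>d<n * kP. b d = 0"
    using kernel_family_set[OF finI count, of EE] by blast
  have cong: "mop n K A (comps (vecf n F)) r x = mop n K A F r x" for K A F r x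
    by (rule mop_cong) (auto simp: comps_vecf)
  have dB: "degree (B $$ (r, c)) \<le> (n - 1) * e" if "r < n" "c < n" for r c
    unfolding B_def by (rule adj_poly_top(1)[OF q d that])
  have Gan: "G v r analytic_on {x}" for v r x
    unfolding G_def using Tan Fe by (intro mop_analytic) (auto intro: entire_analytic)
  have Gq: "G v r x = psi_sum \<Lambda> (\<lambda>c i. \<Sum>c'<n. tact c (q $$ (r, c')) (a v c' c i)) x" if r: "r < n" for v r x
  proof -
    have "G v r x = airy_poly_app n N \<alpha> q (vecf n (F v)) x $ r"
      unfolding G_def T_def using d r Fe
      by (subst airy_poly_app_mop[OF N]) (auto simp: cong comps_vecf intro!: entire_analytic)
    then show ?thesis unfolding F_def using airy_poly_app_psi_sum[OF r] by simp
  qed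
  \<comment> \<open>B q is \<open>p\<close> times the identity, and \<open>p\<close> kills the
    symbols \<open>a v r c i\<close> since their degrees lie below the multiplicity of
    \<open>c\<close>.\<close>
  have BG: "mop n (Suc k2) (qcoef n N \<alpha> B) (G v) r x = 0" if r: "r < n" for v r x
  proof -
    have Gq': "G v c = psi_sum \<Lambda> (\<lambda>c'' i. \<Sum>c'<n. tact c'' (q $$ (c, c')) (a v c' c'' i))" if "c < n" for c
      using Gq[OF that] by auto
    define b where "b r' c i = (\<Sum>c'<n. tact c (q $$ (r', c')) (a v c' c i))" for r' c i
    have "mop n (Suc k2) (qcoef n N \<alpha> B) (G v) r x = mop n (Suc k2) (qcoef n N \<alpha> B) (\<lambda>r. psi_sum \<Lambda> (b r)) r x"
      by (rule mop_cong) (auto simp: Gq' b_def[abs_def])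
    also have "\<dots> = airy_poly_app n N \<alpha> B (vecf n (\<lambda>r. psi_sum \<Lambda> (b r))) x $ r"
      unfolding k2_def using dB r
      by (subst airy_poly_app_mop[OF N]) (auto simp: cong comps_vecf intro!: entire_analytic psi_sum_entire)
    also have "\<dots> = psi_sum \<Lambda> (\<lambda>c i. \<Sum>r'<n. tact c (B $$ (r, r')) (b r' c i)) x"
      by (rule airy_poly_app_psi_sum[OF r])
    also have "\<dots> = 0"
      unfolding psi_sum_def
    proof (intro sum.neutral ballI)
      fix c i assume c: "c \<in> \<Lambda>"
      have "(\<Sum>r'<n. tact c (B $$ (r, r')) (b r' c i)) = (\<Sum>r'<n. \<Sum>c'<n. tact c (B $$ (r, r') * q $$ (r', c')) (a v c' c i))"
        by (simp add: b_def tact_sum_right tact_mult)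
      also have "\<dots> = (\<Sum>c'<n. tact c (\<Sum>r'<n. B $$ (r, r') * q $$ (r', c')) (a v c' c i))"
        by (subst sum.swap) (simp add: tact_sum)
      also have "\<dots> = (\<Sum>c'<n. tact c (if c' = r then p else 0) (a v c' c i))"
      proof (intro sum.cong refl)
        fix c' assume c': "c' \<in> {..<n}"
        have "(\<Sum>r'<n. B $$ (r, r') * q $$ (r', c')) = (B * q) $$ (r, c')"
          using Bq(1) q r c' by (auto simp: scalar_prod_def atLeast0LessThan intro!: sum.cong)
        also have "\<dots> = (if c' = r then p else 0)"
          unfolding Bq(3) using r c' by auto
        finally show "tact c (\<Sum>r'<n. B $$ (r, r') * q $$ (r', c')) (a v c' c i) = tact c (if c' = r then p else 0) (a v c' c i)"
          by simp
      qed
      also have "\<dots> = tact c p (a v r c i)"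
        using r by (simp add: if_distrib[of "\<lambda>p. tact c p _"] cong: if_cong)
      also have "\<dots> = 0"
      proof (rule tact_dvd_eq_0[OF order_1])
        show "a v r c i = 0 \<or> degree (a v r c i) < order c p"
        proof (cases "order c p")
          case (Suc m)
          have "degree (a v r c i) \<le> m" unfolding a_def Suc
            by (intro degree_sum_le) (auto intro: order.trans[OF degree_monom_le])
          then show ?thesis using Suc by simp
        qed (simp add: a_def)
      qed
      finally show "papp (\<Sum>r'<n. tact c (B $$ (r, r')) (b r' c i)) (psi c i) x = 0" by simp
    qed
    finally show ?thesis .
  qed
  define f where "f d = vecf n (F (u d))" for d
  have fm: "mero_vec n (f d)" for d unfolding f_def using Fe by (intro mero_vec_vecf entire_mero)
  have fker: "f d \<in> vker n P" if dd: "d < n * kP" for d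
  proof -
    let ?v = "u d"
    have G0: "\<forall>\<^sub>\<approx>y. G ?v r y = 0" if r: "r < n" for r
    proof (rule mop_unique[of "qcoef n N \<alpha> B" x0 n "G ?v" k2, OF _ _ _ _ _ _ _ r])
      show "qcoef n N \<alpha> B r c i analytic_on {x0}" for r c i by (rule qcoef_analytic)
      show "G ?v c analytic_on {x0}" for c by (rule Gan)
      show "G ?v c meromorphic_on UNIV" if "c < n" for c
      proof -
        have "G ?v c = psi_sum \<Lambda> (\<lambda>c' i. \<Sum>c''<n. tact c' (q $$ (c, c'')) (a ?v c'' c' i))"
          using Gq[OF that] by auto
        then show ?thesis using entire_mero[OF psi_sum_entire] by simp
      qed
      show "qcoef n N \<alpha> B r c i = (\<lambda>_. 0)" if "i > k2" for r c i
        using dB that by (intro qcoef_zero[OF N]) (auto simp: k2_def)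
      show "\<forall>\<^sub>\<approx>y. mop n (Suc k2) (qcoef n N \<alpha> B) (G ?v) r y = 0" if "r < n" for r
        using BG[OF that] by simp
      have "mat n n (\<lambda>(r, c). qcoef n N \<alpha> B r c k2 x0) = adj_mat (mat n n (\<lambda>(r, c). coeff (q $$ (r, c)) e))"
        using adj_poly_top(2)[OF q d] qcoef_top[OF N dB, where \<alpha> = \<alpha> and x = x0] adj_mat(1)[of "mat n n (\<lambda>(r, c). coeff (q $$ (r, c)) e)" n]
        by (intro eq_matI) (auto simp: k2_def B_def)
      then show "det (mat n n (\<lambda>(r, c). qcoef n N \<alpha> B r c k2 x0)) \<noteq> 0"
        using det_adj_nz[OF mat_carrier qe] by simp
      fix i c assume ic: "i < k2" "c < n"
      note di = div_mod_idx[OF ic(2,1)]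
      have "(\<Sum>j\<in>I. EE (n * kQ + (i * n + c)) j * ?v j) = 0" using u(1)[OF dd] di by simp
      then show "(deriv ^^ i) (G ?v c) x0 = 0"
        unfolding G_def jetlin[OF Tan] by (simp add: EE_def E2_def di ic)
    qed
    have "\<forall>\<^sub>\<approx>y. PF ?v r y = 0" if r: "r < n" for r
    proof (rule mop_unique[of "cf n Q" x0 n "PF ?v" kQ, OF _ _ _ _ _ _ _ r])
      show "cf n Q r c i analytic_on {x0}" for r c i using x0 by (auto simp: regular_at_def)
      show "PF ?v c analytic_on {x0}" for c
        unfolding PF_def using Pan Fe by (intro mop_analytic) (auto intro: entire_analytic)
      show "PF ?v c meromorphic_on UNIV" for c
        unfolding PF_def using cf_mero[OF \<open>mero_mdo n P\<close>] entire_mero[OF Fe]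
        by (intro mop_mero)
      show "cf n Q r c i = (\<lambda>_. 0)" if "i > kQ" for r c i using that len by (intro cf_zero) auto
      show "det (mat n n (\<lambda>(r, c). cf n Q r c kQ x0)) \<noteq> 0"
        using x0 len by (simp add: regular_at_def)
      show "(deriv ^^ i) (PF ?v c) x0 = 0" if ic: "i < kQ" "c < n" for i c
      proof -
        note di = div_mod_idx[OF ic(2,1)]
        have "(\<Sum>j\<in>I. EE (i * n + c) j * ?v j) = 0" using u(1)[OF dd] di by simp
        then show ?thesis unfolding PF_def jetlin[OF Pan] by (simp add: EE_def E1_def di ic)
      qed
      fix r assume r: "r < n"
      show "\<forall>\<^sub>\<approx>y. mop n (Suc kQ) (cf n Q) (PF ?v) r y = 0"
        using fact[OF fm[of d]] G0[OF r]
      proof eventually_elim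
        case (elim y)
        have "mop n (Suc kQ) (cf n Q) (PF ?v) r y = mop n (Suc kQ) (cf n Q) (comps (mdo_app n P (f d))) r y"
        proof (rule mop_cong)
          fix c assume c: "c < n"
          show "PF ?v c = comps (mdo_app n P (f d)) c"
          proof
            fix y show "PF ?v c y = comps (mdo_app n P (f d)) c y"
              unfolding PF_def comps_def[of "mdo_app n P (f d)"] mdo_app_eq_mop[OF cP c] len(2)
              unfolding f_def cong ..
          qed
        qed auto
        also have "\<dots> = mdo_app n Q (mdo_app n P (f d)) y $ r"
          using mdo_app_eq_mop[OF cQ r] len by simp
        also have "\<dots> = airy_poly_app n N \<alpha> q (f d) y $ r" using elim(1) by simp
        also have "\<dots> = G ?v r y"
          unfolding G_def T_def f_def using d r Fe
          by (subst airy_poly_app_mop[OF N]) (auto simp: cong comps_vecf intro!: entire_analytic)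
        finally show ?case using elim(2) by simp
      qed
    qed
    then show ?thesis unfolding vker_iff[OF cP] using fm[of d] len by (simp add: PF_def f_def cong)
  qed
  have ind: "indep n (n * kP) f"
    unfolding indep_def
  proof (intro allI impI)
    fix b d0 assume b: "\<forall>\<^sub>\<approx>x. lin_comb n (n * kP) b f x = 0\<^sub>v n" and d0: "d0 < n * kP"
    define v where "v j = (\<Sum>d<n * kP. b d * u d j)" for j
    have Fv: "F v r x = (\<Sum>d<n * kP. b d * F (u d) r x)" if r: "r < n" for r x
    proof -
      have "F v r x = (\<Sum>j\<in>I. \<Sum>d<n * kP. b d * (u d j * \<kappa> j r x))"
        by (simp add: F\<kappa>[OF r] v_def sum_distrib_right mult.assoc)
      also have "\<dots> = (\<Sum>d<n * kP. \<Sum>j\<in>I. b d * (u d j * \<kappa> j r x))" by (rule sum.swap)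
      finally show ?thesis by (simp add: F\<kappa>[OF r] sum_distrib_left)
    qed
    \<comment> \<open>\<open>psi_sum_indep\<close> separates the pairs of \<open>c\<close> and
      \<open>i\<close>, and the coefficients of a polynomial separate the exponents
      \<open>h\<close>.\<close>
    have "v j = 0" if j: "j \<in> I" for j
    proof -
      obtain c h i r where jj: "j = (c, h, i, r)" "c \<in> \<Lambda>" "h < order c p" "i < N" "r < n"
        using j by (auto simp: I_def)
      have "\<forall>\<^sub>\<approx>x. F v r x = 0"
        using b jj(5) unfolding lin_comb_0_iff by (simp add: Fv f_def comps_vecf)
      then have "psi_sum \<Lambda> (a v r) x = 0" for x
        using entire_eq_0[OF Fe] unfolding F_def by blast
      then have "a v r c i = 0" by (rule psi_sum_indep[OF fin _ jj(2,4)])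
      then have "0 = coeff (a v r c i) h" by simp
      also have "\<dots> = v j" using jj by (simp add: a_def coeff_sum)
      finally show ?thesis by simp
    qed
    then show "b d0 = 0" using u(2)[of b] d0 by (auto simp: v_def)
  qed
  show ?thesis
    by (rule that[of \<Lambda> f "\<lambda>d. a (u d)", OF fin ind fker]) (auto simp: f_def F_def[abs_def])
qed

end

lemma rational_det:
  assumes "rational_mat n W"
  shows "rational_fun (\<lambda>x. det (W x))"
  by (rule det_closed[where C = rational_fun and n = n]) (use assms in \<open>auto simp: rational_mat_def\<close>)

lemma rational_adj:
  assumes "rational_mat n W" "r < n" "c < n"
  shows "rational_fun (\<lambda>x. adj_mat (W x) $$ (r, c))"
  by (rule adj_closed[where C = rational_fun and n = n]) (use assms in \<open>auto simp: rational_mat_def\<close>)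

context airy
begin

text \<open>A maximal independent family of tuples in the kernel spans it: a tuple with a member outside the
  span could be added to the family, by \<open>psi_sum_indep\<close>.\<close>

lemma tuple_basis_exists:
  assumes P: "rational_mdo n P" and len: "length P = Suc k" and inv: "invertible_fun (last P)"
    and fin: "finite \<Lambda>" and ind: "indep n (n * k) f" and fker: "\<And>d. d < n * k \<Longrightarrow> f d \<in> vker n P"
    and fA: "\<And>d. d < n * k \<Longrightarrow> f d = vecf n (\<lambda>r. psi_sum \<Lambda> (A d r))"
  obtains m c b where "m * N = n * k"
    "mero_basis n (vker n P) (m * N) (\<lambda>j. vecf n (\<lambda>r. papp (b (j div N) r) (psi (c (j div N)) (j mod N))))"
proof -
  note mP = rational_mdo_mero[OF P] and cP = carr_mdo_rational[OF P]
  define E where "E c b j r = papp (b (j div N) r) (psi (c (j div N)) (j mod N))"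
    for c :: "nat \<Rightarrow> complex" and b :: "nat \<Rightarrow> nat \<Rightarrow> complex poly" and j r
  define el where "el c b j = vecf n (E c b j)" for c b j
  have Ee: "E c b j r holomorphic_on UNIV" for c b j r
    unfolding E_def using N by (intro papp_entire psi_entire) simp
  define fam where "fam m c b \<longleftrightarrow> (\<forall>j<m * N. el c b j \<in> vker n P) \<and> indep n (m * N) (el c b)" for m c b
  have bound: "m * N \<le> n * k" if "fam m c b" for m c b
    using indep_vker_le[OF mP len inv, of "m * N" "el c b"] that by (auto simp: fam_def)
  have "fam 0 (\<lambda>_. 0) (\<lambda>_ _. 0)" by (auto simp: fam_def indep_def)
  then have ex: "\<exists>c b. fam 0 c b" by blast
  define M where "M = {m. \<exists>c b. fam m c b}"
  have "m \<le> n * k" if "m \<in> M" for m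
  proof -
    have "m * N \<le> n * k" using that bound by (auto simp: M_def)
    moreover have "m \<le> m * N" using N by simp
    ultimately show ?thesis by linarith
  qed
  then have finM: "finite M" by (meson finite_nat_set_iff_bounded_le)
  define m where "m = Max M"
  have "m \<in> M" unfolding m_def using finM ex by (intro Max_in) (auto simp: M_def)
  then have "\<exists>c b. fam m c b" by (simp add: M_def)
  have mx: "m' \<le> m" if "fam m' c b" for m' c b
    unfolding m_def using finM that by (intro Max_ge) (auto simp: M_def)
  from \<open>\<exists>c b. fam m c b\<close> obtain c b where fam: "fam m c b" by blast
  define sp where "sp G \<longleftrightarrow> (\<exists>a. \<forall>r<n. \<forall>x. G r x = (\<Sum>j<m * N. a j * E c b j r x))" for G :: "nat \<Rightarrow> complex \<Rightarrow> complex"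
  have sp_sum: "sp (\<lambda>r x. \<Sum>s\<in>S. G s r x)" if "finite S" "\<And>s. s \<in> S \<Longrightarrow> sp (G s)" for S and G :: "'i \<Rightarrow> nat \<Rightarrow> complex \<Rightarrow> complex"
    using that
  proof (induction S rule: finite_induct)
    case empty
    show ?case unfolding sp_def by (intro exI[of _ "\<lambda>_. 0"]) auto
  next
    case (insert s S)
    obtain a1 where a1: "\<forall>r<n. \<forall>x. G s r x = (\<Sum>j<m * N. a1 j * E c b j r x)"
      using insert.prems[of s] unfolding sp_def by blast
    obtain a2 where a2: "\<forall>r<n. \<forall>x. (\<Sum>s\<in>S. G s r x) = (\<Sum>j<m * N. a2 j * E c b j r x)"
      using insert by (auto simp: sp_def)
    show ?case unfolding sp_def
      by (intro exI[of _ "\<lambda>j. a1 j + a2 j"]) (use insert a1 a2 in \<open>simp add: distrib_right sum.distrib\<close>)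
  qed
  have reidx: "(\<Sum>j<m * N. g j * E c b j r x) = (\<Sum>t<m. \<Sum>i<N. g (t * N + i) * papp (b t r) (psi (c t) i) x)" for m g c b r x
    using sum_div_mod[of "\<lambda>t i. g (t * N + i) * papp (b t r) (psi (c t) i) x" N m]
    by (simp add: E_def)
  have comp: "sp (\<lambda>r. papp (A d r c0 i0) (psi c0 i0))" if d: "d < n * k" and c0: "c0 \<in> \<Lambda>" and i0: "i0 < N" for d c0 i0
  proof (rule ccontr)
    assume nsp: "\<not> sp (\<lambda>r. papp (A d r c0 i0) (psi c0 i0))"
    define \<beta> where "\<beta> r = A d r c0 i0" for r
    define c' where "c' = c(m := c0)"
    define b' where "b' = b(m := \<beta>)"
    have E': "E c' b' j r = E c b j r" if "j < m * N" for j r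
    proof -
      have "j div N < m" using that by (simp add: less_mult_imp_div_less)
      then show ?thesis by (simp add: E_def c'_def b'_def)
    qed
    have jdiv: "j < m * N \<or> (\<exists>i<N. j = m * N + i)" if "j < Suc m * N" for j
    proof (cases "j < m * N")
      case False
      then have "j = m * N + (j - m * N)" "j - m * N < N" using that by auto
      then show ?thesis by blast
    qed simp
    have "fam (Suc m) c' b'"
      unfolding fam_def
    proof (intro conjI allI impI)
      fix j assume j: "j < Suc m * N"
      show "el c' b' j \<in> vker n P"
      proof (cases "j < m * N")
        case True
        then have "el c' b' j = el c b j" by (simp add: el_def E' cong: vecf_def) (auto simp: vecf_def E')
        then show ?thesis using fam True by (simp add: fam_def)
      next
        case False
        then obtain i where i: "i < N" "j = m * N + i" using jdiv[OF j] by auto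
        have "vecf n (\<lambda>r. papp (A d r c0 i0) (psi c0 i)) \<in> vker n P"
          using component_in_vker[OF P fin _ c0 i0 i(1), of "A d"] fker[OF d] fA[OF d] by simp
        moreover have "el c' b' j = vecf n (\<lambda>r. papp (A d r c0 i0) (psi c0 i))"
          using i by (simp add: el_def E_def[abs_def] c'_def b'_def \<beta>_def)
        ultimately show ?thesis by simp
      qed
    next
      show "indep n (Suc m * N) (el c' b')"
        unfolding indep_def
      proof (intro allI impI)
        fix g j assume g: "\<forall>\<^sub>\<approx>x. lin_comb n (Suc m * N) g (el c' b') x = 0\<^sub>v n" and j: "j < Suc m * N"
        have g0: "(\<Sum>j<Suc m * N. g j * E c' b' j r x) = 0" if r: "r < n" for r x
        proof (rule entire_eq_0[of "\<lambda>x. \<Sum>j<Suc m * N. g j * E c' b' j r x"])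
          show "(\<lambda>x. \<Sum>j<Suc m * N. g j * E c' b' j r x) holomorphic_on UNIV"
            using Ee by (intro holomorphic_intros)
          show "\<forall>\<^sub>\<approx>x. (\<Sum>j<Suc m * N. g j * E c' b' j r x) = 0"
            using g r unfolding lin_comb_0_iff by (simp add: el_def comps_vecf)
        qed
        \<comment> \<open>Different tuples may share an eigenvalue, so independence yields, for each
          \<open>i\<close>, one relation among all symbols belonging to \<open>c0\<close>.\<close>
        have rel: "(\<Sum>t<Suc m. if c' t = c0 then smult (g (t * N + i)) (b' t r) else 0) = 0"
          if r: "r < n" and i: "i < N" for r i
        proof (rule psi_sum_indep[of "c' ` {..<Suc m}" "\<lambda>cc i. \<Sum>t<Suc m. if c' t = cc then smult (g (t * N + i)) (b' t r) else 0" c0 i])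
          let ?C = "c' ` {..<Suc m}"
          let ?S = "\<lambda>cc i. \<Sum>t<Suc m. if c' t = cc then smult (g (t * N + i)) (b' t r) else 0"
          show "c0 \<in> ?C" by (auto simp: c'_def intro!: image_eqI[of _ _ m])
          show "i < N" by fact
          fix x
          let ?u = "\<lambda>t i. g (t * N + i) * papp (b' t r) (psi (c' t) i) x"
          have "psi_sum (?C) ?S x =
             (\<Sum>cc\<in>?C. \<Sum>i<N. \<Sum>t<Suc m. if cc = c' t then ?u t i else 0)"
            unfolding psi_sum_def papp_sum by (intro sum.cong refl) (auto simp: papp_smult)
          also have "\<dots> = (\<Sum>cc\<in>?C. \<Sum>t<Suc m. \<Sum>i<N. if cc = c' t then ?u t i else 0)"
            by (rule sum.cong[OF refl], rule sum.swap)
          also have "\<dots> = (\<Sum>t<Suc m. \<Sum>cc\<in>?C. \<Sum>i<N. if cc = c' t then ?u t i else 0)"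
            by (rule sum.swap)
          also have "\<dots> = (\<Sum>t<Suc m. \<Sum>i<N. ?u t i)"
          proof (rule sum.cong[OF refl])
            fix t assume t: "t \<in> {..<Suc m}"
            have "(\<Sum>cc\<in>?C. \<Sum>i<N. if cc = c' t then ?u t i else 0) =
               (\<Sum>cc\<in>?C. if cc = c' t then \<Sum>i<N. ?u t i else 0)"
              by (rule sum.cong) auto
            then show "(\<Sum>cc\<in>?C. \<Sum>i<N. if cc = c' t then ?u t i else 0) =
               (\<Sum>i<N. ?u t i)"
              using t by (simp add: sum.delta')
          qed
          also have "\<dots> = 0" using g0[OF r, of x] unfolding reidx .
          finally show "psi_sum (?C) ?S x = 0" .
        qed auto
        have top: "g (m * N + i) = 0" if i: "i < N" for i
        proof (rule ccontr)
          let ?g = "g (m * N + i)"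
          assume nz: "?g \<noteq> 0"
          \<comment> \<open>Solving the relation for the new symbol expresses it through old ones at
            \<open>c0\<close>. As a relation between symbols it may be applied to
            \<open>psi c0 i0\<close>, although it came from the index \<open>i\<close>.\<close>
          define \<gamma> where "\<gamma> t = (if c t = c0 then - g (t * N + i) / ?g else 0)" for t
          have "papp (\<beta> r) (psi c0 i0) x = (\<Sum>j<m * N. (if j mod N = i0 then \<gamma> (j div N) else 0) * E c b j r x)"
            if r: "r < n" for r x
          proof -
            have "0 = papp (\<Sum>t<Suc m. if c' t = c0 then smult (g (t * N + i)) (b' t r) else 0) (psi c0 i0) x"
              using rel[OF r i] by simp
            also have "\<dots> = (\<Sum>t<m. if c t = c0 then g (t * N + i) * papp (b t r) (psi (c t) i0) x else 0) + ?g * papp (\<beta> r) (psi c0 i0) x"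
              by (auto simp: papp_add papp_sum papp_smult c'_def b'_def intro!: sum.cong)
            finally have "papp (\<beta> r) (psi c0 i0) x = - (\<Sum>t<m. if c t = c0 then g (t * N + i) * papp (b t r) (psi (c t) i0) x else 0) / ?g"
              using nz by (simp add: field_simps add_eq_0_iff)
            also have "\<dots> = (\<Sum>t<m. \<gamma> t * papp (b t r) (psi (c t) i0) x)"
              unfolding sum_negf[symmetric] sum_divide_distrib by (intro sum.cong) (auto simp: \<gamma>_def)
            also have "\<dots> = (\<Sum>t<m. \<Sum>i<N. if i = i0 then \<gamma> t * papp (b t r) (psi (c t) i) x else 0)"
              using i0 by simp
            also have "\<dots> = (\<Sum>j<m * N. (if j mod N = i0 then \<gamma> (j div N) else 0) * E c b j r x)"
              unfolding reidx by (intro sum.cong) auto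
            finally show ?thesis .
          qed
          then have "sp (\<lambda>r. papp (\<beta> r) (psi c0 i0))" unfolding sp_def
            by (intro exI[of _ "\<lambda>j. if j mod N = i0 then \<gamma> (j div N) else 0"]) blast
          then show False using nsp by (simp add: \<beta>_def)
        qed
        have "\<forall>\<^sub>\<approx>x. lin_comb n (m * N) g (el c b) x = 0\<^sub>v n"
          unfolding lin_comb_0_iff
        proof (intro allI impI)
          fix r assume r: "r < n"
          have "(\<Sum>j<m * N. g j * comps (el c b j) r x) = 0" for x
          proof -
            have "0 = (\<Sum>j<m * N + N. g j * E c' b' j r x)"
              using g0[OF r, of x] by (simp add: add.commute)
            also have "\<dots> = (\<Sum>j<m * N. g j * E c' b' j r x)"
              unfolding sum_lessThan_add using top by simp
            also have "\<dots> = (\<Sum>j<m * N. g j * comps (el c b j) r x)"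
              using r E' by (intro sum.cong) (auto simp: el_def comps_vecf)
            finally show ?thesis by simp
          qed
          then show "\<forall>\<^sub>\<approx>x. (\<Sum>j<m * N. g j * comps (el c b j) r x) = 0" by simp
        qed
        then have "\<forall>j<m * N. g j = 0" using fam unfolding fam_def indep_def by blast
        then show "g j = 0" using top jdiv[OF j] by auto
      qed
    qed
    then have "Suc m \<le> m" using mx by blast
    then show False by simp
  qed
  have fsp: "\<exists>a. \<forall>\<^sub>\<approx>x. f d x = lin_comb n (m * N) a (el c b) x" if d: "d < n * k" for d
  proof -
    have "sp (\<lambda>r x. \<Sum>cc\<in>\<Lambda>. \<Sum>i<N. papp (A d r cc i) (psi cc i) x)"
      using fin comp[OF d] by (intro sp_sum) auto
    then obtain a where a: "\<And>r x. r < n \<Longrightarrow> psi_sum \<Lambda> (A d r) x = (\<Sum>j<m * N. a j * E c b j r x)"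
      by (auto simp: sp_def psi_sum_def)
    have "f d x = lin_comb n (m * N) a (el c b) x" for x
      unfolding fA[OF d] by (rule eq_vecI) (auto simp: vecf_def lin_comb_def a el_def)
    then have "\<forall>\<^sub>\<approx>x. f d x = lin_comb n (m * N) a (el c b) x" by simp
    then show ?thesis by blast
  qed
  \<comment> \<open>The \<open>n * k\<close> independent functions \<open>f d\<close> lie in the
    span of the tuples, and \<open>bound\<close> gives the opposite inequality.\<close>
  have dim: "m * N = n * k"
    using indep_le_span[OF ind fsp] bound[OF fam] by simp
  have "mero_basis n (vker n P) (m * N) (el c b)"
  proof (rule mero_basisI[OF cP])
    show "el c b j \<in> vker n P" if "j < m * N" for j using fam that by (simp add: fam_def)
    show ib: "indep n (m * N) (el c b)" using fam by (simp add: fam_def)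
    show "\<exists>a. \<forall>\<^sub>\<approx>x. g x = lin_comb n (m * N) a (el c b) x" if "g \<in> vker n P" for g
      using vker_span[OF mP len inv, of "el c b" g] fam that unfolding fam_def dim by blast
  qed
  then show ?thesis using that[OF dim, of b c] by (simp add: el_def[abs_def] E_def[abs_def])
qed

lemma mdo_app_mat_mult:
  assumes W: "W \<in> carrier_mat n n"
    and "\<And>f. mdo_app n P f x = W *\<^sub>v mdo_app n P' f x"
  shows "mdo_app_mat n P F x = W * mdo_app_mat n P' F x"
  by (rule eq_matI) (use W in \<open>auto simp: mdo_app_mat_def assms(2) scalar_prod_def intro!: sum.cong\<close>)

text \<open>Dividing P from the left by its leading coefficient gives a monic operator with the same
  kernel, and that coefficient is the factor \<open>W\<close> of the theorem.\<close>

lemma darboux_imp_form: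
  assumes n: "n > 0" and bd: "bispectral_darboux n N \<alpha> \<psi> \<Phi>"
  shows "airy_darboux_form n N \<psi>s \<psi> \<Phi>"
proof -
  obtain q L Q P where q: "q \<in> carrier_mat n n" and Q: "rational_mdo n Q" and P: "rational_mdo n P"
    and inv: "invertible_fun (last Q)" "invertible_fun (last P)"
    and fc: "airy_factorization n N \<alpha> q L Q P"
    and \<Phi>: "\<forall>\<^sub>\<approx>x. \<forall>z. \<Phi> x z = mdo_app_mat n P (\<lambda>y. Psi_Airy n \<psi> y z) x"
    using bd unfolding bispectral_darboux_def by blast
  note mP = rational_mdo_mero[OF P] and cP = carr_mdo_rational[OF P]
  obtain kP kQ where len: "length Q = Suc kQ" "length P = Suc kP"
    using Q P unfolding rational_mdo_def by (metis length_greater_0_conv gr0_implies_Suc)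
  have fact: "\<forall>\<^sub>\<approx>x. airy_poly_app n N \<alpha> q f x = mdo_app n Q (mdo_app n P f) x" if f: "mero_vec n f" for f
  proof -
    have "\<forall>\<^sub>\<approx>x. mdo_app n L f x = airy_poly_app n N \<alpha> q f x" "\<forall>\<^sub>\<approx>x. mdo_app n L f x = mdo_app n Q (mdo_app n P f) x"
      using fc f unfolding airy_factorization_def by auto
    then show ?thesis by eventually_elim simp
  qed
  obtain \<Lambda> f A where fam: "finite \<Lambda>" "indep n (n * kP) f" "\<And>d. d < n * kP \<Longrightarrow> f d \<in> vker n P"
    "\<And>d. d < n * kP \<Longrightarrow> f d = vecf n (\<lambda>r. psi_sum \<Lambda> (A d r))"
    using kernel_family_exists[OF n q Q P inv len fact] by metis
  obtain m c b where m: "m * N = n * kP"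
    and mb: "mero_basis n (vker n P) (m * N) (\<lambda>j. vecf n (\<lambda>r. papp (b (j div N) r) (psi (c (j div N)) (j mod N))))"
    by (rule tuple_basis_exists[OF P len(2) inv(2) fam])
  define W where "W = last P"
  have Wr: "rational_mat n W" using P by (auto simp: rational_mdo_def W_def)
  then have Wc: "W x \<in> carrier_mat n n" for x by (auto simp: rational_mat_def)
  have Wm: "mero_mat n W" using mP by (auto simp: mero_mdo_def W_def)
  \<comment> \<open>The inverse of \<open>W\<close> by the adjugate, rational in \<open>x\<close>.
    On the zeros of det W, a discrete set, division by zero makes it 0.\<close>
  define V where "V r e x = adj_mat (W x) $$ (r, e) / det (W x)" for r e x
  define A' where "A' r c i x = (\<Sum>e<n. V r e x * cf n P e c i x)" for r c i x
  define P' where "P' = mdo_of n (Suc kP) A'"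
  have Vr: "rational_fun (V r e)" if "r < n" "e < n" for r e
  proof -
    have "rational_fun (\<lambda>x. adj_mat (W x) $$ (r, e))" "rational_fun (\<lambda>x. det (W x))"
      using rational_adj[OF Wr that] rational_det[OF Wr] by auto
    then show ?thesis unfolding V_def by (rule rational_divide)
  qed
  have P'r: "rational_mdo n P'" unfolding P'_def
    by (rule rational_mdo_of, unfold A'_def[abs_def])
      (auto intro!: rational_sum rational_mult Vr cf_rational P)
  note mP' = rational_mdo_mero[OF P'r] and cP' = carr_mdo_rational[OF P'r]
  have detW: "\<forall>\<^sub>\<approx>x. det (W x) \<noteq> 0"
    using invertible_cosparse[OF Wm] inv by (simp add: W_def)
  have app': "mdo_app n P f x = W x *\<^sub>v mdo_app n P' f x" if dW: "det (W x) \<noteq> 0" for f x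
  proof -
    let ?y = "mdo_app n P f x"
    have e: "mdo_app n P' f x $ s = (\<Sum>e<n. V s e x * ?y $ e)" if "s < n" for s
      using mdo_app_eq_mop[OF cP, of _ f x] len
      by (simp add: P'_def mdo_app_of[OF that] A'_def[abs_def] mop_left)
    show ?thesis
    proof (rule eq_vecI)
      fix r assume "r < dim_vec (W x *\<^sub>v mdo_app n P' f x)"
      then have r: "r < n" using Wc[of x] by simp
      have "(W x *\<^sub>v mdo_app n P' f x) $ r = (\<Sum>s<n. W x $$ (r, s) * (\<Sum>e<n. V s e x * ?y $ e))"
        using Wc[of x] r by (auto simp: scalar_prod_def atLeast0LessThan e intro!: sum.cong)
      also have "\<dots> = (\<Sum>s<n. \<Sum>e<n. W x $$ (r, s) * V s e x * ?y $ e)"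
        by (simp add: sum_distrib_left mult.assoc)
      also have "\<dots> = (\<Sum>e<n. \<Sum>s<n. W x $$ (r, s) * V s e x * ?y $ e)" by (rule sum.swap)
      also have "\<dots> = (\<Sum>e<n. (W x * adj_mat (W x)) $$ (r, e) / det (W x) * ?y $ e)"
        using Wc[of x] adj_mat(1)[OF Wc[of x]] r
        by (intro sum.cong) (auto simp: V_def scalar_prod_def atLeast0LessThan sum_distrib_right sum_divide_distrib)
      also have "\<dots> = (\<Sum>e<n. if e = r then ?y $ e else 0)"
        unfolding adj_mat(2)[OF Wc] using r dW by (intro sum.cong) auto
      finally show "?y $ r = (W x *\<^sub>v mdo_app n P' f x) $ r" using r by simp
    qed (use Wc[of x] in simp)
  qed
  have monic: "\<forall>\<^sub>\<approx>x. last P' x = 1\<^sub>m n" using detW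
  proof eventually_elim
    case (elim x)
    show ?case
    proof (rule eq_matI)
      fix r c assume "r < dim_row (1\<^sub>m n)" "c < dim_col (1\<^sub>m n)"
      then have rc: "r < n" "c < n" by auto
      have Wcf: "cf n P e c kP x = W x $$ (e, c)" if "e < n" for e
        unfolding W_def cf_top[OF cP, symmetric] using that rc len by simp
      have "last P' x $$ (r, c) = (\<Sum>e<n. V r e x * W x $$ (e, c))"
        using rc by (simp add: P'_def last_mdo_of A'_def Wcf)
      also have "\<dots> = (adj_mat (W x) * W x) $$ (r, c) / det (W x)"
        using Wc[of x] adj_mat(1)[OF Wc[of x]] rc
        by (auto simp: V_def scalar_prod_def atLeast0LessThan sum_divide_distrib intro!: sum.cong)
      also have "\<dots> = 1\<^sub>m n $$ (r, c)" unfolding adj_mat(3)[OF Wc] using rc elim by auto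
      finally show "last P' x $$ (r, c) = 1\<^sub>m n $$ (r, c)" .
    qed (auto simp: P'_def last_mdo_of)
  qed
  have vk: "vker n P' = vker n P"
  proof -
    have "(\<forall>\<^sub>\<approx>x. mdo_app n P' f x = 0\<^sub>v n) \<longleftrightarrow> (\<forall>\<^sub>\<approx>x. mdo_app n P f x = 0\<^sub>v n)" for f
    proof
      assume "\<forall>\<^sub>\<approx>x. mdo_app n P' f x = 0\<^sub>v n"
      then show "\<forall>\<^sub>\<approx>x. mdo_app n P f x = 0\<^sub>v n" using detW
      proof eventually_elim
        case (elim x)
        have "W x *\<^sub>v 0\<^sub>v n = 0\<^sub>v n" using Wc[of x] by (intro eq_vecI) auto
        then show ?case using app'[of x f] elim by simp
      qed
    next
      assume "\<forall>\<^sub>\<approx>x. mdo_app n P f x = 0\<^sub>v n"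
      then show "\<forall>\<^sub>\<approx>x. mdo_app n P' f x = 0\<^sub>v n" using detW
      proof eventually_elim
        case (elim x)
        then have "W x *\<^sub>v mdo_app n P' f x = 0\<^sub>v n" using app'[of x f] by simp
        then show ?case using det_0_iff_vec_prod_zero[OF Wc] elim(2) dim_mdo_app(2) by blast
      qed
    qed
    then show ?thesis unfolding vker_def by simp
  qed
  have "airy_tuple_basis n N \<psi>s (vker n P') m"
  proof -
    have "\<exists>p. \<forall>i<N. papp (b t r) (psi (c t) i) = tup (c t) p i" for t r
      by (rule papp_eq_tup)
    then obtain pp where pp: "\<And>t r i. i < N \<Longrightarrow> papp (b t r) (psi (c t) i) = tup (c t) (pp t r) i"
      by metis
    define lam where "lam t = - c t / \<alpha> 0" for t
    define p where "p t j = Matrix.vec n (\<lambda>r. pp t r j)" for t j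
    have "airy_tuple n N \<psi>s (lam (j div N)) (p (j div N)) (j mod N) =
       vecf n (\<lambda>r. papp (b (j div N) r) (psi (c (j div N)) (j mod N)))" for j
    proof
      fix x
      have jN: "j mod N < N" using N by simp
      show "airy_tuple n N \<psi>s (lam (j div N)) (p (j div N)) (j mod N) x =
         vecf n (\<lambda>r. papp (b (j div N) r) (psi (c (j div N)) (j mod N))) x"
        by (rule eq_vecI) (auto simp: airy_tuple_def vecf_def pp[OF jN] tup_def higher_deriv_psi[OF jN] lam_def p_def)
    qed
    then show ?thesis unfolding airy_tuple_basis_def vk
      by (intro exI[of _ lam] exI[of _ p]) (use mb in \<open>auto simp: p_def\<close>)
  qed
  moreover have "nondegenerate n kP (vker n P')"
    unfolding nondegenerate_def vk
  proof (intro exI[of _ f] conjI)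
    show "mero_basis n (vker n P) (n * kP) f"
      using vker_span[OF mP len(2) inv(2) fam(3,2)] by (intro mero_basisI[OF cP fam(3,2)])
    show "invertible_fun (wronski_mat n kP f)"
      by (rule invertible_funI, rule vker_wronski[OF mP len(2) inv(2) fam(3,2)])
  qed
  moreover have ord: "mdo_order P' = kP" by (simp add: mdo_order_def P'_def)
  moreover have "\<forall>\<^sub>\<approx>x. \<forall>z. \<Phi> x z = W x * mdo_app_mat n P' (\<lambda>y. Psi_Airy n \<psi> y z) x"
    using \<Phi> detW
  proof eventually_elim
    case (elim x)
    then show ?case using mdo_app_mat_mult[OF Wc[of x] app'[OF elim(2)]] by simp
  qed
  \<comment> \<open>The rational \<open>d\<close> is the order divided by \<open>N\<close>; then n d
    is the number \<open>m\<close> of tuples because \<open>m * N = n * kP\<close>.\<close>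
  moreover have "of_nat kP = (of_nat kP / of_nat N :: rat) * of_nat N" using N by simp
  moreover have "of_nat m = of_nat n * (of_nat kP / of_nat N :: rat)"
  proof -
    have "(of_nat m * of_nat N :: rat) = of_nat n * of_nat kP" using m by (metis of_nat_mult)
    then show ?thesis using N by (simp add: field_simps)
  qed
  ultimately show ?thesis
    unfolding airy_darboux_form_def using Wr inv mP' monic
    by (intro exI[of _ W] exI[of _ P'] exI[of _ "of_nat kP / of_nat N"] exI[of _ m])
      (simp add: W_def monic_mdo_def)
qed

end

section \<open>Tuple kernels give Darboux transformations\<close>

definition rat_coeffs :: "nat \<Rightarrow> nat \<Rightarrow> (nat \<Rightarrow> nat \<Rightarrow> fun_seq) \<Rightarrow> bool" where
  "rat_coeffs n K A \<longleftrightarrow> (\<forall>r c i. rational_fun (A r c i)) \<and> (\<forall>r c i. \<not> (r < n \<and> c < n \<and> i < K) \<longrightarrow> A r c i = (\<lambda>_. 0))"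

lemma rat_coeffs_rational: "rat_coeffs n K A \<Longrightarrow> rational_fun (A r c i)"
  by (simp add: rat_coeffs_def)

lemma rat_coeffs_zero: "rat_coeffs n K A \<Longrightarrow> \<not> (r < n \<and> c < n \<and> i < K) \<Longrightarrow> A r c i = (\<lambda>_. 0)"
  by (simp add: rat_coeffs_def)

lemma rat_coeffs_analytic: "rat_coeffs n K A \<Longrightarrow> \<forall>\<^sub>\<approx>x. \<forall>r c i. A r c i analytic_on {x}"
  by (rule analytic_family_cosparse[of _ n K]) (auto simp: rat_coeffs_def intro: rational_mero)

section \<open>Linear systems and division over the rational functions\<close>

lemma row_inj:
  assumes M: "M \<in> carrier_mat K K" "det M \<noteq> (0::complex)"
    and v: "\<And>b. b < K \<Longrightarrow> (\<Sum>a<K. v a * M $$ (a, b)) = 0"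
  shows "\<forall>a<K. v a = 0"
proof (rule det_inj)
  have "mat K K (\<lambda>(r, c). M $$ (c, r)) = transpose_mat M"
    using M by (intro eq_matI) auto
  then show "det (mat K K (\<lambda>(r, c). M $$ (c, r))) \<noteq> 0"
    using det_transpose[OF M(1)] M(2) by simp
  show "\<forall>r<K. (\<Sum>c<K. M $$ (c, r) * v c) = 0" using v by (simp add: mult.commute)
qed

text \<open>\<partial>^d composed with A has the leading coefficient of A, so a multiple of it
  removes the top term of L, and induction on the excess \<open>d\<close> does the rest. The last
  conjunct will show that the quotient has an invertible leading term.\<close>

lemma division:
  assumes A: "rat_coeffs n (Suc k) A" and top: "invertible_fun (\<lambda>x. mat n n (\<lambda>(r, c). A r c k x))"
    and L: "rat_coeffs n (k + d) L"
  shows "\<exists>Q R. rat_coeffs n d Q \<and> rat_coeffs n k R \<and>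
    (\<forall>F. (\<forall>c<n. F c meromorphic_on UNIV) \<longrightarrow> (\<forall>r<n. \<forall>\<^sub>\<approx>x.
       mop n (k + d) L F r x = mop n d Q (mop n (Suc k) A F) r x + mop n k R F r x)) \<and>
    (d > 0 \<longrightarrow> (\<forall>\<^sub>\<approx>x. \<forall>r<n. \<forall>c<n. (\<Sum>e<n. Q r e (d - 1) x * A e c k x) = L r c (k + d - 1) x))"
  using L
proof (induction d arbitrary: L)
  case 0
  show ?case
    by (intro exI[of _ "\<lambda>_ _ _ _. 0"] exI[of _ L]) (use 0 in \<open>auto simp: rat_coeffs_def mop_def sop_def\<close>)
next
  case (Suc d)
  define M where "M x = mat n n (\<lambda>(r, c). A r c k x)" for x
  have Mr: "rational_mat n M" using A by (auto simp: rational_mat_def M_def rat_coeffs_rational)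
  have Mc: "M x \<in> carrier_mat n n" for x by (simp add: M_def)
  have "mero_mat n M" using Mr by (auto simp: rational_mat_def mero_mat_def intro: rational_mero)
  then have detM: "\<forall>\<^sub>\<approx>x. det (M x) \<noteq> 0"
    using invertible_cosparse top unfolding M_def by blast
  define V where "V c e x = adj_mat (M x) $$ (c, e) / det (M x)" for c e x
  define Qd where "Qd r e x = (if r < n \<and> e < n then \<Sum>c<n. L r c (k + d) x * V c e x else 0)" for r e x
  have Vr: "rational_fun (V c e)" if "c < n" "e < n" for c e
    unfolding V_def using rational_divide[OF rational_adj[OF Mr that] rational_det[OF Mr]] .
  have Qdr: "rational_fun (Qd r e)" for r e
  proof (cases "r < n \<and> e < n")
    case True
    have "rational_fun (\<lambda>x. \<Sum>c<n. L r c (k + d) x * V c e x)"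
      by (intro rational_sum rational_mult rat_coeffs_rational[OF Suc.prems] Vr) (use True in auto)
    then show ?thesis using True by (simp add: Qd_def[abs_def])
  qed (auto simp: Qd_def[abs_def])
  have Qd_top: "(\<Sum>e<n. Qd r e x * A e c k x) = L r c (k + d) x"
    if rc: "r < n" "c < n" and x: "det (M x) \<noteq> 0" for r c x
  proof -
    have "(\<Sum>e<n. Qd r e x * A e c k x) = (\<Sum>e<n. \<Sum>c'<n. L r c' (k + d) x * (V c' e x * A e c k x))"
      using rc by (simp add: Qd_def sum_distrib_right mult.assoc)
    also have "\<dots> = (\<Sum>c'<n. L r c' (k + d) x * (\<Sum>e<n. V c' e x * A e c k x))"
      by (subst sum.swap) (simp add: sum_distrib_left)
    also have "\<dots> = (\<Sum>c'<n. if c' = c then L r c (k + d) x else 0)"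
    proof (intro sum.cong refl)
      fix c' assume c': "c' \<in> {..<n}"
      have "(\<Sum>e<n. V c' e x * A e c k x) = (\<Sum>e<n. adj_mat (M x) $$ (c', e) * M x $$ (e, c)) / det (M x)"
        unfolding sum_divide_distrib using rc by (intro sum.cong) (auto simp: V_def M_def)
      also have "(\<Sum>e<n. adj_mat (M x) $$ (c', e) * M x $$ (e, c)) = (adj_mat (M x) * M x) $$ (c', c)"
        using rc c' Mc[of x] adj_mat(1)[OF Mc[of x]]
        by (auto simp: scalar_prod_def atLeast0LessThan intro!: sum.cong)
      also have "\<dots> / det (M x) = (if c' = c then 1 else 0)"
        unfolding adj_mat(3)[OF Mc] using rc c' x by auto
      finally show "L r c' (k + d) x * (\<Sum>e<n. V c' e x * A e c k x) = (if c' = c then L r c (k + d) x else 0)"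
        by auto
    qed
    finally show ?thesis using rc by simp
  qed
  define D where "D e c = (dop ^^ d) (A e c)" for e c
  have Dr: "rational_fun (D e c i)" for e c i unfolding D_def using A by (intro rational_dop rat_coeffs_rational)
  \<comment> \<open>The coefficient at \<open>k + d\<close> cancels only where \<open>M\<close> is
    invertible; it is set to zero outright so that the induction hypothesis applies.\<close>
  define L' where "L' r c i = (\<lambda>x. if r < n \<and> c < n \<and> i < k + d then L r c i x - (\<Sum>e<n. Qd r e x * D e c i x) else 0)" for r c i
  have "rat_coeffs n (k + d) L'"
    unfolding rat_coeffs_def
  proof (intro conjI allI impI)
    fix r c i
    show "rational_fun (L' r c i)"
    proof (cases "r < n \<and> c < n \<and> i < k + d")
      case True
      have "rational_fun (\<lambda>x. L r c i x + (- 1) * (\<Sum>e<n. Qd r e x * D e c i x))"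
        by (intro rational_add rational_mult rational_const rational_sum Qdr Dr rat_coeffs_rational[OF Suc.prems])
      then show ?thesis using True by (simp add: L'_def)
    qed (auto simp: L'_def)
  qed (auto simp: L'_def)
  from Suc.IH[OF this] obtain Q' R where Q': "rat_coeffs n d Q'" and R: "rat_coeffs n k R"
    and eq: "\<And>F r. (\<And>c. c < n \<Longrightarrow> F c meromorphic_on UNIV) \<Longrightarrow> r < n \<Longrightarrow> \<forall>\<^sub>\<approx>x.
       mop n (k + d) L' F r x = mop n d Q' (mop n (Suc k) A F) r x + mop n k R F r x" by blast
  define Q where "Q r e i = (if i = d then Qd r e else Q' r e i)" for r e i
  have "rat_coeffs n (Suc d) Q"
    unfolding rat_coeffs_def Q_def using Qdr Q' by (auto simp: rat_coeffs_def Qd_def[abs_def])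
  moreover have "\<forall>\<^sub>\<approx>x. mop n (k + Suc d) L F r x = mop n (Suc d) Q (mop n (Suc k) A F) r x + mop n k R F r x"
    if F: "\<forall>c<n. F c meromorphic_on UNIV" and r: "r < n" for F r
  proof -
    have an: "\<forall>\<^sub>\<approx>x. \<forall>c<n. F c analytic_on {x}"
      unfolding cosparse_all_less using F by (auto intro!: meromorphic_on_imp_analytic_cosparse)
    have "\<forall>\<^sub>\<approx>x. mop n (k + d) L' F r x = mop n d Q' (mop n (Suc k) A F) r x + mop n k R F r x"
      using F r by (intro eq) auto
    then show ?thesis using an detM rat_coeffs_analytic[OF A]
    proof eventually_elim
      case (elim x)
      have Az: "A r c i = (\<lambda>_. 0)" if "i \<ge> Suc k" for r c i using rat_coeffs_zero[OF A] that by auto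
      let ?G = "mop n (Suc k) A F"
      have hd: "(deriv ^^ d) (?G e) x = (\<Sum>c<n. \<Sum>i<Suc (k + d). D e c i x * (deriv ^^ i) (F c) x)" for e
        using higher_deriv_mop[of A x n F "Suc k" d e] elim Az by (simp add: sop_def D_def del: sum.lessThan_Suc)
      have 1: "mop n (Suc d) Q ?G r x = mop n d Q' ?G r x + (\<Sum>e<n. Qd r e x * (deriv ^^ d) (?G e) x)"
        unfolding mop_def[of n "Suc d"] mop_def[of n d Q'] sop_def sum.distrib[symmetric] by (intro sum.cong) (auto simp: Q_def)
      have "(\<Sum>e<n. Qd r e x * (deriv ^^ d) (?G e) x) =
          (\<Sum>e<n. \<Sum>c<n. \<Sum>i<Suc (k + d). Qd r e x * D e c i x * (deriv ^^ i) (F c) x)"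
        by (simp add: hd sum_distrib_left mult.assoc del: sum.lessThan_Suc)
      also have "\<dots> = (\<Sum>c<n. \<Sum>e<n. \<Sum>i<Suc (k + d). Qd r e x * D e c i x * (deriv ^^ i) (F c) x)"
        by (rule sum.swap)
      also have "\<dots> = (\<Sum>c<n. \<Sum>i<Suc (k + d). (\<Sum>e<n. Qd r e x * D e c i x) * (deriv ^^ i) (F c) x)"
        unfolding sum_distrib_right by (intro sum.cong refl sum.swap)
      finally have 2: "(\<Sum>e<n. Qd r e x * (deriv ^^ d) (?G e) x) =
        (\<Sum>c<n. \<Sum>i<Suc (k + d). (\<Sum>e<n. Qd r e x * D e c i x) * (deriv ^^ i) (F c) x)" .
      have Dtop: "D e c (k + d) = A e c k" for e c
        unfolding D_def by (rule dop_pow_top) (use Az in auto)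
      have "mop n (k + Suc d) L F r x = (\<Sum>c<n. \<Sum>i<Suc (k + d). L r c i x * (deriv ^^ i) (F c) x)"
        by (simp add: mop_def sop_def)
      also have "\<dots> = (\<Sum>c<n. \<Sum>i<Suc (k + d). (L' r c i x + (\<Sum>e<n. Qd r e x * D e c i x)) * (deriv ^^ i) (F c) x)"
      proof (intro sum.cong refl arg_cong2[of _ _ _ _ "(*)"])
        fix c i assume ci: "c \<in> {..<n}" "i \<in> {..<Suc (k + d)}"
        show "L r c i x = L' r c i x + (\<Sum>e<n. Qd r e x * D e c i x)"
        proof (cases "i < k + d")
          case False
          then have "i = k + d" using ci by auto
          then show ?thesis using Qd_top[OF r _ elim(3), of c] ci by (simp add: L'_def Dtop)
        qed (use ci r in \<open>simp add: L'_def\<close>)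
      qed
      also have "\<dots> = (\<Sum>c<n. \<Sum>i<Suc (k + d). L' r c i x * (deriv ^^ i) (F c) x) + (\<Sum>e<n. Qd r e x * (deriv ^^ d) (?G e) x)"
        unfolding 2 by (simp only: distrib_right sum.distrib)
      also have "(\<Sum>c<n. \<Sum>i<Suc (k + d). L' r c i x * (deriv ^^ i) (F c) x) = mop n (k + d) L' F r x"
        by (simp add: mop_def sop_def) (simp add: L'_def)
      finally show ?case using elim(1) 1 by simp
    qed
  qed
  moreover have "\<forall>\<^sub>\<approx>x. \<forall>r<n. \<forall>c<n. (\<Sum>e<n. Q r e d x * A e c k x) = L r c (k + d) x"
    using detM by eventually_elim (use Qd_top in \<open>auto simp: Q_def\<close>)
  ultimately show ?case using R by (intro exI[of _ Q] exI[of _ R]) auto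
qed

text \<open>Cramer's rule: if \<open>v W + S B = 0\<close> with \<open>W = R B\<close> then \<open>v = - S R\<^sup>-\<^sup>1\<close>. It will be used for the
  Wronski matrix \<open>W\<close> of a basis of tuples, in which \<open>B\<close> collects the Airy functions.\<close>

lemma mat_rows_rational:
  fixes k n :: nat
  assumes Rc: "R \<in> carrier_mat K K" and Bc: "\<And>x. B x \<in> carrier_mat K K"
    and W: "\<And>x. W x = map_mat (\<lambda>p. poly p x) R * B x"
    and det: "\<forall>\<^sub>\<approx>x. det (W x) \<noteq> (0::complex)"
  obtains D g where "D \<noteq> 0" "\<forall>\<^sub>\<approx>x. \<forall>v S. (\<forall>b<K. (\<Sum>a<K. v a * W x $$ (a, b)) + (\<Sum>a<K. poly (S a) x * B x $$ (a, b)) = 0) \<longrightarrow>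
     (\<forall>a<K. v a = poly (g S a) x / poly D x)"
proof -
  define D where "D = det R"
  define g where "g S a = - (\<Sum>b<K. S b * adj_mat R $$ (b, a))" for S :: "nat \<Rightarrow> complex poly" and a
  have hom: "det (map_mat (\<lambda>p. poly p x) R) = poly D x" for x
  proof -
    interpret comm_ring_hom "\<lambda>p. poly p x" by unfold_locales auto
    show ?thesis unfolding D_def by (rule hom_det)
  qed
  have dW: "det (W x) = poly D x * det (B x)" for x
    unfolding W hom[symmetric] by (rule det_mult) (use Rc Bc in auto)
  have "D \<noteq> 0"
  proof
    assume "D = 0"
    then have "\<forall>x. det (W x) = 0" using dW by simp
    then show False using cosparse_ex[OF det] by blast
  qed
  moreover have "\<forall>\<^sub>\<approx>x. \<forall>v S. (\<forall>b<K. (\<Sum>a<K. v a * W x $$ (a, b)) + (\<Sum>a<K. poly (S a) x * B x $$ (a, b)) = 0) \<longrightarrow>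
     (\<forall>a<K. v a = poly (g S a) x / poly D x)"
    using det
  proof eventually_elim
    case (elim x)
    then have nz: "poly D x \<noteq> 0" "det (B x) \<noteq> 0" using dW by auto
    show ?case
    proof (intro allI impI)
      fix v :: "nat \<Rightarrow> complex" and S :: "nat \<Rightarrow> complex poly" and a0
      assume h: "\<forall>b<K. (\<Sum>a<K. v a * W x $$ (a, b)) + (\<Sum>a<K. poly (S a) x * B x $$ (a, b)) = 0" and a0: "a0 < K"
      \<comment> \<open>\<open>w\<close> is the row v R + S, and the hypothesis \<open>h\<close>
        says that w B = 0, where \<open>B\<close> is invertible at \<open>x\<close>.\<close>
      define w where "w b' = (\<Sum>a<K. v a * poly (R $$ (a, b')) x) + poly (S b') x" for b'
      have "\<forall>b'<K. w b' = 0"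
      proof (rule row_inj[OF Bc nz(2)])
        fix b assume b: "b < K"
        have "(\<Sum>a<K. v a * W x $$ (a, b)) = (\<Sum>a<K. \<Sum>b'<K. v a * (poly (R $$ (a, b')) x * B x $$ (b', b)))"
        proof (intro sum.cong refl)
          fix a assume "a \<in> {..<K}"
          then have "W x $$ (a, b) = (\<Sum>b'<K. poly (R $$ (a, b')) x * B x $$ (b', b))"
            unfolding W using Rc Bc[of x] b by (auto simp: scalar_prod_def atLeast0LessThan intro!: sum.cong)
          then show "v a * W x $$ (a, b) = (\<Sum>b'<K. v a * (poly (R $$ (a, b')) x * B x $$ (b', b)))"
            by (simp add: sum_distrib_left)
        qed
        also have "\<dots> = (\<Sum>b'<K. \<Sum>a<K. v a * (poly (R $$ (a, b')) x * B x $$ (b', b)))" by (rule sum.swap)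
        also have "\<dots> = (\<Sum>b'<K. (\<Sum>a<K. v a * poly (R $$ (a, b')) x) * B x $$ (b', b))"
          by (simp add: sum_distrib_right mult.assoc)
        finally have "(\<Sum>b'<K. w b' * B x $$ (b', b)) = (\<Sum>a<K. v a * W x $$ (a, b)) + (\<Sum>a<K. poly (S a) x * B x $$ (a, b))"
          by (simp add: w_def distrib_right sum.distrib)
        then show "(\<Sum>b'<K. w b' * B x $$ (b', b)) = 0" using h b by simp
      qed
      then have S: "poly (S b') x = - (\<Sum>a<K. v a * poly (R $$ (a, b')) x)" if "b' < K" for b'
        using that by (auto simp: w_def add_eq_0_iff)
      have Radj: "(\<Sum>b'<K. poly (R $$ (a, b')) x * poly (adj_mat R $$ (b', a0)) x) = (if a = a0 then poly D x else 0)" if a: "a < K" for a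
      proof -
        have "(\<Sum>b'<K. poly (R $$ (a, b')) x * poly (adj_mat R $$ (b', a0)) x) = poly ((R * adj_mat R) $$ (a, a0)) x"
          using Rc adj_mat(1)[OF Rc] a a0 by (auto simp: scalar_prod_def atLeast0LessThan poly_sum intro!: sum.cong)
        also have "\<dots> = (if a = a0 then poly D x else 0)"
          unfolding adj_mat(2)[OF Rc] using a a0 by (auto simp: D_def)
        finally show ?thesis .
      qed
      have "poly (g S a0) x = (\<Sum>b<K. (\<Sum>a<K. v a * poly (R $$ (a, b)) x) * poly (adj_mat R $$ (b, a0)) x)"
        by (simp add: g_def poly_sum S sum_negf)
      also have "\<dots> = (\<Sum>b<K. \<Sum>a<K. v a * (poly (R $$ (a, b)) x * poly (adj_mat R $$ (b, a0)) x))"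
        by (simp add: sum_distrib_right mult.assoc)
      also have "\<dots> = (\<Sum>a<K. \<Sum>b<K. v a * (poly (R $$ (a, b)) x * poly (adj_mat R $$ (b, a0)) x))" by (rule sum.swap)
      also have "\<dots> = (\<Sum>a<K. v a * (if a = a0 then poly D x else 0))"
        by (intro sum.cong refl) (simp add: Radj flip: sum_distrib_left)
      also have "\<dots> = v a0 * poly D x" using a0 by (simp add: if_distrib cong: if_cong)
      finally show "v a0 = poly (g S a0) x / poly D x" using nz by simp
    qed
  qed
  ultimately show ?thesis using that by blast
qed

lemma cosparse_nhds:
  assumes "\<forall>\<^sub>\<approx>x. P x"
  shows "\<forall>\<^sub>\<approx>x. eventually P (nhds (x::complex))"
  using assms by eventually_elim (use cosparse_at[OF assms] in \<open>simp add: eventually_nhds_conv_at\<close>)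

lemma mop_zero_near:
  assumes "\<And>c. c < n \<Longrightarrow> eventually (\<lambda>y. G c y = 0) (nhds x)"
  shows "mop n K A G r x = 0"
  unfolding mop_def sop_def
proof (intro sum.neutral ballI)
  fix c i assume "c \<in> {..<n}"
  then have "(deriv ^^ i) (G c) x = (deriv ^^ i) (\<lambda>_. 0) x"
    using assms by (intro higher_deriv_cong_ev) auto
  then show "A r c i x * (deriv ^^ i) (G c) x = 0" by simp
qed

lemma monic_invertible:
  assumes "monic_mdo n P"
  shows "invertible_fun (last P)"
proof (rule invertible_funI)
  have "\<forall>\<^sub>\<approx>x. last P x = 1\<^sub>m n" using assms by (simp add: monic_mdo_def)
  then show "\<forall>\<^sub>\<approx>x. det (last P x) \<noteq> 0" by eventually_elim simp
qed

context airy
begin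

lemma tup_entire: "i < N \<Longrightarrow> tup c p i holomorphic_on UNIV"
  using tup_eq_papp[of c p] papp_entire[OF psi_entire] by metis

text \<open>On the basis elements, P f = 0 says that each row of lower coefficients times the
  Wronski matrix equals minus a row of \<open>k\<close>-th derivatives, P being monic. The rational
  solution agrees with the coefficients of P only off a discrete set, hence the separate family
  \<open>A\<close>.\<close>

lemma tuple_kernel_rational:
  assumes n: "n > 0" and P: "mero_mdo n P" "length P = Suc k" "monic_mdo n P" and mN: "m * N = n * k"
    and el: "\<And>b. el b = vecf n (\<lambda>r. tup (c (b div N)) (pp (b div N) r) (b mod N))"
    and ker: "\<And>b. b < n * k \<Longrightarrow> el b \<in> vker n P" and ind: "indep n (n * k) el"
  obtains A where "rat_coeffs n (Suc k) A" "\<forall>r<n. \<forall>c<n. \<forall>x. A r c k x = (if r = c then 1 else 0)"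
    "\<forall>\<^sub>\<approx>x. \<forall>r<n. \<forall>c<n. \<forall>i<Suc k. A r c i x = cf n P r c i x"
proof -
  let ?K = "n * k"
  note cP = carr_mdo_mero[OF P(1)] and inv = monic_invertible[OF P(3)]
  have modN: "b mod N < N" for b using N by simp
  have cel: "comps (el b) r = tup (c (b div N)) (pp (b div N) r) (b mod N)" if "r < n" for b r
    using that by (simp add: el comps_vecf)
  \<comment> \<open>The factors of the Wronski matrix: \<open>B\<close> is block diagonal, block
    \<open>t\<close> being the scalar Wronski matrix of the functions \<open>psi (c t) i\<close>,
    and \<open>R\<close> holds the polynomials in front of them.\<close>
  define R where "R = mat ?K ?K (\<lambda>(a, b). ((Dt (c (b div N)) ^^ (a div n)) (pp (b div N) (a mod n))) (b mod N))"
  define B where "B x = mat ?K ?K (\<lambda>(a, b). if a div N = b div N then (deriv ^^ (a mod N)) (psi (c (b div N)) (b mod N)) x else 0)" for x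
  have expand: "tup (c (b div N)) (s (b div N)) (b mod N) x = (\<Sum>a<?K. poly (s (a div N) (a mod N)) x * B x $$ (a, b))"
    if b: "b < ?K" for b s x
  proof -
    have "(\<Sum>a<?K. poly (s (a div N) (a mod N)) x * B x $$ (a, b)) =
        (\<Sum>a<m * N. poly (s (a div N) (a mod N)) x * (if a div N = b div N then (deriv ^^ (a mod N)) (psi (c (b div N)) (b mod N)) x else 0))"
      using b mN by (intro sum.cong) (auto simp: B_def)
    also have "\<dots> = (\<Sum>t<m. \<Sum>j<N. poly (s t j) x * (if t = b div N then (deriv ^^ j) (psi (c (b div N)) (b mod N)) x else 0))"
      by (rule sum_div_mod)
    also have "\<dots> = (\<Sum>t<m. if t = b div N then \<Sum>j<N. poly (s t j) x * (deriv ^^ j) (psi (c (b div N)) (b mod N)) x else 0)"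
      by (intro sum.cong) auto
    also have "\<dots> = (\<Sum>j<N. poly (s (b div N) j) x * (deriv ^^ j) (psi (c (b div N)) (b mod N)) x)"
    proof -
      have "b div N < m" using b mN by (simp add: less_mult_imp_div_less)
      then show ?thesis by simp
    qed
    finally show ?thesis by (simp add: tup_def mult.commute)
  qed
  have hd: "(deriv ^^ l) (comps (el b) r) x = (\<Sum>a<?K. poly (((Dt (c (a div N)) ^^ l) (pp (a div N) r)) (a mod N)) x * B x $$ (a, b))"
    if "b < ?K" "r < n" for l b r x
    using expand[OF that(1), of "\<lambda>t. (Dt (c t) ^^ l) (pp t r)" x] that modN
    by (simp add: cel higher_deriv_tup)
  have Wr: "wronski_mat n k el x = map_mat (\<lambda>p. poly p x) R * B x" for x
  proof (rule eq_matI)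
    fix a b assume "a < dim_row (map_mat (\<lambda>p. poly p x) R * B x)" "b < dim_col (map_mat (\<lambda>p. poly p x) R * B x)"
    then have ab: "a < ?K" "b < ?K" by (auto simp: R_def B_def)
    have an: "a mod n < n" using n by simp
    have "wronski_mat n k el x $$ (a, b) = (deriv ^^ (a div n)) (comps (el b) (a mod n)) x"
      using ab an by (simp add: wronski_mat_def vec_deriv_def comps_def[abs_def])
    also have "\<dots> = (\<Sum>a'<?K. poly (R $$ (a, a')) x * B x $$ (a', b))"
      unfolding hd[OF ab(2) an] using ab by (intro sum.cong) (auto simp: R_def)
    also have "\<dots> = (map_mat (\<lambda>p. poly p x) R * B x) $$ (a, b)"
      using ab by (auto simp: R_def B_def scalar_prod_def atLeast0LessThan intro!: sum.cong)
    finally show "wronski_mat n k el x $$ (a, b) = (map_mat (\<lambda>p. poly p x) R * B x) $$ (a, b)" .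
  qed (auto simp: wronski_mat_def R_def B_def)
  have detW: "\<forall>\<^sub>\<approx>x. det (wronski_mat n k el x) \<noteq> 0"
    by (rule vker_wronski[OF P(1,2) inv ker ind])
  have Rc: "R \<in> carrier_mat ?K ?K" and Bc: "B x \<in> carrier_mat ?K ?K" for x
    by (simp_all add: R_def B_def)
  obtain D g where D: "D \<noteq> 0" and g: "\<forall>\<^sub>\<approx>x. \<forall>v S. (\<forall>b<?K. (\<Sum>a<?K. v a * wronski_mat n k el x $$ (a, b)) + (\<Sum>a<?K. poly (S a) x * B x $$ (a, b)) = 0) \<longrightarrow>
     (\<forall>a<?K. v a = poly (g S a) x / poly D x)"
    by (rule mat_rows_rational[OF Rc Bc Wr detW]) blast
  \<comment> \<open>The polynomials in the \<open>k\<close>-th derivative of component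
    \<open>r\<close>, which is the contribution of the leading coefficient 1 of P.\<close>
  define S where "S r b = ((Dt (c (b div N)) ^^ k) (pp (b div N) r)) (b mod N)" for r b
  define A where "A r c' i = (\<lambda>x. if r < n \<and> c' < n \<and> i < Suc k then
      (if i = k then (if r = c' then 1 else 0) else poly (g (S r) (i * n + c')) x / poly D x) else 0)" for r c' i
  have "rat_coeffs n (Suc k) A"
    unfolding rat_coeffs_def
  proof (intro conjI allI impI)
    fix r c' i
    show "rational_fun (A r c' i)"
    proof (cases "r < n \<and> c' < n \<and> i < k")
      case True
      then show ?thesis by (auto simp: A_def intro!: rational_divide rational_poly)
    next
      case False
      then have "A r c' i = (\<lambda>_. if r < n \<and> c' < n \<and> i = k \<and> r = c' then 1 else 0)"
        by (auto simp: A_def)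
      then show ?thesis by (simp only: rational_const)
    qed
  qed (auto simp: A_def)
  moreover have "\<forall>r<n. \<forall>c'<n. \<forall>x. A r c' k x = (if r = c' then 1 else 0)"
    by (simp add: A_def)
  moreover have "\<forall>\<^sub>\<approx>x. \<forall>r<n. \<forall>c'<n. \<forall>i<Suc k. A r c' i x = cf n P r c' i x"
  proof -
    have 1: "\<forall>\<^sub>\<approx>x. last P x = 1\<^sub>m n" using P(3) by (simp add: monic_mdo_def)
    have 2: "\<forall>\<^sub>\<approx>x. \<forall>r<n. \<forall>b<?K. mop n (Suc k) (cf n P) (comps (el b)) r x = 0"
      unfolding cosparse_all_less using ker P(2) by (auto simp: vker_iff[OF cP])
    show ?thesis using 1 2 g
    proof eventually_elim
      case (elim x)
      have top: "cf n P r c' k x = (if r = c' then 1 else 0)" if "r < n" "c' < n" for r c'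
      proof -
        have "cf n P r c' k x = last P x $$ (r, c')"
          unfolding cf_top[OF cP, symmetric] using that P(2) by simp
        then show ?thesis using elim(1) that by simp
      qed
      have low: "cf n P r (a mod n) (a div n) x = poly (g (S r) a) x / poly D x" if r: "r < n" and a: "a < ?K" for r a
      proof -
        have "(\<Sum>a<?K. cf n P r (a mod n) (a div n) x * wronski_mat n k el x $$ (a, b)) + (\<Sum>a<?K. poly (S r a) x * B x $$ (a, b)) = 0"
          if b: "b < ?K" for b
        proof -
          have "0 = (\<Sum>c'<n. \<Sum>i<Suc k. cf n P r c' i x * (deriv ^^ i) (comps (el b) c') x)"
            using elim(2) r b by (simp add: mop_def sop_def del: sum.lessThan_Suc)
          also have "\<dots> = (\<Sum>c'<n. \<Sum>i<k. cf n P r c' i x * (deriv ^^ i) (comps (el b) c') x) +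
              (\<Sum>c'<n. cf n P r c' k x * (deriv ^^ k) (comps (el b) c') x)"
            by (simp add: sum.distrib)
          also have "(\<Sum>c'<n. cf n P r c' k x * (deriv ^^ k) (comps (el b) c') x) = (\<Sum>c'<n. if c' = r then (deriv ^^ k) (comps (el b) r) x else 0)"
            using r top by (intro sum.cong) auto
          also have "\<dots> = (\<Sum>a<?K. poly (S r a) x * B x $$ (a, b))"
            using r hd[OF b r] by (simp add: S_def)
          also have "(\<Sum>c'<n. \<Sum>i<k. cf n P r c' i x * (deriv ^^ i) (comps (el b) c') x) =
              (\<Sum>i<k. \<Sum>c'<n. cf n P r c' i x * (deriv ^^ i) (comps (el b) c') x)" by (rule sum.swap)
          also have "\<dots> = (\<Sum>a<k * n. cf n P r (a mod n) (a div n) x * (deriv ^^ (a div n)) (comps (el b) (a mod n)) x)"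
            by (rule sum_div_mod[symmetric])
          also have "\<dots> = (\<Sum>a<?K. cf n P r (a mod n) (a div n) x * wronski_mat n k el x $$ (a, b))"
            using b n by (intro sum.cong) (auto simp: wronski_mat_def vec_deriv_def comps_def[abs_def] mult.commute)
          finally show ?thesis by simp
        qed
        then show ?thesis using elim(3)[rule_format, of "\<lambda>a. cf n P r (a mod n) (a div n) x" "S r"] a by blast
      qed
      show ?case
      proof (intro allI impI)
        fix r c' i assume rci: "r < n" "c' < n" "i < Suc k"
        show "A r c' i x = cf n P r c' i x"
        proof (cases "i = k")
          case True
          then show ?thesis using rci top by (simp add: A_def)
        next
          case False
          then have i: "i < k" using rci by simp
          note di = div_mod_idx[OF rci(2) i]
          show ?thesis using low[OF rci(1), of "i * n + c'"] di rci False by (simp add: A_def)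
        qed
      qed
    qed
  qed
  ultimately show ?thesis using that by blast
qed

text \<open>The factors (t - c)^s, with \<open>s\<close> above all degrees, kill the symbols. The
  factor t^k only raises the degree, so that the order of q(M) is at least \<open>k\<close> and
  division by P makes sense.\<close>

lemma tuples_annihilated:
  fixes pp :: "nat \<Rightarrow> nat \<Rightarrow> nat \<Rightarrow> complex poly"
  obtains q where "lead_coeff q = 1" "degree q \<ge> k"
    "\<forall>t<m. \<forall>r<n. \<exists>a. (\<forall>i<N. tup (c t) (pp t r) i = papp a (psi (c t) i)) \<and> tact (c t) q a = 0"
proof -
  have "\<exists>a. \<forall>i<N. tup (c t) (pp t r) i = papp a (psi (c t) i)" for t r by (rule tup_eq_papp)
  then obtain a where a: "\<And>t r i. i < N \<Longrightarrow> tup (c t) (pp t r) i = papp (a t r) (psi (c t) i)" by metis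
  define s where "s = Suc (\<Sum>t<m. \<Sum>r<n. degree (a t r))"
  have s: "degree (a t r) < s" if "t < m" "r < n" for t r
  proof -
    have "degree (a t r) \<le> (\<Sum>r<n. degree (a t r))" using that by (intro member_le_sum) auto
    also have "\<dots> \<le> (\<Sum>t<m. \<Sum>r<n. degree (a t r))"
      using that by (intro member_le_sum[of t _ "\<lambda>t. \<Sum>r<n. degree (a t r)"]) auto
    finally show ?thesis by (simp add: s_def)
  qed
  define q where "q = (\<Prod>t<m. [:- c t, 1:] ^ s) * monom 1 k"
  have "lead_coeff q = 1"
    by (simp add: q_def lead_coeff_mult lead_coeff_prod lead_coeff_power degree_monom_eq)
  moreover have "degree q \<ge> k"
    by (simp add: q_def degree_mult_eq degree_monom_eq)
  moreover have "tact (c t) q (a t r) = 0" if "t < m" "r < n" for t r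
  proof (rule tact_dvd_eq_0)
    show "[:- c t, 1:] ^ s dvd q" unfolding q_def
      using that by (intro dvd_mult2 dvd_prodI) auto
  qed (use s that in auto)
  ultimately show ?thesis using that[of q] a by blast
qed

text \<open>The division is by W P, with its coefficients replaced by rational ones. As q(M) is
  monic, the leading coefficient of the quotient is inverse to \<open>W\<close> almost everywhere,
  hence invertible.\<close>

lemma form_imp_darboux:
  assumes n: "n > 0" and df: "airy_darboux_form n N \<psi>s \<psi> \<Phi>"
  shows "bispectral_darboux n N \<alpha> \<psi> \<Phi>"
proof -
  obtain W P and d :: rat and m where Wr: "rational_mat n W" and Wi: "invertible_fun W"
    and P: "mero_mdo n P" "monic_mdo n P" and ord: "of_nat (mdo_order P) = d * of_nat N" "of_nat m = of_nat n * d"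
    and tb: "airy_tuple_basis n N \<psi>s (vker n P) m"
    and \<Phi>: "\<forall>\<^sub>\<approx>x. \<forall>z. \<Phi> x z = W x * mdo_app_mat n P (\<lambda>y. Psi_Airy n \<psi> y z) x"
    using df unfolding airy_darboux_form_def by blast
  define k where "k = mdo_order P"
  note cP = carr_mdo_mero[OF P(1)] and invP = monic_invertible[OF P(2)]
  have len: "length P = Suc k" using P(1) by (cases P) (auto simp: k_def mdo_order_def mero_mdo_def)
  have mN: "m * N = n * k"
  proof -
    have "(of_nat (m * N) :: rat) = of_nat (n * k)" using ord by (simp add: k_def)
    then show ?thesis using of_nat_eq_iff by blast
  qed
  obtain lam p where mb: "mero_basis n (vker n P) (m * N)
      (\<lambda>b. airy_tuple n N \<psi>s (lam (b div N)) (p (b div N)) (b mod N))"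
    using tb unfolding airy_tuple_basis_def by blast
  \<comment> \<open>The eigenvalue belonging to the shift \<open>lam t\<close>.\<close>
  define c where "c t = - \<alpha> 0 * lam t" for t
  define pp where "pp t r j = p t j $ r" for t r j
  define el where "el b = vecf n (\<lambda>r. tup (c (b div N)) (pp (b div N) r) (b mod N))" for b
  have modN: "b mod N < N" for b using N by simp
  have "airy_tuple n N \<psi>s (lam (b div N)) (p (b div N)) (b mod N) = el b" for b
  proof
    fix x
    show "airy_tuple n N \<psi>s (lam (b div N)) (p (b div N)) (b mod N) x = el b x"
      by (rule eq_vecI) (use \<alpha>0 in \<open>auto simp: airy_tuple_def el_def vecf_def tup_def higher_deriv_psi[OF modN] c_def pp_def\<close>)
  qed
  then have mb': "mero_basis n (vker n P) (n * k) el" using mb mN by simp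
  note ind = mero_basisD(1)[OF mb'] and ker = mero_basisD(2)[OF mb']
  obtain A1 where A1: "rat_coeffs n (Suc k) A1" "\<forall>r<n. \<forall>c<n. \<forall>x. A1 r c k x = (if r = c then 1 else 0)"
    "\<forall>\<^sub>\<approx>x. \<forall>r<n. \<forall>c<n. \<forall>i<Suc k. A1 r c i x = cf n P r c i x"
    by (rule tuple_kernel_rational[OF n P(1) len P(2) mN el_def ker ind])
  have Wc: "W x \<in> carrier_mat n n" for x using Wr by (simp add: rational_mat_def)
  define A2 where "A2 r c' i = (\<lambda>x. if r < n then \<Sum>e<n. W x $$ (r, e) * A1 e c' i x else 0)" for r c' i
  have A2: "rat_coeffs n (Suc k) A2"
    unfolding rat_coeffs_def
  proof (intro conjI allI impI)
    fix r c' i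
    have "rational_fun (\<lambda>x. \<Sum>e<n. W x $$ (r, e) * A1 e c' i x)" if "r < n"
      using that Wr by (intro rational_sum rational_mult rat_coeffs_rational[OF A1(1)]) (auto simp: rational_mat_def)
    then show "rational_fun (A2 r c' i)" unfolding A2_def by (cases "r < n") auto
  qed (use A1(1) in \<open>auto simp: A2_def rat_coeffs_def\<close>)
  have A2top: "A2 r c' k x = W x $$ (r, c')" if "r < n" "c' < n" for r c' x
  proof -
    have "A2 r c' k x = (\<Sum>e<n. W x $$ (r, e) * A1 e c' k x)" using that by (simp add: A2_def)
    also have "\<dots> = (\<Sum>e<n. if e = c' then W x $$ (r, e) else 0)"
      by (intro sum.cong refl) (use that A1(2) in auto)
    finally have "A2 r c' k x = (\<Sum>e<n. if e = c' then W x $$ (r, e) else 0)" .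
    then show ?thesis using that by simp
  qed
  have A2W: "(\<lambda>x. mat n n (\<lambda>(r, c). A2 r c k x)) = W"
    by (intro ext eq_matI) (auto simp: A2top carrier_matD[OF Wc])
  have mopA2: "mop n K A2 F r x = (\<Sum>e<n. W x $$ (r, e) * mop n K A1 F e x)" if "r < n" for K F r x
  proof -
    have "mop n K A2 F r x = mop n K (\<lambda>r c i x. \<Sum>e<n. W x $$ (r, e) * A1 e c i x) F r x"
      by (rule mop_cong) (use that in \<open>auto simp: A2_def\<close>)
    then show ?thesis by (simp add: mop_left)
  qed
  define P2 where "P2 = mdo_of n (Suc k) A2"
  have P2: "rational_mdo n P2" unfolding P2_def by (intro rational_mdo_of rat_coeffs_rational[OF A2])
  have lP2: "last P2 = W" using A2W by (simp add: P2_def last_mdo_of[abs_def] fun_eq_iff)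
  have app2: "\<forall>\<^sub>\<approx>x. \<forall>f. mdo_app n P2 f x = W x *\<^sub>v mdo_app n P f x"
    using A1(3)
  proof eventually_elim
    case (elim x)
    show ?case
    proof (intro allI eq_vecI)
      fix f r assume "r < dim_vec (W x *\<^sub>v mdo_app n P f x)"
      then have r: "r < n" using Wc[of x] by simp
      have "mdo_app n P2 f x $ r = (\<Sum>e<n. W x $$ (r, e) * mop n (Suc k) A1 (comps f) e x)"
        unfolding P2_def mdo_app_of[OF r] mopA2[OF r] ..
      also have "\<dots> = (\<Sum>e<n. W x $$ (r, e) * mdo_app n P f x $ e)"
      proof (intro sum.cong refl arg_cong2[of _ _ _ _ "(*)"])
        fix e assume e: "e \<in> {..<n}"
        have "mop n (Suc k) A1 (comps f) e x = mop n (Suc k) (cf n P) (comps f) e x"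
          by (rule mop_cong) (use elim e in auto)
        then show "mop n (Suc k) A1 (comps f) e x = mdo_app n P f x $ e"
          using mdo_app_eq_mop[OF cP, of e f x] e len by simp
      qed
      also have "\<dots> = (W x *\<^sub>v mdo_app n P f x) $ r"
        using r Wc[of x] by (auto simp: scalar_prod_def atLeast0LessThan intro!: sum.cong)
      finally show "mdo_app n P2 f x $ r = (W x *\<^sub>v mdo_app n P f x) $ r" .
    qed (use Wc[of x] in simp)
  qed
  obtain qq where qq: "lead_coeff qq = 1" "degree qq \<ge> k"
    and ann: "\<forall>t<m. \<forall>r<n. \<exists>a. (\<forall>i<N. tup (c t) (pp t r) i = papp a (psi (c t) i)) \<and> tact (c t) qq a = 0"
    by (rule tuples_annihilated[of k m n c pp])
  define e where "e = degree qq"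
  define q where "q = mat n n (\<lambda>(r, c). if r = c then qq else 0)"
  have dq: "degree (q $$ (r, c)) \<le> e" if "r < n" "c < n" for r c
    using that by (simp add: q_def e_def)
  define T where "T = qcoef n N \<alpha> q"
  have T: "rat_coeffs n (Suc (N * e)) T"
    unfolding rat_coeffs_def
  proof (intro conjI allI impI)
    show "rational_fun (T r c i)" for r c i unfolding T_def by (rule qcoef_rational)
    fix r c i assume "\<not> (r < n \<and> c < n \<and> i < Suc (N * e))"
    moreover have "T r c i = (\<lambda>_. 0)" if "i > N * e"
      unfolding T_def by (rule qcoef_zero[OF N _ that]) (rule dq)
    ultimately show "T r c i = (\<lambda>_. 0)"
      by (cases "r < n \<and> c < n") (auto simp: T_def qcoef_def[abs_def])
  qed
  have Ttop: "T r c (N * e) x = (if r = c then 1 else 0)" if "r < n" "c < n" for r c x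
    using qcoef_top[OF N dq that, where \<alpha> = \<alpha> and x = x] that qq(1) by (simp add: T_def q_def e_def)
  define L where "L = mdo_of n (Suc (N * e)) T"
  have Lr: "rational_mdo n L" unfolding L_def by (intro rational_mdo_of rat_coeffs_rational[OF T])
  have "last L x = 1\<^sub>m n" for x unfolding L_def last_mdo_of by (intro eq_matI) (auto simp: Ttop)
  then have Li: "invertible_fun (last L)" by (intro invertible_funI) simp
  have ke: "k \<le> N * e" using qq(2) N by (simp add: e_def) (metis le_trans mult_le_mono1 Suc_leI mult_1 One_nat_def)
  define d' where "d' = N * e - k"
  have kd: "k + Suc d' = Suc (N * e)" using ke by (simp add: d'_def)
  have cong: "mop n K A (comps (vecf n F)) r x = mop n K A F r x" for K A F r x
    by (rule mop_cong) (auto simp: comps_vecf)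
  have airyT: "airy_poly_app n N \<alpha> q f x $ r = mop n (Suc (N * e)) T (comps f) r x"
    if "\<And>c. c < n \<Longrightarrow> comps f c analytic_on {x}" "r < n" for f x r
    unfolding T_def using airy_poly_app_mop[OF N dq that] by simp
  obtain Q R where Q: "rat_coeffs n (Suc d') Q" and R: "rat_coeffs n k R"
    and QR: "\<And>F r. (\<And>c. c < n \<Longrightarrow> F c meromorphic_on UNIV) \<Longrightarrow> r < n \<Longrightarrow> \<forall>\<^sub>\<approx>x.
       mop n (Suc (N * e)) T F r x = mop n (Suc d') Q (mop n (Suc k) A2 F) r x + mop n k R F r x"
    and Qtop: "\<forall>\<^sub>\<approx>x. \<forall>r<n. \<forall>c<n. (\<Sum>e<n. Q r e d' x * A2 e c k x) = T r c (N * e) x"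
    using division[OF A2, of "Suc d'" T] Wi T kd unfolding A2W by auto
  have elm: "comps (el b) r meromorphic_on UNIV" "comps (el b) r analytic_on {x}" if "r < n" for b r x
    using that entire_mero[OF tup_entire[OF modN]] entire_analytic[OF tup_entire[OF modN]]
    by (simp_all add: el_def comps_vecf)
  have Tel: "mop n (Suc (N * e)) T (comps (el b)) r x = 0" if b: "b < n * k" and r: "r < n" for b r x
  proof -
    let ?t = "b div N" and ?i = "b mod N"
    have "?t < m" using b mN by (simp add: less_mult_imp_div_less)
    then have "\<forall>r<n. \<exists>a. (\<forall>i<N. tup (c ?t) (pp ?t r) i = papp a (psi (c ?t) i)) \<and> tact (c ?t) qq a = 0"
      using ann by blast
    then obtain a where a: "\<And>r i. r < n \<Longrightarrow> i < N \<Longrightarrow> tup (c ?t) (pp ?t r) i = papp (a r) (psi (c ?t) i)"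
      "\<And>r. r < n \<Longrightarrow> tact (c ?t) qq (a r) = 0" by metis
    \<comment> \<open>A single member of a tuple is a \<open>psi_sum\<close> whose polynomials
      vanish at all indices other than \<open>b mod N\<close>.\<close>
    define a' where "a' r cc i = (if i = ?i then a r else 0)" for r and cc :: complex and i
    have "comps (el b) r' = psi_sum {c ?t} (a' r')" if "r' < n" for r'
    proof
      fix y
      have "psi_sum {c ?t} (a' r') y = (\<Sum>i<N. papp (a' r' (c ?t) i) (psi (c ?t) i) y)"
        by (simp add: psi_sum_def)
      also have "\<dots> = (\<Sum>i<N. if i = ?i then papp (a r') (psi (c ?t) i) y else 0)"
        by (intro sum.cong refl) (simp add: a'_def)
      finally show "comps (el b) r' y = psi_sum {c ?t} (a' r') y"
        using that modN[of b] by (simp add: el_def comps_vecf a(1))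
    qed
    then have "el b = vecf n (\<lambda>r. psi_sum {c ?t} (a' r))"
      unfolding el_def by (auto simp: vecf_def fun_eq_iff comps_def intro!: eq_vecI)
    then have "airy_poly_app n N \<alpha> q (el b) x $ r = psi_sum {c ?t} (\<lambda>cc i. \<Sum>c'<n. tact cc (q $$ (r, c')) (a' c' cc i)) x"
      using airy_poly_app_psi_sum[OF r] by simp
    also have "\<dots> = 0"
    proof -
      have "tact (c ?t) (q $$ (r, c')) (a' c' (c ?t) i) = 0" if "c' < n" for c' i
        using that r a(2)[OF that] by (simp add: q_def a'_def)
      then show ?thesis by (simp add: psi_sum_def)
    qed
    finally show ?thesis using airyT[of "el b" x r] elm r by simp
  qed
  \<comment> \<open>The quotient differentiates W P f, so its vanishing is needed on neighbourhoods
    and not just at points.\<close>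
  have A2el: "\<forall>\<^sub>\<approx>x. \<forall>b<n * k. \<forall>r<n. eventually (\<lambda>y. mop n (Suc k) A2 (comps (el b)) r y = 0) (nhds x)"
    unfolding cosparse_all_less
  proof (intro allI impI cosparse_nhds)
    fix b r assume b: "b < n * k" and r: "r < n"
    have "\<forall>\<^sub>\<approx>x. mdo_app n P (el b) x = 0\<^sub>v n" using ker[OF b] by (simp add: vker_def)
    then show "\<forall>\<^sub>\<approx>x. mop n (Suc k) A2 (comps (el b)) r x = 0" using app2
    proof eventually_elim
      case (elim x)
      have "mop n (Suc k) A2 (comps (el b)) r x = (W x *\<^sub>v 0\<^sub>v n) $ r"
        using elim mdo_app_of[OF r, of k A2 "el b" x] by (simp add: P2_def)
      then show ?case using r Wc[of x] by simp
    qed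
  qed
  have R0: "\<forall>\<^sub>\<approx>x. \<forall>r<n. \<forall>c<n. \<forall>i<k. R r c i x = 0"
  proof -
    have 1: "\<forall>\<^sub>\<approx>x. \<forall>b<n * k. \<forall>r<n. mop n (Suc (N * e)) T (comps (el b)) r x =
        mop n (Suc d') Q (mop n (Suc k) A2 (comps (el b))) r x + mop n k R (comps (el b)) r x"
      unfolding cosparse_all_less using elm by (intro allI impI QR) auto
    have 2: "\<forall>\<^sub>\<approx>x. det (wronski_mat n k el x) \<noteq> 0"
      by (rule vker_wronski[OF P(1) len invP ker ind])
    show ?thesis using 1 2 A2el
    proof eventually_elim
      case (elim x)
      have rel: "mop n k R (comps (el b)) r x = 0" if "b < n * k" "r < n" for b r
      proof -
        have "mop n (Suc d') Q (mop n (Suc k) A2 (comps (el b))) r x = 0"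
          by (rule mop_zero_near) (use elim that in auto)
        moreover have "mop n (Suc d') Q (mop n (Suc k) A2 (comps (el b))) r x + mop n k R (comps (el b)) r x = 0"
          using elim(1) that Tel[OF that, of x] by simp
        ultimately show ?thesis by simp
      qed
      show ?case
      proof (intro allI impI)
        fix r c' i assume rci: "r < n" "c' < n" "i < k"
        \<comment> \<open>The remainder has order below \<open>k\<close>, so its action on the basis
          is its row of coefficients times the Wronski matrix.\<close>
        have "\<forall>a<n * k. R r (a mod n) (a div n) x = 0"
        proof (rule row_inj[OF _ elim(2)])
          show "wronski_mat n k el x \<in> carrier_mat (n * k) (n * k)" by (simp add: wronski_mat_def)
          fix b assume b: "b < n * k"
          have "0 = (\<Sum>c'<n. \<Sum>i<k. R r c' i x * (deriv ^^ i) (comps (el b) c') x)"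
            using rel[OF b rci(1)] by (simp add: mop_def sop_def)
          also have "\<dots> = (\<Sum>i<k. \<Sum>c'<n. R r c' i x * (deriv ^^ i) (comps (el b) c') x)" by (rule sum.swap)
          also have "\<dots> = (\<Sum>a<k * n. R r (a mod n) (a div n) x * (deriv ^^ (a div n)) (comps (el b) (a mod n)) x)"
            by (rule sum_div_mod[symmetric])
          also have "\<dots> = (\<Sum>a<n * k. R r (a mod n) (a div n) x * wronski_mat n k el x $$ (a, b))"
            using b n by (intro sum.cong) (auto simp: wronski_mat_def vec_deriv_def comps_def[abs_def] mult.commute)
          finally show "(\<Sum>a<n * k. R r (a mod n) (a div n) x * wronski_mat n k el x $$ (a, b)) = 0" by simp
        qed
        then show "R r c' i x = 0" using div_mod_idx[OF rci(2,3)] by metis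
      qed
    qed
  qed
  define Q1 where "Q1 = mdo_of n (Suc d') Q"
  have Q1: "rational_mdo n Q1" unfolding Q1_def by (intro rational_mdo_of rat_coeffs_rational[OF Q])
  have Q1i: "invertible_fun (last Q1)"
  proof (rule invertible_funI)
    show "\<forall>\<^sub>\<approx>x. det (last Q1 x) \<noteq> 0" using Qtop
    proof eventually_elim
      case (elim x)
      have Qc: "last Q1 x \<in> carrier_mat n n" by (simp add: Q1_def last_mdo_of)
      \<comment> \<open>By \<open>Qtop\<close> this product is the leading matrix of q(M).\<close>
      have "last Q1 x * W x = 1\<^sub>m n"
      proof (rule eq_matI)
        fix r c' assume "r < dim_row (1\<^sub>m n)" "c' < dim_col (1\<^sub>m n)"
        then have rc: "r < n" "c' < n" by auto
        have "(last Q1 x * W x) $$ (r, c') = (\<Sum>e<n. Q r e d' x * A2 e c' k x)"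
          using rc Wc[of x] by (auto simp: Q1_def last_mdo_of scalar_prod_def atLeast0LessThan A2top intro!: sum.cong)
        then show "(last Q1 x * W x) $$ (r, c') = 1\<^sub>m n $$ (r, c')"
          using elim rc Ttop by simp
      qed (use Qc Wc[of x] in auto)
      then have "det (last Q1 x) * det (W x) = 1"
        using det_mult[OF Qc Wc[of x]] by simp
      then show ?case by auto
    qed
  qed
  have "airy_factorization n N \<alpha> q L Q1 P2"
    unfolding airy_factorization_def
  proof (intro allI impI conjI)
    fix f assume f: "mero_vec n f"
    have fm: "comps f c meromorphic_on UNIV" if "c < n" for c using f that by (rule mero_vec_comps)
    have fa: "\<forall>\<^sub>\<approx>x. \<forall>c<n. comps f c analytic_on {x}"
      unfolding cosparse_all_less using fm by (auto intro: meromorphic_on_imp_analytic_cosparse)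
    show "\<forall>\<^sub>\<approx>x. mdo_app n L f x = airy_poly_app n N \<alpha> q f x" using fa
    proof eventually_elim
      case (elim x)
      show ?case
        by (rule eq_vecI) (use elim airyT in \<open>auto simp: airy_poly_app_def[of n N \<alpha> q f x] L_def mdo_app_of simp flip: airyT\<close>)
    qed
    have "\<forall>\<^sub>\<approx>x. \<forall>r<n. mop n (Suc (N * e)) T (comps f) r x =
        mop n (Suc d') Q (mop n (Suc k) A2 (comps f)) r x + mop n k R (comps f) r x"
      unfolding cosparse_all_less using fm by (intro allI impI QR) auto
    then show "\<forall>\<^sub>\<approx>x. mdo_app n L f x = mdo_app n Q1 (mdo_app n P2 f) x" using R0
    proof eventually_elim
      case (elim x)
      show ?case
      proof (rule eq_vecI)
        fix r assume "r < dim_vec (mdo_app n Q1 (mdo_app n P2 f) x)"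
        then have r: "r < n" by simp
        have "mop n k R (comps f) r x = 0"
          unfolding mop_def sop_def using elim(2) r by (intro sum.neutral ballI) auto
        then have "mdo_app n L f x $ r = mop n (Suc d') Q (mop n (Suc k) A2 (comps f)) r x"
          using elim(1) r by (simp add: L_def mdo_app_of)
        also have "\<dots> = mop n (Suc d') Q (comps (mdo_app n P2 f)) r x"
        proof (rule mop_cong)
          fix c assume c: "c < n"
          show "mop n (Suc k) A2 (comps f) c = comps (mdo_app n P2 f) c"
          proof
            fix y show "mop n (Suc k) A2 (comps f) c y = comps (mdo_app n P2 f) c y"
              unfolding comps_def[of "mdo_app n P2 f"] unfolding P2_def mdo_app_of[OF c] ..
          qed
        qed auto
        also have "\<dots> = mdo_app n Q1 (mdo_app n P2 f) x $ r"
          by (simp add: Q1_def mdo_app_of[OF r])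
        finally show "mdo_app n L f x $ r = mdo_app n Q1 (mdo_app n P2 f) x $ r" .
      qed simp
    qed
  qed
  moreover have "\<forall>\<^sub>\<approx>x. \<forall>z. \<Phi> x z = mdo_app_mat n P2 (\<lambda>y. Psi_Airy n \<psi> y z) x"
    using \<Phi> app2
  proof eventually_elim
    case (elim x)
    then show ?case using mdo_app_mat_mult[OF Wc[of x], of P2 x P] by simp
  qed
  moreover have "q \<in> carrier_mat n n" by (simp add: q_def)
  ultimately show ?thesis
    unfolding bispectral_darboux_def using Lr Q1 P2 Li Q1i Wi lP2 by blast
qed

end

theorem theorem1p3:
  fixes n N :: nat
    and \<alpha> :: "nat \<Rightarrow> complex"
    and \<psi>s :: "nat \<Rightarrow> complex \<Rightarrow> complex"
    and \<psi> :: "complex \<Rightarrow> complex"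
  assumes "n > 0" and "N > 0"
    and "\<alpha> 0 \<noteq> 0"
    and "airy_basis N \<alpha> \<psi>s"
    and "\<psi> \<in> airy_kernel N \<alpha>"
  shows "{\<Phi>. bispectral_darboux n N \<alpha> \<psi> \<Phi>} = {\<Phi>. airy_darboux_form n N \<psi>s \<psi> \<Phi>}"
proof -
  interpret airy N \<alpha> \<psi>s by unfold_locales fact+
  show ?thesis using darboux_imp_form form_imp_darboux assms(1) by blast
qed

end
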